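(* Let $G_o$ be a unimodular lcsc group acting jointly continuously on Polish spaces $X_1,\dots,X_r$ with separated cross sections $Z_1,\dots,Z_r$ respectively, and for each $k$ let $\mu_k$ be a $G_o$-invariant Borel probability measure on $X_k$ with transverse measure $\nu_k$ on $Z_k$. Assume that $Z_1,\dots,Z_r$ are commensurable. Then $G_o$ acts diagonally on the generalized intersection space $X^{[r]}$ with separated cross section $Z:=Z_1\times\dots\times Z_r$, and there is a unique finite $G_o$-invariant Borel measure $\mu^{[r]}$ on $X^{[r]}$ whose transverse measure on $Z$ is $\nu_1\otimes\dots\otimes\nu_r$. Moreover, if $\mu_1,\dots,\mu_r$ are $G_o$-ergodic, then, up to a multiplicative constant, $\mu^{[r]}$ is a $G_o$-invariant joining of the measures $\mu_1,\dots,\mu_r$.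
   Context: lcsc = locally compact second countable; $m_{G_o}$ is a fixed Haar measure on $G_o$. For a Borel action of an lcsc group $H$ on a standard Borel space $S$, a Borel set $T\subset S$ is a cross section if $H.T=S$; it is separated if $\{h\in H: h.T\cap T\ne\emptyset\}\cap U=\{e\}$ for some identity neighbourhood $U$ in $H$. For $s\in S$, $T_s:=\{h\in H:h.s\in T\}$. If $T$ is a separated cross section and $\mu$ is a finite $H$-invariant Borel measure on $S$, the transverse measure of $\mu$ on $T$ is the unique Borel measure $\nu$ on $T$ such that for all bounded non-negative Borel $f$ on $H\times T$: $\int_S\sum_{h\in T_s}f(h^{-1},h.s)\,d\mu(s)=\int_H\int_T f(h,t)\,d\nu(t)\,dm_H(h)$. Put $X:=X_1\times\dots\times X_r$, with the product action of $G:=G_o^r$, and $$X^{[r]}:=\{(x_1,\dots,x_r)\in X:\exists g\in G_o:\ g.x_1\in Z_1,\dots,g.x_r\in Z_r\},$$ a Borel subset of $X$. For $k\in\{1,\dots,r\}$ let $N_k<G_o^r$ be the kernel of the $k$-th coordinate projection $G_o^r\to G_o$. The cross sections $Z_1,\dots,Z_r$ are called commensurable if $X^{[r]}$ is a separated cross section for the $N_k$-action on $X$ for every $k\in\{1,\dots,r\}$. A $G_o$-invariant joining of $\mu_1,\dots,\mu_r$ is a Borel probability measure on $X$ invariant under the diagonal $G_o$-action whose projection to $X_k$ is $\mu_k$ for every $k$; measures on $X^{[r]}$ are regarded as measures on $X$. *)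

theory Defs
  imports "HOL-Probability.Probability" "HOL-Algebra.Group_Action" "HOL-Algebra.Product_Groups"
begin

definition polish :: "'a topology \<Rightarrow> bool" where
  "polish X \<longleftrightarrow> completely_metrizable_space X \<and> separable_space X"

definition borel_of :: "'a topology \<Rightarrow> 'a measure" where
  "borel_of X = sigma (topspace X) {U. openin X U}"

text \<open>Standard Borel in Mackey's form: a Borel subset of a Polish space, with the induced
  sigma-algebra.\<close>
definition standard_borel :: "'a measure \<Rightarrow> bool" where
  "standard_borel S \<longleftrightarrow>
    (\<exists>P B. polish P \<and> B \<in> sets (borel_of P) \<and> sets S = sets (restrict_space (borel_of P) B))"

locale lcsc_group = group G for G (structure) +
  fixes T :: "'a topology"
  assumes topspace_eq: "topspace T = carrier G"
    and continuous_mult: "continuous_map (prod_topology T T) T (\<lambda>(g, h). g \<otimes> h)"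
    and continuous_inv: "continuous_map T T (\<lambda>g. inv g)"
    and Hausdorff: "Hausdorff_space T"
    and locally_compact: "locally_compact_space T"
    and second_countable: "second_countable T"

text \<open>No regularity clause is needed: on a second countable locally compact Hausdorff space every
  Borel measure that is finite on compact sets is Radon.\<close>
definition haar_measure :: "('g, 'b) monoid_scheme \<Rightarrow> 'g topology \<Rightarrow> 'g measure \<Rightarrow> bool" where
  "haar_measure G T m \<longleftrightarrow>
    sets m = sets (borel_of T) \<and>
    emeasure m (carrier G) \<noteq> 0 \<and>
    (\<forall>K. compactin T K \<longrightarrow> emeasure m K < \<infinity>) \<and>
    (\<forall>g\<in>carrier G. \<forall>A\<in>sets m. emeasure m (g <#\<^bsub>G\<^esub> A) = emeasure m A)"

definition unimodular :: "('g, 'b) monoid_scheme \<Rightarrow> 'g topology \<Rightarrow> bool" where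
  "unimodular G T \<longleftrightarrow>
    (\<forall>m. haar_measure G T m \<longrightarrow>
      (\<forall>g\<in>carrier G. \<forall>A\<in>sets m. emeasure m (A #>\<^bsub>G\<^esub> g) = emeasure m A))"

text \<open>The maps \<open>\<phi> g\<close> of a group action are extensional, that is, \<open>undefined\<close> off the space
  acted upon; hence the restricted abstractions in the product and diagonal actions below.\<close>

definition borel_action ::
  "('g, 'b) monoid_scheme \<Rightarrow> 'g topology \<Rightarrow> 's measure \<Rightarrow> ('g \<Rightarrow> 's \<Rightarrow> 's) \<Rightarrow> bool" where
  "borel_action H T S \<phi> \<longleftrightarrow>
    lcsc_group H T \<and> standard_borel S \<and> group_action H (space S) \<phi> \<and>
    (\<lambda>(h, s). \<phi> h s) \<in> borel_of T \<Otimes>\<^sub>M S \<rightarrow>\<^sub>M S"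

definition jointly_continuous_action ::
  "('g, 'b) monoid_scheme \<Rightarrow> 'g topology \<Rightarrow> 's topology \<Rightarrow> ('g \<Rightarrow> 's \<Rightarrow> 's) \<Rightarrow> bool" where
  "jointly_continuous_action H T X \<phi> \<longleftrightarrow>
    group_action H (topspace X) \<phi> \<and>
    continuous_map (prod_topology T X) X (\<lambda>(h, x). \<phi> h x)"

definition separated_cross_section ::
  "('g, 'b) monoid_scheme \<Rightarrow> 'g topology \<Rightarrow> 's measure \<Rightarrow> ('g \<Rightarrow> 's \<Rightarrow> 's) \<Rightarrow> 's set \<Rightarrow> bool" where
  "separated_cross_section H T S \<phi> Z \<longleftrightarrow>
    Z \<in> sets S \<and>
    (\<Union>h\<in>carrier H. \<phi> h ` Z) = space S \<and>
    (\<exists>U. openin T U \<and> \<one>\<^bsub>H\<^esub> \<in> U \<and> {h \<in> carrier H. \<phi> h ` Z \<inter> Z \<noteq> {}} \<inter> U = {\<one>\<^bsub>H\<^esub>})"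

definition invariant_measure ::
  "('g, 'b) monoid_scheme \<Rightarrow> ('g \<Rightarrow> 's \<Rightarrow> 's) \<Rightarrow> 's measure \<Rightarrow> bool" where
  "invariant_measure H \<phi> \<mu> \<longleftrightarrow> (\<forall>h\<in>carrier H. distr \<mu> \<mu> (\<phi> h) = \<mu>)"

definition return_set ::
  "('g, 'b) monoid_scheme \<Rightarrow> ('g \<Rightarrow> 's \<Rightarrow> 's) \<Rightarrow> 's set \<Rightarrow> 's \<Rightarrow> 'g set" where
  "return_set H \<phi> Z s = {h \<in> carrier H. \<phi> h s \<in> Z}"

text \<open>This is a predicate rather than a function because the identity, which is between values in
  \<open>[0, \<infinity>]\<close>, determines \<open>\<nu>\<close>: test it on products of an indicator of a set of finite positive
  Haar measure and an indicator of a Borel subset of \<open>Z\<close>.\<close>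
definition transverse_measure ::
  "('g, 'b) monoid_scheme \<Rightarrow> 'g topology \<Rightarrow> 'g measure \<Rightarrow> 's measure \<Rightarrow> ('g \<Rightarrow> 's \<Rightarrow> 's) \<Rightarrow> 's set
    \<Rightarrow> 's measure \<Rightarrow> 's measure \<Rightarrow> bool" where
  "transverse_measure H T m S \<phi> Z \<mu> \<nu> \<longleftrightarrow>
    sets \<nu> = sets (restrict_space S Z) \<and>
    (\<forall>f :: 'g \<times> 's \<Rightarrow> real.
      f \<in> borel_measurable (borel_of T \<Otimes>\<^sub>M restrict_space S Z) \<longrightarrow>
      (\<forall>p\<in>carrier H \<times> Z. 0 \<le> f p) \<longrightarrow>
      bounded (f ` (carrier H \<times> Z)) \<longrightarrow>
      (\<integral>\<^sup>+ s. (\<Sum>\<^sub>\<infinity>h\<in>return_set H \<phi> Z s. ennreal (f (inv\<^bsub>H\<^esub> h, \<phi> h s))) \<partial>\<mu>) =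
      (\<integral>\<^sup>+ h. (\<integral>\<^sup>+ t. ennreal (f (h, t)) \<partial>\<nu>) \<partial>m))"

definition ergodic ::
  "('g, 'b) monoid_scheme \<Rightarrow> ('g \<Rightarrow> 's \<Rightarrow> 's) \<Rightarrow> 's measure \<Rightarrow> bool" where
  "ergodic H \<phi> \<mu> \<longleftrightarrow>
    (\<forall>A\<in>sets \<mu>. (\<forall>h\<in>carrier H. \<phi> h ` A = A) \<longrightarrow>
      emeasure \<mu> A = 0 \<or> emeasure \<mu> (space \<mu> - A) = 0)"

text \<open>Tuples indexed by \<open>{1..r}\<close> are extensional functions on \<open>{1..r}\<close>.\<close>

abbreviation product_space :: "nat \<Rightarrow> (nat \<Rightarrow> 'x topology) \<Rightarrow> (nat \<Rightarrow> 'x) topology" where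
  "product_space r X \<equiv> product_topology X {1..r}"

definition product_action ::
  "nat \<Rightarrow> (nat \<Rightarrow> 'x topology) \<Rightarrow> (nat \<Rightarrow> 'g \<Rightarrow> 'x \<Rightarrow> 'x) \<Rightarrow> (nat \<Rightarrow> 'g) \<Rightarrow> (nat \<Rightarrow> 'x) \<Rightarrow> (nat \<Rightarrow> 'x)"
  where
  "product_action r X \<phi> g = (\<lambda>x\<in>topspace (product_space r X). \<lambda>k\<in>{1..r}. \<phi> k (g k) (x k))"

definition diagonal_action ::
  "nat \<Rightarrow> (nat \<Rightarrow> 'g \<Rightarrow> 'x \<Rightarrow> 'x) \<Rightarrow> (nat \<Rightarrow> 'x) set \<Rightarrow> 'g \<Rightarrow> (nat \<Rightarrow> 'x) \<Rightarrow> (nat \<Rightarrow> 'x)" where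
  "diagonal_action r \<phi> Y g = (\<lambda>x\<in>Y. \<lambda>k\<in>{1..r}. \<phi> k g (x k))"

definition intersection_space ::
  "('g, 'b) monoid_scheme \<Rightarrow> nat \<Rightarrow> (nat \<Rightarrow> 'x topology) \<Rightarrow> (nat \<Rightarrow> 'g \<Rightarrow> 'x \<Rightarrow> 'x) \<Rightarrow> (nat \<Rightarrow> 'x set)
    \<Rightarrow> (nat \<Rightarrow> 'x) set" where
  "intersection_space G r X \<phi> Z =
    {x \<in> topspace (product_space r X). \<exists>g\<in>carrier G. \<forall>k\<in>{1..r}. \<phi> k g (x k) \<in> Z k}"

definition intersection_borel ::
  "('g, 'b) monoid_scheme \<Rightarrow> nat \<Rightarrow> (nat \<Rightarrow> 'x topology) \<Rightarrow> (nat \<Rightarrow> 'g \<Rightarrow> 'x \<Rightarrow> 'x) \<Rightarrow> (nat \<Rightarrow> 'x set)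
    \<Rightarrow> (nat \<Rightarrow> 'x) measure" where
  "intersection_borel G r X \<phi> Z =
    restrict_space (borel_of (product_space r X)) (intersection_space G r X \<phi> Z)"

definition power_group :: "nat \<Rightarrow> ('g, 'b) monoid_scheme \<Rightarrow> (nat \<Rightarrow> 'g) monoid" where
  "power_group r G = product_group {1..r} (\<lambda>_. G)"

definition coordinate_kernel ::
  "nat \<Rightarrow> ('g, 'b) monoid_scheme \<Rightarrow> nat \<Rightarrow> (nat \<Rightarrow> 'g) set" where
  "coordinate_kernel r G k = kernel (power_group r G) G (\<lambda>g. g k)"

definition commensurable ::
  "('g, 'b) monoid_scheme \<Rightarrow> 'g topology \<Rightarrow> nat \<Rightarrow> (nat \<Rightarrow> 'x topology) \<Rightarrow> (nat \<Rightarrow> 'g \<Rightarrow> 'x \<Rightarrow> 'x)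
    \<Rightarrow> (nat \<Rightarrow> 'x set) \<Rightarrow> bool" where
  "commensurable G T r X \<phi> Z \<longleftrightarrow>
    (\<forall>k\<in>{1..r}.
      separated_cross_section
        ((power_group r G)\<lparr>carrier := coordinate_kernel r G k\<rparr>)
        (subtopology (product_topology (\<lambda>_. T) {1..r}) (coordinate_kernel r G k))
        (borel_of (product_space r X))
        (product_action r X \<phi>)
        (intersection_space G r X \<phi> Z))"

definition joining ::
  "('g, 'b) monoid_scheme \<Rightarrow> nat \<Rightarrow> (nat \<Rightarrow> 'x topology) \<Rightarrow> (nat \<Rightarrow> 'g \<Rightarrow> 'x \<Rightarrow> 'x) \<Rightarrow> (nat \<Rightarrow> 'x measure)
    \<Rightarrow> (nat \<Rightarrow> 'x) measure \<Rightarrow> bool" where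
  "joining G r X \<phi> \<mu> \<Lambda> \<longleftrightarrow>
    sets \<Lambda> = sets (borel_of (product_space r X)) \<and>
    prob_space \<Lambda> \<and>
    invariant_measure G (diagonal_action r \<phi> (topspace (product_space r X))) \<Lambda> \<and>
    (\<forall>k\<in>{1..r}. distr \<Lambda> (borel_of (X k)) (\<lambda>x. x k) = \<mu> k)"

end

theory Submission
  imports Defs
begin

text \<open>A finite measure \<open>\<nu>\<close> on the cross section determines the invariant measure: choosing one
  return time for every point gives a fundamental domain in \<open>G \<times> Z\<close>, and the invariant measure is
  the image of \<open>m \<otimes> \<nu>\<close> restricted to it. That the result has transverse measure \<open>\<nu>\<close> is a mass
  transport principle, that is, invariance of \<open>m \<otimes> \<nu>\<close> under the equivalence relation of having
  the same image. For \<open>\<nu> = \<nu>\<^sub>1 \<otimes> \<dots> \<otimes> \<nu>\<^sub>r\<close> it is obtained by thickening \<open>G\<close> to a neighbourhood of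
  the diagonal in \<open>G\<^sup>r\<close> (by right translates, so that unimodularity makes the thickness constant)
  and pushing everything down to the product of the measures \<open>\<mu>\<^sub>k\<close>, of which \<open>m\<^sup>r \<otimes> \<nu>\<close> is the lift.
  If the thickening is so small that commensurability makes the map to the product injective, the
  same computation bounds the marginals of the new measure by multiples of the \<open>\<mu>\<^sub>k\<close>; this gives
  finiteness, and under ergodicity the marginals are proportional to the \<open>\<mu>\<^sub>k\<close>.

  The sums over return times are measurable by the theorem of Lusin and Souslin on injective images
  of Borel sets.\<close>

section \<open>Borel sets of abstract topologies\<close>

text \<open>A return set is countable but comes without an enumeration that depends measurably on
  the point, while sums over return sets are the only access to a transverse measure. Small
  translates of an identity neighbourhood, on each of which the action map is injective, cut the
  return sets into Borel branches. This is where descriptive set theory enters; afterwards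
  everything is integration of series.

  For several flows, a tuple of return times h_j of points x_j yields a point above the intersection
  space once a reference index k is fixed: its group coordinate is inv h_k, and its image has the
  coordinates (inv h_k h_j) x_j. For given x this image depends on the quotients inv h_k h_j alone.
  So does the thickening, and therefore it leaves mass transport as a mere constant, the product of
  the m(V_j) with j \<noteq> k. The same constant appears in the bound of the k-th marginal. Every k
  may serve as reference index there, although the measure itself is built with one fixed index. The
  total mass is nonzero because every point has a return time, so no \<nu>_k vanishes.\<close>

lemma space_borel_of [simp]: "space (borel_of P) = topspace P"
  unfolding borel_of_def by (auto intro!: space_measure_of openin_subset[THEN subsetD])

lemma sets_borel_of: "sets (borel_of P) = sigma_sets (topspace P) {U. openin P U}"
  unfolding borel_of_def by (rule sets_measure_of) (auto dest: openin_subset)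

lemma openin_borel_of: "openin P U \<Longrightarrow> U \<in> sets (borel_of P)"
  by (simp add: sets_borel_of sigma_sets.Basic)

lemma closedin_borel_of: "closedin P C \<Longrightarrow> C \<in> sets (borel_of P)"
  by (metis (full_types) Diff_Diff_Int closedin_def closedin_subset inf.absorb2 openin_borel_of
      sets.compl_sets space_borel_of)

lemma continuous_map_measurable:
  assumes "continuous_map P Q f"
  shows "f \<in> borel_of P \<rightarrow>\<^sub>M borel_of Q"
  unfolding borel_of_def[of Q]
proof (rule measurable_measure_of)
  show "{U. openin Q U} \<subseteq> Pow (topspace Q)"
    by (auto dest: openin_subset)
  show "f \<in> space (borel_of P) \<rightarrow> topspace Q"
    using assms by (simp add: continuous_map_def)
  show "f -` U \<inter> space (borel_of P) \<in> sets (borel_of P)" if "U \<in> {U. openin Q U}" for U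
  proof -
    have "f -` U \<inter> topspace P = {x \<in> topspace P. f x \<in> U}"
      by auto
    then show ?thesis
      using that assms by (auto intro!: openin_borel_of simp: continuous_map_def)
  qed
qed

lemma Times_in_borel_of_prod:
  assumes "A \<in> sets (borel_of P)" "B \<in> sets (borel_of Q)"
  shows "A \<times> B \<in> sets (borel_of (prod_topology P Q))"
proof -
  have "fst -` A \<inter> topspace (prod_topology P Q) \<in> sets (borel_of (prod_topology P Q))"
    "snd -` B \<inter> topspace (prod_topology P Q) \<in> sets (borel_of (prod_topology P Q))"
    using measurable_sets[OF continuous_map_measurable[OF continuous_map_fst] assms(1)]
      measurable_sets[OF continuous_map_measurable[OF continuous_map_snd] assms(2)] by auto
  moreover have "A \<subseteq> topspace P" "B \<subseteq> topspace Q"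
    using assms sets.sets_into_space by fastforce+
  then have "A \<times> B = (fst -` A \<inter> topspace (prod_topology P Q)) \<inter> (snd -` B \<inter> topspace (prod_topology P Q))"
    by auto
  ultimately show ?thesis
    by (metis sets.Int)
qed

section \<open>Codings of Borel sets and images of injective maps\<close>

text \<open>Digits of codes are often first indices with some property. This form writes their level
  sets as finite Boolean combinations of membership conditions, hence as Borel sets.\<close>

lemma Least_eq_iff:
  fixes P :: "nat \<Rightarrow> bool"
  assumes "\<exists>i. P i"
  shows "(LEAST i. P i) = n \<longleftrightarrow> P n \<and> (\<forall>m<n. \<not> P m)"
  using assms by (metis LeastI Least_equality linorder_le_less_linear not_less_Least)

text \<open>Codes in the Baire space. A branch all of whose cylinder sets are nonempty converges to a
  point of \<open>A\<close>, but this point need not lie in the cylinder sets.\<close>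

definition coding :: "'a topology \<Rightarrow> 'a set \<Rightarrow> (nat \<Rightarrow> 'a \<Rightarrow> nat) \<Rightarrow> bool" where
  "coding P A c \<longleftrightarrow> A \<subseteq> topspace P \<and> (\<forall>j n. {x \<in> A. c j x = n} \<in> sets (borel_of P)) \<and>
    (\<forall>\<alpha>. (\<forall>n. \<exists>x\<in>A. \<forall>j<n. c j x = \<alpha> j) \<longrightarrow>
      (\<exists>p\<in>A. \<forall>W. openin P W \<and> p \<in> W \<longrightarrow> (\<exists>n. \<forall>x\<in>A. (\<forall>j<n. c j x = \<alpha> j) \<longrightarrow> x \<in> W)))"

definition coded :: "'a topology \<Rightarrow> 'a set \<Rightarrow> bool" where
  "coded P A \<longleftrightarrow> (\<exists>c. coding P A c)"

section \<open>Elementary facts about codings and their stability under set operations\<close>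

lemma coding_limit:
  assumes "coding P A c" "\<And>n. \<exists>x\<in>A. \<forall>j<n. c j x = \<alpha> j"
  obtains p where "p \<in> A"
    "\<And>W. openin P W \<Longrightarrow> p \<in> W \<Longrightarrow> \<exists>n. \<forall>x\<in>A. (\<forall>j<n. c j x = \<alpha> j) \<longrightarrow> x \<in> W"
proof -
  have "\<exists>p\<in>A. \<forall>W. openin P W \<and> p \<in> W \<longrightarrow> (\<exists>n. \<forall>x\<in>A. (\<forall>j<n. c j x = \<alpha> j) \<longrightarrow> x \<in> W)"
    using assms unfolding coding_def by blast
  then obtain p where "p \<in> A" "\<forall>W. openin P W \<and> p \<in> W \<longrightarrow> (\<exists>n. \<forall>x\<in>A. (\<forall>j<n. c j x = \<alpha> j) \<longrightarrow> x \<in> W)"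
    by (elim bexE)
  then show ?thesis
    by (intro that[of p]) (simp_all only:)
qed

lemma coding_sets: "coding P A c \<Longrightarrow> {x \<in> A. c j x = n} \<in> sets (borel_of P)"
  unfolding coding_def by blast

lemma coding_subset: "coding P A c \<Longrightarrow> A \<subseteq> topspace P"
  unfolding coding_def by blast

lemma coded_subset: "coded P A \<Longrightarrow> A \<subseteq> topspace P"
  unfolding coded_def using coding_subset by (elim exE)

lemma codingI:
  assumes "A \<subseteq> topspace P" "\<And>j n. {x \<in> A. c j x = n} \<in> sets (borel_of P)"
    "\<And>\<alpha>. (\<And>n. \<exists>x\<in>A. \<forall>j<n. c j x = \<alpha> j) \<Longrightarrow>
      \<exists>p\<in>A. \<forall>W. openin P W \<and> p \<in> W \<longrightarrow> (\<exists>n. \<forall>x\<in>A. (\<forall>j<n. c j x = \<alpha> j) \<longrightarrow> x \<in> W)"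
  shows "coding P A c"
  using assms unfolding coding_def by blast

lemma coding_in_sets:
  assumes "coding P A c"
  shows "A \<in> sets (borel_of P)"
proof -
  have "A = (\<Union>n. {x \<in> A. c 0 x = n})"
    by auto
  then show ?thesis
    using coding_sets[OF assms, of 0] by (metis (no_types, lifting) countable_Un_Int(1) image_subsetI)
qed

lemma coding_cylinder_sets:
  assumes "coding P A c"
  shows "{x \<in> A. \<forall>j<n. c j x = \<alpha> j} \<in> sets (borel_of P)"
proof (induction n)
  case 0
  then show ?case using coding_in_sets[OF assms] by simp
next
  case (Suc n)
  have "{x \<in> A. \<forall>j<Suc n. c j x = \<alpha> j} = {x \<in> A. \<forall>j<n. c j x = \<alpha> j} \<inter> {x \<in> A. c n x = \<alpha> n}"
    by (auto simp: less_Suc_eq)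
  then show ?case
    using sets.Int[OF Suc coding_sets[OF assms]] by (simp only:)
qed

text \<open>All codes are interleaved through \<open>prod_decode\<close>, so a branch of the
  combined code contains a branch of every single one. The limits obtained in the different sets
  coincide: disjoint neighbourhoods of two of them would both contain some cylinder of the combined
  code, and these cylinders are nonempty. The common limit therefore lies in the
  intersection.\<close>

lemma coded_INT:
  assumes H: "Hausdorff_space P" and A: "\<And>i::nat. coded P (A i)"
  shows "coded P (\<Inter>i. A i)"
proof -
  obtain c where c: "\<And>i. coding P (A i) (c i)"
    using A unfolding coded_def by metis
  define d where "d = (\<lambda>j. case prod_decode j of (i, k) \<Rightarrow> c i k)"
  have "coding P (\<Inter>i. A i) d"
  proof (rule codingI)
    show "(\<Inter>i. A i) \<subseteq> topspace P"
      using coding_subset[OF c] by blast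
    show "{x \<in> (\<Inter>i. A i). d j x = n} \<in> sets (borel_of P)" for j n
    proof -
      obtain i k where ik: "prod_decode j = (i, k)"
        by fastforce
      have "{x \<in> (\<Inter>i. A i). d j x = n} = (\<Inter>i. A i) \<inter> {x \<in> A i. c i k x = n}"
        by (auto simp: d_def ik)
      then show ?thesis
        using coding_in_sets[OF c] coding_sets[OF c] by (auto intro!: sets.countable_INT)
    qed
    fix \<alpha> assume ne: "\<And>n. \<exists>x\<in>(\<Inter>i. A i). \<forall>j<n. d j x = \<alpha> j"
    define \<beta> where "\<beta> i k = \<alpha> (prod_encode (i, k))" for i k
    \<comment> \<open>Finitely many digits of code i are read off from a long enough initial segment
      of the combined code.\<close>
    have bd: "\<exists>N. \<forall>k<n. prod_encode (i, k) < N" for i n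
      using finite_nat_set_iff_bounded[of "(\<lambda>k. prod_encode (i, k)) ` {..<n}"] by auto
    have cyl: "\<exists>N. \<forall>x. (\<forall>j<N. d j x = \<alpha> j) \<longrightarrow> (\<forall>k<n. c i k x = \<beta> i k)" for i n
    proof -
      obtain N where "\<forall>k<n. prod_encode (i, k) < N" using bd by blast
      moreover have "d (prod_encode (i, k)) = c i k" for k
        by (simp add: d_def)
      ultimately show ?thesis
        unfolding \<beta>_def by metis
    qed
    have "\<exists>p\<in>A i. \<forall>W. openin P W \<and> p \<in> W \<longrightarrow> (\<exists>n. \<forall>x\<in>A i. (\<forall>j<n. c i j x = \<beta> i j) \<longrightarrow> x \<in> W)" for i
    proof -
      have "\<exists>x\<in>A i. \<forall>j<n. c i j x = \<beta> i j" for n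
      proof -
        obtain N where N: "\<forall>x. (\<forall>j<N. d j x = \<alpha> j) \<longrightarrow> (\<forall>k<n. c i k x = \<beta> i k)"
          using cyl by blast
        obtain x where "x \<in> (\<Inter>i. A i)" "\<forall>j<N. d j x = \<alpha> j"
          using ne[of N] by (elim bexE)
        then show ?thesis
          using N by (intro bexI[of _ x]) auto
      qed
      then obtain p where "p \<in> A i"
        "\<And>W. openin P W \<Longrightarrow> p \<in> W \<Longrightarrow> \<exists>n. \<forall>x\<in>A i. (\<forall>j<n. c i j x = \<beta> i j) \<longrightarrow> x \<in> W"
        by (rule coding_limit[OF c]) (rule that)
      then show ?thesis
        by (intro bexI[of _ p]) auto
    qed
    then obtain p where p: "\<And>i. p i \<in> A i"
      and pW: "\<And>i W. openin P W \<Longrightarrow> p i \<in> W \<Longrightarrow> \<exists>n. \<forall>x\<in>A i. (\<forall>j<n. c i j x = \<beta> i j) \<longrightarrow> x \<in> W"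
      by metis
    have pW': "\<exists>n. \<forall>x\<in>\<Inter> (range A). (\<forall>j<n. d j x = \<alpha> j) \<longrightarrow> x \<in> W"
      if "openin P W" "p i \<in> W" for i W
    proof -
      obtain n where "\<forall>x\<in>A i. (\<forall>j<n. c i j x = \<beta> i j) \<longrightarrow> x \<in> W"
        using pW \<open>openin P W\<close> \<open>p i \<in> W\<close> by blast
      then show ?thesis
        using cyl[of n i] by blast
    qed
    have "p i = p 0" for i
    proof (rule ccontr)
      assume "p i \<noteq> p 0"
      moreover have "p i \<in> topspace P" "p 0 \<in> topspace P"
        using p coding_subset[OF c] by blast+
      ultimately obtain U V where UV: "openin P U" "openin P V" "p i \<in> U" "p 0 \<in> V" "disjnt U V"
        using H unfolding Hausdorff_space_def by metis
      obtain n1 where n1: "\<forall>x\<in>\<Inter> (range A). (\<forall>j<n1. d j x = \<alpha> j) \<longrightarrow> x \<in> U"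
        by (rule exE[OF pW'[OF UV(1,3)]])
      obtain n2 where n2: "\<forall>x\<in>\<Inter> (range A). (\<forall>j<n2. d j x = \<alpha> j) \<longrightarrow> x \<in> V"
        by (rule exE[OF pW'[OF UV(2,4)]])
      obtain x where "x \<in> \<Inter> (range A)" "\<forall>j<max n1 n2. d j x = \<alpha> j"
        using ne by blast
      then have "x \<in> U" "x \<in> V"
        using n1 n2 by auto
      then show False
        using UV(5) by (auto simp: disjnt_iff)
    qed
    then have "p 0 \<in> (\<Inter>i. A i)"
      using p by (metis INT_I)
    then show "\<exists>p\<in>\<Inter> (range A). \<forall>W. openin P W \<and> p \<in> W \<longrightarrow>
        (\<exists>n. \<forall>x\<in>\<Inter> (range A). (\<forall>j<n. d j x = \<alpha> j) \<longrightarrow> x \<in> W)"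
      using pW' by blast
  qed
  then show ?thesis
    unfolding coded_def by blast
qed

text \<open>Digit 0 names the piece that contains the point, so a branch stays in one piece and
  converges there. Disjointness makes the level sets of this digit the pieces themselves, hence
  Borel.\<close>

lemma coded_disjoint_UN:
  assumes A: "\<And>i::nat. coded P (A i)" and disj: "disjoint_family A"
  shows "coded P (\<Union>i. A i)"
proof -
  obtain c where c: "\<And>i. coding P (A i) (c i)"
    using A unfolding coded_def by metis
  define \<iota> where "\<iota> x = (SOME i. x \<in> A i)" for x
  have \<iota>: "\<iota> x = i" if "x \<in> A i" for x i
    using disj that someI[of "\<lambda>i. x \<in> A i" i] unfolding \<iota>_def disjoint_family_on_def by blast
  define d where "d j x = (case j of 0 \<Rightarrow> \<iota> x | Suc k \<Rightarrow> c (\<iota> x) k x)" for j x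
  have "coding P (\<Union>i. A i) d"
  proof (rule codingI)
    show "(\<Union>i. A i) \<subseteq> topspace P"
      using coding_subset[OF c] by blast
    show "{x \<in> (\<Union>i. A i). d j x = n} \<in> sets (borel_of P)" for j n
    proof (cases j)
      case 0
      then have "{x \<in> (\<Union>i. A i). d j x = n} = A n"
        by (auto simp: d_def \<iota>)
      then show ?thesis
        using coding_in_sets[OF c] by simp
    next
      case (Suc k)
      then have "{x \<in> (\<Union>i. A i). d j x = n} = (\<Union>i. {x \<in> A i. c i k x = n})"
        by (auto simp: d_def \<iota>)
      then show ?thesis
        using coding_sets[OF c] by auto
    qed
    fix \<alpha> assume ne: "\<And>n. \<exists>x\<in>(\<Union>i. A i). \<forall>j<n. d j x = \<alpha> j"
    let ?i = "\<alpha> 0"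
    have cyl: "x \<in> A ?i \<and> (\<forall>k<n. c ?i k x = \<alpha> (Suc k))"
      if "x \<in> (\<Union>i. A i)" "\<forall>j<Suc n. d j x = \<alpha> j" for x n
    proof -
      have "\<iota> x = ?i"
        using that(2) by (auto simp: d_def)
      then have "x \<in> A ?i"
        using that(1) \<iota> by auto
      moreover have "c ?i k x = \<alpha> (Suc k)" if "k < n" for k
        using \<open>\<forall>j<Suc n. d j x = \<alpha> j\<close>[rule_format, of "Suc k"] that \<open>\<iota> x = ?i\<close> by (simp add: d_def)
      ultimately show ?thesis by blast
    qed
    have ne': "\<exists>x\<in>A ?i. \<forall>k<n. c ?i k x = \<alpha> (Suc k)" for n
      using ne[of "Suc n"] cyl by blast
    obtain p where "p \<in> A ?i" and
      pW: "\<And>W. openin P W \<Longrightarrow> p \<in> W \<Longrightarrow> \<exists>n. \<forall>x\<in>A ?i. (\<forall>k<n. c ?i k x = \<alpha> (Suc k)) \<longrightarrow> x \<in> W"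
      by (rule coding_limit[OF c ne']) (rule that)
    have "\<exists>n. \<forall>x\<in>(\<Union>i. A i). (\<forall>j<n. d j x = \<alpha> j) \<longrightarrow> x \<in> W" if W: "openin P W" "p \<in> W" for W
    proof -
      obtain n where "\<forall>x\<in>A ?i. (\<forall>k<n. c ?i k x = \<alpha> (Suc k)) \<longrightarrow> x \<in> W"
        by (rule exE[OF pW[OF W]])
      then have "\<forall>x\<in>(\<Union>i. A i). (\<forall>j<Suc n. d j x = \<alpha> j) \<longrightarrow> x \<in> W"
        using cyl by auto
      then show ?thesis ..
    qed
    then show "\<exists>p\<in>(\<Union>i. A i). \<forall>W. openin P W \<and> p \<in> W \<longrightarrow>
        (\<exists>n. \<forall>x\<in>(\<Union>i. A i). (\<forall>j<n. d j x = \<alpha> j) \<longrightarrow> x \<in> W)"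
      using \<open>p \<in> A ?i\<close> by blast
  qed
  then show ?thesis
    unfolding coded_def by blast
qed

text \<open>The digits of the two codes are paired. The second conclusion exhibits a coding whose
  cylinders are rectangles with Borel sides: \<open>borel_injective_image\<close> wants the
  cylinders of its coding to be coded themselves, and for rectangles the first conclusion gives
  this.\<close>

lemma coded_Times:
  assumes "coded P A" "coded Q B"
  shows "coded (prod_topology P Q) (A \<times> B)"
    and "\<exists>c. coding (prod_topology P Q) (A \<times> B) c \<and>
      (\<forall>n \<alpha>. \<exists>A'\<in>sets (borel_of P). \<exists>B'\<in>sets (borel_of Q).
        {x \<in> A \<times> B. \<forall>j<n. c j x = \<alpha> j} = A' \<times> B')"
proof -
  obtain a b where a: "coding P A a" and b: "coding Q B b"
    using assms unfolding coded_def by blast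
  define d where "d j x = prod_encode (a j (fst x), b j (snd x))" for j x
  have d_eq: "d j x = n \<longleftrightarrow> a j (fst x) = fst (prod_decode n) \<and> b j (snd x) = snd (prod_decode n)" for j x n
    unfolding d_def by (metis fst_conv prod.collapse prod_decode_inverse prod_encode_inverse snd_conv)
  have cyl: "{x \<in> A \<times> B. \<forall>j<n. d j x = \<alpha> j} =
      {x \<in> A. \<forall>j<n. a j x = fst (prod_decode (\<alpha> j))} \<times> {x \<in> B. \<forall>j<n. b j x = snd (prod_decode (\<alpha> j))}" for n \<alpha>
    by (auto simp: d_eq)
  have "coding (prod_topology P Q) (A \<times> B) d"
  proof (rule codingI)
    show "A \<times> B \<subseteq> topspace (prod_topology P Q)"
      using coding_subset[OF a] coding_subset[OF b] by auto
    show "{x \<in> A \<times> B. d j x = n} \<in> sets (borel_of (prod_topology P Q))" for j n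
    proof -
      have "{x \<in> A \<times> B. d j x = n} = {x \<in> A. a j x = fst (prod_decode n)} \<times> {x \<in> B. b j x = snd (prod_decode n)}"
        by (auto simp: d_eq)
      then show ?thesis
        by (simp only: Times_in_borel_of_prod[OF coding_sets[OF a] coding_sets[OF b]])
    qed
    fix \<alpha> assume ne: "\<And>n. \<exists>x\<in>A \<times> B. \<forall>j<n. d j x = \<alpha> j"
    have neA: "\<exists>x\<in>A. \<forall>j<n. a j x = fst (prod_decode (\<alpha> j))"
      and neB: "\<exists>x\<in>B. \<forall>j<n. b j x = snd (prod_decode (\<alpha> j))" for n
      using ne[of n] by (auto simp: d_eq)
    obtain p where p: "p \<in> A"
      and pW: "\<And>W. openin P W \<Longrightarrow> p \<in> W \<Longrightarrow> \<exists>n. \<forall>x\<in>A. (\<forall>j<n. a j x = fst (prod_decode (\<alpha> j))) \<longrightarrow> x \<in> W"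
      by (rule coding_limit[OF a neA]) (rule that)
    obtain q where q: "q \<in> B"
      and qW: "\<And>W. openin Q W \<Longrightarrow> q \<in> W \<Longrightarrow> \<exists>n. \<forall>x\<in>B. (\<forall>j<n. b j x = snd (prod_decode (\<alpha> j))) \<longrightarrow> x \<in> W"
      by (rule coding_limit[OF b neB]) (rule that)
    have "\<exists>n. \<forall>x\<in>A \<times> B. (\<forall>j<n. d j x = \<alpha> j) \<longrightarrow> x \<in> W"
      if W: "openin (prod_topology P Q) W" "(p, q) \<in> W" for W
    proof -
      obtain U V where UV: "openin P U" "openin Q V" "p \<in> U" "q \<in> V" "U \<times> V \<subseteq> W"
        using W unfolding openin_prod_topology_alt by metis
      obtain n1 where n1: "\<forall>x\<in>A. (\<forall>j<n1. a j x = fst (prod_decode (\<alpha> j))) \<longrightarrow> x \<in> U"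
        by (rule exE[OF pW[OF UV(1,3)]])
      obtain n2 where n2: "\<forall>x\<in>B. (\<forall>j<n2. b j x = snd (prod_decode (\<alpha> j))) \<longrightarrow> x \<in> V"
        by (rule exE[OF qW[OF UV(2,4)]])
      have "x \<in> W" if x: "x \<in> A \<times> B" "\<forall>j<max n1 n2. d j x = \<alpha> j" for x
      proof -
        have "fst x \<in> U" "snd x \<in> V"
          using x n1 n2 by (auto simp: d_eq)
        then show ?thesis
          using UV(5) by (metis mem_Times_iff subsetD)
      qed
      then show ?thesis by blast
    qed
    then show "\<exists>p\<in>A \<times> B. \<forall>W. openin (prod_topology P Q) W \<and> p \<in> W \<longrightarrow>
        (\<exists>n. \<forall>x\<in>A \<times> B. (\<forall>j<n. d j x = \<alpha> j) \<longrightarrow> x \<in> W)"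
      using p q by blast
  qed
  moreover have "\<exists>A'\<in>sets (borel_of P). \<exists>B'\<in>sets (borel_of Q).
        {x \<in> A \<times> B. \<forall>j<n. d j x = \<alpha> j} = A' \<times> B'" for n \<alpha>
    unfolding cyl
    by (rule bexI[OF bexI[OF refl coding_cylinder_sets[OF b]] coding_cylinder_sets[OF a]])
  ultimately show "coded (prod_topology P Q) (A \<times> B)"
    "\<exists>c. coding (prod_topology P Q) (A \<times> B) c \<and>
      (\<forall>n \<alpha>. \<exists>A'\<in>sets (borel_of P). \<exists>B'\<in>sets (borel_of Q).
        {x \<in> A \<times> B. \<forall>j<n. c j x = \<alpha> j} = A' \<times> B')"
    unfolding coded_def by blast+
qed

text \<open>A limit of points in one of the closed sets stays in that set, so it suffices to record the
  first closed set containing a point.\<close>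

lemma coded_closed_UN:
  assumes M: "coded P (topspace P)" and F: "\<And>i::nat. closedin P (F i)"
  shows "coded P (\<Union>i. F i)"
proof -
  obtain c where c: "coding P (topspace P) c"
    using M unfolding coded_def by blast
  define d where "d j x = (case j of 0 \<Rightarrow> (LEAST i. x \<in> F i) | Suc k \<Rightarrow> c k x)" for j x
  have sub: "(\<Union>i. F i) \<subseteq> topspace P"
    using F closedin_subset by blast
  have B: "F i \<in> sets (borel_of P)" for i
    using F closedin_borel_of by blast
  have "coding P (\<Union>i. F i) d"
  proof (rule codingI[OF sub])
    show "{x \<in> (\<Union>i. F i). d j x = n} \<in> sets (borel_of P)" for j n
    proof (cases j)
      case 0
      have least: "(\<exists>i. x \<in> F i) \<and> (LEAST i. x \<in> F i) = n \<longleftrightarrow> x \<in> F n \<and> (\<forall>m<n. x \<notin> F m)" for x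
        using Least_eq_iff[of "\<lambda>i. x \<in> F i" n] by blast
      have "{x \<in> (\<Union>i. F i). d j x = n} = F n - (\<Union>m<n. F m)"
        using least 0 by (auto simp: d_def)
      moreover have "F n - (\<Union>m<n. F m) \<in> sets (borel_of P)"
        using B by (intro sets.Diff sets.finite_UN) auto
      ultimately show ?thesis
        by (simp only:)
    next
      case (Suc k)
      then have "{x \<in> (\<Union>i. F i). d j x = n} = (\<Union>i. F i) \<inter> {x \<in> topspace P. c k x = n}"
        using sub by (auto simp: d_def)
      moreover have "(\<Union>i. F i) \<in> sets (borel_of P)"
        using B by auto
      ultimately show ?thesis
        using coding_sets[OF c] by auto
    qed
    fix \<alpha> assume ne: "\<And>n. \<exists>x\<in>(\<Union>i. F i). \<forall>j<n. d j x = \<alpha> j"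
    have cyl: "x \<in> F (\<alpha> 0) \<and> (\<forall>k<n. c k x = \<alpha> (Suc k))"
      if "x \<in> (\<Union>i. F i)" "\<forall>j<Suc n. d j x = \<alpha> j" for x n
    proof -
      have "(LEAST i. x \<in> F i) = \<alpha> 0"
        using that(2) by (auto simp: d_def)
      then have "x \<in> F (\<alpha> 0)"
        using that(1) by (metis LeastI UN_E)
      moreover have "c k x = \<alpha> (Suc k)" if "k < n" for k
        using \<open>\<forall>j<Suc n. d j x = \<alpha> j\<close>[rule_format, of "Suc k"] that by (simp add: d_def)
      ultimately show ?thesis by blast
    qed
    have ne': "\<exists>x\<in>F (\<alpha> 0). \<forall>k<n. c k x = \<alpha> (Suc k)" for n
      using ne[of "Suc n"] cyl by blast
    then have ne'': "\<exists>x\<in>topspace P. \<forall>k<n. c k x = \<alpha> (Suc k)" for n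
      using sub by blast
    obtain p where p: "p \<in> topspace P" and
      pW: "\<And>W. openin P W \<Longrightarrow> p \<in> W \<Longrightarrow> \<exists>n. \<forall>x\<in>topspace P. (\<forall>k<n. c k x = \<alpha> (Suc k)) \<longrightarrow> x \<in> W"
      by (rule coding_limit[OF c ne'']) (rule that)
    have "p \<in> F (\<alpha> 0)"
    proof (rule ccontr)
      assume "p \<notin> F (\<alpha> 0)"
      then have "openin P (topspace P - F (\<alpha> 0))" "p \<in> topspace P - F (\<alpha> 0)"
        using F p by auto
      from exE[OF pW[OF this]]
      obtain n where "\<forall>x\<in>topspace P. (\<forall>k<n. c k x = \<alpha> (Suc k)) \<longrightarrow> x \<in> topspace P - F (\<alpha> 0)" .
      then show False
        using ne'[of n] sub by blast
    qed
    moreover have "\<exists>n. \<forall>x\<in>(\<Union>i. F i). (\<forall>j<n. d j x = \<alpha> j) \<longrightarrow> x \<in> W" if W: "openin P W" "p \<in> W" for W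
    proof -
      obtain n where "\<forall>x\<in>topspace P. (\<forall>k<n. c k x = \<alpha> (Suc k)) \<longrightarrow> x \<in> W"
        by (rule exE[OF pW[OF W]])
      then have "\<forall>x\<in>(\<Union>i. F i). (\<forall>j<Suc n. d j x = \<alpha> j) \<longrightarrow> x \<in> W"
        using cyl[of _ n] subsetD[OF sub] by simp
      then show ?thesis ..
    qed
    ultimately show "\<exists>p\<in>(\<Union>i. F i). \<forall>W. openin P W \<and> p \<in> W \<longrightarrow>
        (\<exists>n. \<forall>x\<in>(\<Union>i. F i). (\<forall>j<n. d j x = \<alpha> j) \<longrightarrow> x \<in> W)"
      by blast
  qed
  then show ?thesis
    unfolding coded_def by blast
qed

text \<open>By regularity every point of U lies in a basic open set whose closure is still inside U,
  and there are only countably many such closures.\<close>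

lemma openin_eq_UN_closedin:
  assumes "regular_space P" "second_countable P" "openin P U"
  shows "\<exists>F::nat \<Rightarrow> 'a set. (\<forall>i. closedin P (F i)) \<and> U = (\<Union>i. F i)"
proof -
  obtain \<B> where \<B>: "countable \<B>" "\<And>V. V \<in> \<B> \<Longrightarrow> openin P V"
    "\<And>U x. openin P U \<Longrightarrow> x \<in> U \<Longrightarrow> \<exists>V\<in>\<B>. x \<in> V \<and> V \<subseteq> U"
    using assms(2) unfolding second_countable_def by metis
  \<comment> \<open>The empty set is added so that the family can be enumerated by the naturals even
    when U is empty.\<close>
  define \<C> where "\<C> = insert {} {C. \<exists>V\<in>\<B>. C = P closure_of V \<and> C \<subseteq> U}"
  have "countable \<C>"
  proof -
    have "\<C> \<subseteq> insert {} ((\<lambda>V. P closure_of V) ` \<B>)"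
      unfolding \<C>_def by blast
    then show ?thesis
      using \<B>(1) by (meson countable_image countable_insert countable_subset)
  qed
  moreover have "\<C> \<noteq> {}"
    by (simp add: \<C>_def)
  ultimately have ran: "range (from_nat_into \<C>) = \<C>"
    by (simp add: range_from_nat_into)
  have "U \<subseteq> \<Union>\<C>"
  proof
    fix x assume "x \<in> U"
    then obtain V K where VK: "openin P V" "closedin P K" "x \<in> V" "V \<subseteq> K" "K \<subseteq> U"
      using assms(1,3) unfolding neighbourhood_base_of_closedin[symmetric] neighbourhood_base_of by metis
    then obtain B where "B \<in> \<B>" "x \<in> B" "B \<subseteq> V"
      using \<B>(3) by blast
    moreover have "P closure_of B \<subseteq> U"
      using VK \<open>B \<subseteq> V\<close> by (meson closure_of_minimal order_trans)
    moreover have "x \<in> P closure_of B"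
      using \<B>(2)[OF \<open>B \<in> \<B>\<close>] \<open>x \<in> B\<close> by (meson closure_of_subset openin_subset subsetD)
    ultimately show "x \<in> \<Union>\<C>"
      unfolding \<C>_def by blast
  qed
  moreover have "\<Union>\<C> \<subseteq> U"
    unfolding \<C>_def by auto
  ultimately have "U = (\<Union>i. from_nat_into \<C> i)"
    by (simp only: ran subset_antisym)
  moreover have "closedin P C" if "C \<in> \<C>" for C
    using that unfolding \<C>_def by auto
  ultimately show ?thesis
    using ran by (metis rangeI)
qed

lemma INT_nat_split: "(\<Inter>n. E n) = E 0 \<inter> (\<Inter>m. E (Suc m))"
  by (metis INT_insert UNIV_nat_eq image_image image_insert)

text \<open>The induction over the sigma-algebra treats a set and its complement together, since
  being coded is not visibly stable under complements. Open sets are countable unions of closed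
  ones. For a countable union, the coded complements of the members are what makes it possible to
  disjoin them first.\<close>

lemma coded_borel:
  assumes H: "Hausdorff_space P" and R: "regular_space P" and S: "second_countable P"
    and M: "coded P (topspace P)" and B: "B \<in> sets (borel_of P)"
  shows "coded P B"
proof -
  have cl: "coded P F" if "closedin P F" for F
    using coded_closed_UN[OF M, of "\<lambda>_. F"] that by simp
  have UN: "coded P (\<Union>i. A i)" if A: "\<And>i::nat. coded P (A i)" "\<And>i. coded P (topspace P - A i)" for A
  proof -
    \<comment> \<open>The intersection runs over all naturals, with the whole space at the positions
      from i on, so that \<open>coded_INT\<close> applies.\<close>
    define D where "D i = A i \<inter> (\<Inter>m. if m < i then topspace P - A m else topspace P)" for i
    have sub: "A i \<subseteq> topspace P" for i
      using A(1)[of i] by (rule coded_subset)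
    have "coded P (D i)" for i
    proof -
      have "D i = (\<Inter>n. case n of 0 \<Rightarrow> A i | Suc m \<Rightarrow> (if m < i then topspace P - A m else topspace P))"
        unfolding D_def by (subst INT_nat_split) simp
      moreover have "coded P (case n of 0 \<Rightarrow> A i | Suc m \<Rightarrow> (if m < i then topspace P - A m else topspace P))" for n
        using A M by (cases n) simp_all
      ultimately show ?thesis
        by (simp only: coded_INT[OF H])
    qed
    moreover have "disjoint_family D"
    proof -
      have "D i \<inter> D j = {}" if "i < j" for i j
        unfolding D_def using that by (auto dest!: spec[of _ i])
      then show ?thesis
        unfolding disjoint_family_on_def by (metis inf_commute linorder_neqE_nat)
    qed
    moreover have "(\<Union>i. D i) = (\<Union>i. A i)"
    proof
      show "(\<Union>i. A i) \<subseteq> (\<Union>i. D i)"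
      proof
        fix x assume "x \<in> (\<Union>i. A i)"
        then have ex: "\<exists>i. x \<in> A i" by blast
        then obtain i where i: "x \<in> A i" "\<And>m. m < i \<Longrightarrow> x \<notin> A m"
          by (subst (asm) exists_least_iff) blast
        moreover have "x \<in> topspace P"
          using i(1) sub by blast
        ultimately have "x \<in> D i"
          unfolding D_def by (intro IntI INT_I) (simp_all split: if_splits)
        then show "x \<in> (\<Union>i. D i)" by blast
      qed
    qed (auto simp: D_def)
    ultimately show ?thesis
      using coded_disjoint_UN[of P D] by simp
  qed
  have "B \<in> sigma_sets (topspace P) {U. openin P U}"
    using B by (simp add: sets_borel_of)
  then have "coded P B \<and> coded P (topspace P - B)"
  proof induction
    case (Basic U)
    then have "openin P U" by simp
    then obtain F :: "nat \<Rightarrow> 'a set" where "\<forall>i. closedin P (F i)" "U = (\<Union>i. F i)"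
      using openin_eq_UN_closedin[OF R S] by blast
    then show ?case
      using coded_closed_UN[OF M] cl \<open>openin P U\<close> by (metis closedin_diff closedin_topspace)
  next
    case Empty
    then show ?case using cl M by simp
  next
    case (Compl A)
    have "topspace P - (topspace P - A) = A"
      using Compl.IH by (intro double_diff[OF coded_subset order_refl]) simp
    then show ?case
      using Compl.IH by (simp only: simp_thms)
  next
    case (Union A)
    have "topspace P - (\<Union>i. A i) = (\<Inter>i. topspace P - A i)"
      by auto
    moreover have "coded P (\<Inter>i. topspace P - A i)"
      using Union.IH by (intro coded_INT[OF H]) simp
    moreover have "coded P (\<Union>i. A i)"
      using Union.IH by (intro UN) simp_all
    ultimately show ?case
      by simp
  qed
  then show ?thesis by blast
qed

text \<open>Two countable unions whose members can be separated pairwise can be separated as a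
  whole. Hence an inseparable pair of cylinders has an inseparable pair among its successors, and
  following such pairs produces two branches. The images of their limits are distinct, and disjoint
  neighbourhoods of these images separate long cylinders, a contradiction.\<close>

lemma borel_separation:
  assumes H: "Hausdorff_space Y" and f: "continuous_map P Y f"
    and A: "coded P A" and B: "coded P B" and disj: "f ` A \<inter> f ` B = {}"
  shows "\<exists>C\<in>sets (borel_of Y). f ` A \<subseteq> C \<and> C \<inter> f ` B = {}"
proof (rule ccontr)
  define Sep where "Sep A B \<longleftrightarrow> (\<exists>C\<in>sets (borel_of Y). f ` A \<subseteq> C \<and> C \<inter> f ` B = {})" for A B
  obtain a b where a: "coding P A a" and b: "coding P B b"
    using A B unfolding coded_def by blast
  define CA where "CA n \<alpha> = {x \<in> A. \<forall>j<n. a j x = \<alpha> j}" for n \<alpha>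
  define CB where "CB n \<beta> = {x \<in> B. \<forall>j<n. b j x = \<beta> j}" for n \<beta>
  \<comment> \<open>Intersecting the separating sets over j and then uniting over i keeps the images
    of all \<open>A' i\<close> inside and those of all \<open>B' j\<close> outside.\<close>
  have Sep_UN: "Sep (\<Union>i. A' i) (\<Union>j. B' j)" if "\<And>i j. Sep (A' i) (B' j)" for A' B' :: "nat \<Rightarrow> _"
  proof -
    have "\<forall>i j. \<exists>C\<in>sets (borel_of Y). f ` A' i \<subseteq> C \<and> C \<inter> f ` B' j = {}"
      using that unfolding Sep_def by blast
    then obtain C where C: "\<And>i j. C i j \<in> sets (borel_of Y)" "\<And>i j. f ` A' i \<subseteq> C i j"
      "\<And>i j. C i j \<inter> f ` B' j = {}"
      by metis
    have "(\<Union>i. \<Inter>j. C i j) \<in> sets (borel_of Y)"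
      using C(1) by auto
    moreover have "f ` (\<Union>i. A' i) \<subseteq> (\<Union>i. \<Inter>j. C i j)"
      unfolding image_UN by (intro UN_mono order_refl INT_greatest C(2))
    moreover have "(\<Union>i. \<Inter>j. C i j) \<inter> f ` (\<Union>j. B' j) = {}"
    proof -
      have "y \<notin> f ` B' j" if "y \<in> (\<Inter>j. C i j)" for y i j
        using that C(3)[of i j] by blast
      then show ?thesis
        unfolding image_UN by blast
    qed
    ultimately show ?thesis
      unfolding Sep_def by blast
  qed
  assume "\<not> (\<exists>C\<in>sets (borel_of Y). f ` A \<subseteq> C \<and> C \<inter> f ` B = {})"
  then have "\<not> Sep A B"
    unfolding Sep_def .
  then have base: "\<exists>\<alpha>\<beta>. \<not> Sep (CA 0 (fst \<alpha>\<beta>)) (CB 0 (snd \<alpha>\<beta>))"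
    by (simp add: CA_def CB_def)
  have step: "\<exists>y. \<not> Sep (CA (Suc n) (fst y)) (CB (Suc n) (snd y)) \<and>
      (\<forall>j<n. fst y j = fst x j \<and> snd y j = snd x j)"
    if "\<not> Sep (CA n (fst x)) (CB n (snd x))" for x n
  proof -
    have "CA n (fst x) = (\<Union>i. CA (Suc n) ((fst x)(n := i)))" "CB n (snd x) = (\<Union>i. CB (Suc n) ((snd x)(n := i)))"
      unfolding CA_def CB_def by (auto simp: less_Suc_eq)
    then have "\<not> (\<forall>i j. Sep (CA (Suc n) ((fst x)(n := i))) (CB (Suc n) ((snd x)(n := j))))"
      using that Sep_UN[of "\<lambda>i. CA (Suc n) ((fst x)(n := i))" "\<lambda>j. CB (Suc n) ((snd x)(n := j))"]
      by auto
    then obtain i j where "\<not> Sep (CA (Suc n) ((fst x)(n := i))) (CB (Suc n) ((snd x)(n := j)))"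
      by blast
    then show ?thesis
      by (intro exI[of _ "((fst x)(n := i), (snd x)(n := j))"]) auto
  qed
  obtain s where s: "\<And>n. \<not> Sep (CA n (fst (s n))) (CB n (snd (s n)))"
    and ext: "\<And>n j. j < n \<Longrightarrow> fst (s (Suc n)) j = fst (s n) j \<and> snd (s (Suc n)) j = snd (s n) j"
    using dependent_nat_choice[of "\<lambda>n x. \<not> Sep (CA n (fst x)) (CB n (snd x))"
        "\<lambda>n x y. \<forall>j<n. fst y j = fst x j \<and> snd y j = snd x j", OF base step] by metis
  \<comment> \<open>Digit j is chosen in the step from stage j to stage j + 1 and never changes
    afterwards, so the limit branches are read off diagonally.\<close>
  define \<alpha> where "\<alpha> j = fst (s (Suc j)) j" for j
  define \<beta> where "\<beta> j = snd (s (Suc j)) j" for j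
  have stab: "fst (s n) j = \<alpha> j \<and> snd (s n) j = \<beta> j" if "j < n" for n j
    using that
  proof (induction n)
    case (Suc n)
    then show ?case
      using ext[of j n] by (cases "j = n") (auto simp: \<alpha>_def \<beta>_def)
  qed simp
  have nsep: "\<not> Sep (CA n \<alpha>) (CB n \<beta>)" for n
  proof -
    have "CA n (fst (s n)) = CA n \<alpha>" "CB n (snd (s n)) = CB n \<beta>"
      unfolding CA_def CB_def using stab by auto
    then show ?thesis using s by metis
  qed
  \<comment> \<open>An empty cylinder would be separated by the empty set or by the whole space; so
    both branches have nonempty cylinders and converge.\<close>
  have "CA n \<alpha> \<noteq> {}" "CB n \<beta> \<noteq> {}" for n
  proof -
    have "Sep {} X" for X
      unfolding Sep_def by (intro bexI[of _ "{}"]) auto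
    moreover have "Sep X {}" if "X \<subseteq> A" for X
      using that coding_subset[OF a] f unfolding Sep_def
      by (intro bexI[of _ "topspace Y"]) (auto simp: continuous_map_def openin_borel_of)
    moreover have "CA n \<alpha> \<subseteq> A"
      unfolding CA_def by blast
    ultimately show "CA n \<alpha> \<noteq> {}" "CB n \<beta> \<noteq> {}"
      using nsep[of n] by metis+
  qed
  then have neA: "\<exists>x\<in>A. \<forall>j<n. a j x = \<alpha> j" and neB: "\<exists>x\<in>B. \<forall>j<n. b j x = \<beta> j" for n
    unfolding CA_def CB_def by blast+
  obtain p where p: "p \<in> A" "\<And>W. openin P W \<Longrightarrow> p \<in> W \<Longrightarrow> \<exists>n. \<forall>x\<in>A. (\<forall>j<n. a j x = \<alpha> j) \<longrightarrow> x \<in> W"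
    by (rule coding_limit[OF a neA]) (rule that)
  obtain q where q: "q \<in> B" "\<And>W. openin P W \<Longrightarrow> q \<in> W \<Longrightarrow> \<exists>n. \<forall>x\<in>B. (\<forall>j<n. b j x = \<beta> j) \<longrightarrow> x \<in> W"
    by (rule coding_limit[OF b neB]) (rule that)
  have "f p \<noteq> f q" "f p \<in> topspace Y" "f q \<in> topspace Y"
    using p(1) q(1) disj coding_subset[OF a] coding_subset[OF b] f by (auto simp: continuous_map_def)
  then obtain U V where UV: "openin Y U" "openin Y V" "f p \<in> U" "f q \<in> V" "disjnt U V"
    using H unfolding Hausdorff_space_def by metis
  have "openin P {x \<in> topspace P. f x \<in> U}" "openin P {x \<in> topspace P. f x \<in> V}"
    using f UV by (auto simp: continuous_map_def)
  moreover have "p \<in> topspace P" "q \<in> topspace P"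
    using p(1) q(1) coding_subset[OF a] coding_subset[OF b] by auto
  ultimately have p': "openin P {x \<in> topspace P. f x \<in> U}" "p \<in> {x \<in> topspace P. f x \<in> U}"
    and q': "openin P {x \<in> topspace P. f x \<in> V}" "q \<in> {x \<in> topspace P. f x \<in> V}"
    using UV by simp_all
  obtain n1 where n1: "\<forall>x\<in>A. (\<forall>j<n1. a j x = \<alpha> j) \<longrightarrow> x \<in> {x \<in> topspace P. f x \<in> U}"
    by (rule exE[OF p(2)[OF p']])
  obtain n2 where n2: "\<forall>x\<in>B. (\<forall>j<n2. b j x = \<beta> j) \<longrightarrow> x \<in> {x \<in> topspace P. f x \<in> V}"
    by (rule exE[OF q(2)[OF q']])
  have "f ` CA (max n1 n2) \<alpha> \<subseteq> U" "f ` CB (max n1 n2) \<beta> \<subseteq> V"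
    using n1 n2 unfolding CA_def CB_def by auto
  then have "Sep (CA (max n1 n2) \<alpha>) (CB (max n1 n2) \<beta>)"
    unfolding Sep_def using UV by (intro bexI[of _ U] openin_borel_of) (auto simp: disjnt_iff)
  then show False
    using nsep by blast
qed

text \<open>The Lusin-Souslin theorem. The images of the cylinder sets at one level are separated by
  disjoint Borel sets, and a point lying in one of these sets (and in the closure of the image) at
  every level is the image of the limit of its branch.\<close>

lemma borel_injective_image:
  assumes H: "Hausdorff_space Y" and f: "continuous_map P Y f" and inj: "inj_on f A"
    and c: "coding P A c"
    and cyl: "\<And>n \<alpha>. coded P {x \<in> A. \<forall>j<n. c j x = \<alpha> j}"
  shows "f ` A \<in> sets (borel_of Y)"
proof -
  define C where "C s = {x \<in> A. \<forall>j<length s. c j x = s ! j}" for s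
  have codedC: "coded P (C s)" for s
    unfolding C_def by (rule cyl)
  \<comment> \<open>Injectivity enters here: disjoint cylinders have disjoint images, so
    \<open>borel_separation\<close> applies to them.\<close>
  have "\<exists>B\<in>sets (borel_of Y). C s \<inter> C t = {} \<longrightarrow> f ` C s \<subseteq> B \<and> B \<inter> f ` C t = {}" for s t
  proof (cases "C s \<inter> C t = {}")
    case True
    then have "f ` C s \<inter> f ` C t = {}"
      using inj by (auto simp: C_def inj_on_def)
    then show ?thesis
      using borel_separation[OF H f codedC[of s] codedC[of t]] by (auto elim!: bexE intro: bexI)
  qed auto
  then obtain B where B: "\<And>s t. B s t \<in> sets (borel_of Y)"
    "\<And>s t. C s \<inter> C t = {} \<Longrightarrow> f ` C s \<subseteq> B s t"
    "\<And>s t. C s \<inter> C t = {} \<Longrightarrow> B s t \<inter> f ` C t = {}"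
    by metis
  \<comment> \<open>\<open>B s t\<close> and \<open>B t s\<close> are chosen independently and may
    overlap. Taking the difference makes \<open>E s\<close> and \<open>E t\<close> disjoint whenever
    the cylinders are. Cylinders are indexed by finite lists, so the intersection is
    countable.\<close>
  define E where "E s = Y closure_of (f ` C s) \<inter>
    (\<Inter>t. if C s \<inter> C t = {} then B s t - B t s else topspace Y)" for s
  have E_sets: "E s \<in> sets (borel_of Y)" for s
  proof -
    have "(\<Inter>t. if C s \<inter> C t = {} then B s t - B t s else topspace Y) \<in> sets (borel_of Y)"
      using B(1) by (intro sets.countable_INT') (auto simp: openin_borel_of)
    then show ?thesis
      unfolding E_def by (rule sets.Int[OF closedin_borel_of[OF closedin_closure_of]])
  qed
  have fC: "f ` C s \<subseteq> E s" for s
  proof -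
    have "f ` C s \<subseteq> topspace Y"
      using coding_subset[OF c] f by (auto simp: C_def continuous_map_def)
    moreover have "f ` C s \<subseteq> B s t - B t s" if "C s \<inter> C t = {}" for t
      using B(2)[OF that] B(3)[of t s] that by blast
    ultimately show ?thesis
      unfolding E_def by (intro Int_greatest closure_of_subset INT_greatest) simp_all
  qed
  have meet: "C s \<inter> C t \<noteq> {}" if "y \<in> E s" "y \<in> E t" for s t y
  proof
    assume disj: "C s \<inter> C t = {}"
    have "y \<in> (if C s \<inter> C t = {} then B s t - B t s else topspace Y)"
      using that(1) unfolding E_def by (rule IntD2[THEN INT_D]) simp
    moreover have "y \<in> (if C t \<inter> C s = {} then B t s - B s t else topspace Y)"
      using that(2) unfolding E_def by (rule IntD2[THEN INT_D]) simp
    ultimately show False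
      using disj by (simp add: Int_commute)
  qed
  have "f ` A = (\<Inter>n. \<Union>s\<in>{s. length s = n}. E s)"
  proof (intro Set.set_eqI iffI)
    fix y assume "y \<in> f ` A"
    then obtain x where x: "x \<in> A" "y = f x" by blast
    have "x \<in> C (map (\<lambda>j. c j x) [0..<n])" for n
      using x by (simp add: C_def)
    then show "y \<in> (\<Inter>n. \<Union>s\<in>{s. length s = n}. E s)"
      using fC x(2) by (auto intro!: exI[of _ "map (\<lambda>j. c j x) [0..<n]" for n])
  next
    fix y assume "y \<in> (\<Inter>n. \<Union>s\<in>{s. length s = n}. E s)"
    then have "\<forall>n. \<exists>s. length s = n \<and> y \<in> E s"
      by auto
    then obtain s where s: "\<And>n. length (s n) = n" "\<And>n. y \<in> E (s n)"
      by metis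
    \<comment> \<open>Cylinders whose E-sets share the point y must meet, so the lists found at
      different levels agree where both are defined and form one branch.\<close>
    have compat: "s n ! j = s m ! j" if "j < n" "j < m" for n m j
      using meet[OF s(2) s(2), of n m] that s(1) by (auto simp: C_def)
    define \<alpha> where "\<alpha> j = s (Suc j) ! j" for j
    have Ceq: "C (s n) = {x \<in> A. \<forall>j<n. c j x = \<alpha> j}" for n
      unfolding C_def \<alpha>_def using compat[OF _ lessI, of _ n] s(1) by simp
    have yc: "y \<in> Y closure_of (f ` C (s n))" for n
      using s(2)[of n] unfolding E_def by blast
    then have "C (s n) \<noteq> {}" for n
      by (metis closure_of_empty empty_iff image_empty)
    then have ne: "\<exists>x\<in>A. \<forall>j<n. c j x = \<alpha> j" for n
      unfolding Ceq by blast
    obtain p where p: "p \<in> A"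
      "\<And>W. openin P W \<Longrightarrow> p \<in> W \<Longrightarrow> \<exists>n. \<forall>x\<in>A. (\<forall>j<n. c j x = \<alpha> j) \<longrightarrow> x \<in> W"
      by (rule coding_limit[OF c ne]) (rule that)
    have "y = f p"
    proof (rule ccontr)
      assume "y \<noteq> f p"
      moreover have "f p \<in> topspace Y" "y \<in> topspace Y"
        using p(1) coding_subset[OF c] f yc[of 0] by (auto simp: continuous_map_def in_closure_of)
      ultimately obtain U V where UV: "openin Y U" "openin Y V" "y \<in> U" "f p \<in> V" "disjnt U V"
        using H unfolding Hausdorff_space_def by metis
      have "openin P {x \<in> topspace P. f x \<in> V}" "p \<in> {x \<in> topspace P. f x \<in> V}"
        using f UV p(1) coding_subset[OF c] by (auto simp: continuous_map_def)
      from exE[OF p(2)[OF this]]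
      obtain n where "\<forall>x\<in>A. (\<forall>j<n. c j x = \<alpha> j) \<longrightarrow> x \<in> {x \<in> topspace P. f x \<in> V}" .
      then have "f ` C (s n) \<subseteq> V"
        unfolding Ceq by auto
      then show False
        using yc[of n] UV unfolding in_closure_of disjnt_iff by blast
    qed
    then show "y \<in> f ` A"
      using p(1) by blast
  qed
  moreover have "(\<Inter>n. \<Union>s\<in>{s. length s = n}. E s) \<in> sets (borel_of Y)"
    using E_sets by (intro sets.countable_INT' sets.countable_UN' image_subsetI) auto
  ultimately show ?thesis
    by simp
qed

section \<open>Codings of Polish spaces and of locally compact spaces\<close>

lemma polish_metric:
  assumes "polish P"
  obtains M d C where "Metric_space M d" "Metric_space.mcomplete M d" "P = Metric_space.mtopology M d"
    "countable C" "C \<subseteq> M" "\<And>x e. x \<in> M \<Longrightarrow> e > 0 \<Longrightarrow> \<exists>c\<in>C. d c x < e"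
proof -
  obtain M d where Md: "Metric_space M d" "Metric_space.mcomplete M d" "P = Metric_space.mtopology M d"
    using assms unfolding polish_def completely_metrizable_space_def by blast
  interpret Metric_space M d by fact
  obtain C where C: "countable C" "C \<subseteq> M" "mtopology closure_of C = M"
    using assms Md(3) unfolding polish_def separable_space_def by auto
  have "\<exists>c\<in>C. d c x < e" if "x \<in> M" "e > 0" for x e
  proof -
    have "x \<in> mtopology closure_of C"
      using that C(3) by simp
    then have "\<exists>c\<in>C. c \<in> M \<and> d x c < e"
      using that unfolding metric_closure_of by auto
    then show ?thesis
      by (auto simp: commute)
  qed
  then show ?thesis
    using that[OF Md C(1,2)] by simp
qed

lemma polish_metrizable: "polish P \<Longrightarrow> metrizable_space P"
  unfolding polish_def by (simp add: completely_metrizable_imp_metrizable_space)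

lemma polish_Hausdorff: "polish P \<Longrightarrow> Hausdorff_space P"
  by (simp add: metrizable_imp_Hausdorff_space polish_metrizable)

lemma polish_regular: "polish P \<Longrightarrow> regular_space P"
  by (simp add: metrizable_imp_regular_space polish_metrizable)

lemma polish_second_countable:
  assumes "polish P"
  shows "second_countable P"
proof -
  obtain M d C where Md: "Metric_space M d" "P = Metric_space.mtopology M d"
    and C: "countable C" "C \<subseteq> M" and dense: "\<And>x e. x \<in> M \<Longrightarrow> e > 0 \<Longrightarrow> \<exists>c\<in>C. d c x < e"
    by (rule polish_metric[OF assms]) (rule that)
  interpret Metric_space M d by fact
  define \<B> where "\<B> = (\<lambda>(c, n). mball c (inverse (real (Suc n)))) ` (C \<times> (UNIV :: nat set))"
  have "\<exists>V\<in>\<B>. x \<in> V \<and> V \<subseteq> U" if U: "openin mtopology U" "x \<in> U" for U x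
  proof -
    obtain r where r: "r > 0" "mball x r \<subseteq> U" and x: "x \<in> M"
      using U unfolding openin_mtopology by blast
    obtain n where n: "inverse (real (Suc n)) < r / 2"
      using reals_Archimedean[of "r / 2"] r by auto
    obtain c where c: "c \<in> C" "d c x < inverse (real (Suc n))"
      using dense[OF x, of "inverse (real (Suc n))"] by auto
    have "mball c (inverse (real (Suc n))) \<subseteq> mball x r"
    proof
      fix y assume y: "y \<in> mball c (inverse (real (Suc n)))"
      then have "d x y \<le> d x c + d c y"
        using x by (intro triangle) auto
      moreover have "d c y < inverse (real (Suc n))"
        using y by auto
      ultimately show "y \<in> mball x r"
        using c n x y by (auto simp: commute)
    qed
    moreover have "x \<in> mball c (inverse (real (Suc n)))"
      using c C x by auto
    ultimately show ?thesis
      unfolding \<B>_def using c(1) r(2) by (intro bexI[of _ "mball c (inverse (real (Suc n)))"]) force+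
  qed
  moreover have "countable \<B>"
    unfolding \<B>_def using C(1) by auto
  moreover have "\<forall>V\<in>\<B>. openin mtopology V"
    unfolding \<B>_def by auto
  ultimately show ?thesis
    unfolding second_countable_def Md(2) by blast
qed

text \<open>Digit j is the first member of a dense sequence within distance 1/(j+1). Points sharing
  the digits 0 to n are less than 2/(n+1) apart, so points chosen from the successive cylinders form
  a Cauchy sequence; completeness provides the limit, to which the cylinders shrink.\<close>

lemma coded_polish:
  assumes "polish P"
  shows "coded P (topspace P)"
proof (cases "topspace P = {}")
  case True
  then have "coding P (topspace P) (\<lambda>_ _. 0)"
    by (simp add: coding_def)
  then show ?thesis
    unfolding coded_def by blast
next
  case False
  obtain M d C where Md: "Metric_space M d" "Metric_space.mcomplete M d" "P = Metric_space.mtopology M d"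
    and C: "countable C" "C \<subseteq> M" and dense: "\<And>x e. x \<in> M \<Longrightarrow> e > 0 \<Longrightarrow> \<exists>c\<in>C. d c x < e"
    by (rule polish_metric[OF assms]) (rule that)
  interpret Metric_space M d by fact
  have "M \<noteq> {}"
    using False Md(3) by simp
  then have "C \<noteq> {}"
    using dense[of _ 1] by fastforce
  define e where "e = from_nat_into C"
  have eC: "range e = C"
    unfolding e_def using C(1) \<open>C \<noteq> {}\<close> by (rule range_from_nat_into[rotated])
  then have eM: "e i \<in> M" for i
    using C(2) by blast
  define \<epsilon> where "\<epsilon> j = inverse (real (Suc j))" for j
  define c where "c j x = (LEAST i. d (e i) x < \<epsilon> j)" for j x
  have ex: "\<exists>i. d (e i) x < \<epsilon> j" if "x \<in> M" for j x
    using dense[OF that, of "\<epsilon> j"] eC unfolding \<epsilon>_def by auto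
  have cd: "d (e (c j x)) x < \<epsilon> j" if "x \<in> M" for j x
    unfolding c_def using ex[OF that] by (rule LeastI_ex)
  have c_eq: "c j x = n \<longleftrightarrow> d (e n) x < \<epsilon> j \<and> (\<forall>m<n. \<not> d (e m) x < \<epsilon> j)" if "x \<in> M" for j x n
    unfolding c_def using ex[OF that] by (rule Least_eq_iff)
  have "coding P M c"
  proof (rule codingI)
    show "M \<subseteq> topspace P"
      using Md(3) by simp
    show "{x \<in> M. c j x = n} \<in> sets (borel_of P)" for j n
    proof -
      have "{x \<in> M. c j x = n} = mball (e n) (\<epsilon> j) - (\<Union>m<n. mball (e m) (\<epsilon> j))"
        using c_eq eM by (auto simp: mball_def)
      moreover have "\<dots> \<in> sets (borel_of P)"
        unfolding Md(3) by (intro sets.Diff sets.finite_UN) (auto intro: openin_borel_of)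
      ultimately show ?thesis
        by (simp only:)
    qed
    fix \<alpha> assume ne: "\<And>n. \<exists>x\<in>M. \<forall>j<n. c j x = \<alpha> j"
    have close: "d x y < 2 * \<epsilon> n" if "x \<in> M" "y \<in> M" "\<forall>j<Suc n. c j x = \<alpha> j" "\<forall>j<Suc n. c j y = \<alpha> j" for x y n
    proof -
      have "d x y \<le> d x (e (\<alpha> n)) + d (e (\<alpha> n)) y"
        using that eM by (intro triangle) auto
      moreover have "d (e (\<alpha> n)) x < \<epsilon> n" "d (e (\<alpha> n)) y < \<epsilon> n"
        using cd[OF that(1), of n] cd[OF that(2), of n] that(3,4) by auto
      ultimately show ?thesis
        by (simp add: commute)
    qed
    have small: "\<exists>n. 2 * \<epsilon> n < r" if "r > 0" for r
      using reals_Archimedean[of "r / 2"] that unfolding \<epsilon>_def by (auto simp: field_simps)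
    have "\<exists>x. \<forall>n. x n \<in> M \<and> (\<forall>j<Suc n. c j (x n) = \<alpha> j)"
      using ne by (intro choice allI) blast
    then obtain x where x: "\<And>n. x n \<in> M" "\<And>n. \<forall>j<Suc n. c j (x n) = \<alpha> j"
      by blast
    have "MCauchy x"
      unfolding MCauchy_def
    proof (intro conjI allI impI)
      show "range x \<subseteq> M"
        using x(1) by blast
      fix r :: real assume "r > 0"
      then obtain N where N: "2 * \<epsilon> N < r"
        using small by blast
      have "d (x n) (x n') < r" if "N \<le> n" "N \<le> n'" for n n'
        using close[OF x(1) x(1), of N n n'] x(2)[of n] x(2)[of n'] N that by auto
      then show "\<exists>N. \<forall>n n'. N \<le> n \<longrightarrow> N \<le> n' \<longrightarrow> d (x n) (x n') < r"
        by blast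
    qed
    then obtain p where p: "limitin mtopology x p sequentially"
      using Md(2) unfolding mcomplete_def by blast
    then have pM: "p \<in> M"
      by (simp add: limitin_metric)
    have "\<exists>n. \<forall>y\<in>M. (\<forall>j<n. c j y = \<alpha> j) \<longrightarrow> y \<in> W" if W: "openin P W" "p \<in> W" for W
    proof -
      obtain r where r: "r > 0" "mball p r \<subseteq> W"
        using W unfolding Md(3) openin_mtopology by blast
      obtain n where n: "2 * \<epsilon> n < r / 2"
        using small[of "r / 2"] r by auto
      have "\<forall>\<^sub>F k in sequentially. x k \<in> M \<and> d (x k) p < r / 2"
        using p half_gt_zero[OF r(1)] unfolding limitin_metric by blast
      then obtain K where K: "\<And>k. k \<ge> K \<Longrightarrow> d (x k) p < r / 2"
        unfolding eventually_sequentially by blast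
      have "y \<in> W" if y: "y \<in> M" "\<forall>j<Suc n. c j y = \<alpha> j" for y
      proof -
        let ?k = "max K n"
        have "d (x ?k) y < r / 2"
          using close[OF x(1) y(1), of n ?k] x(2)[of ?k] y(2) n by auto
        moreover have "d (x ?k) p < r / 2"
          using K by simp
        moreover have "d p y \<le> d p (x ?k) + d (x ?k) y"
          using pM x(1) y(1) by (intro triangle) auto
        ultimately have "d p y < r"
          by (simp add: commute)
        then show ?thesis
          using r(2) pM y(1) by auto
      qed
      then show ?thesis
        by (intro exI[of _ "Suc n"]) simp
    qed
    then show "\<exists>p\<in>M. \<forall>W. openin P W \<and> p \<in> W \<longrightarrow> (\<exists>n. \<forall>x\<in>M. (\<forall>j<n. c j x = \<alpha> j) \<longrightarrow> x \<in> W)"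
      using pM by (intro bexI[of _ p]) simp_all
  qed
  then show ?thesis
    using Md(3) unfolding coded_def by auto
qed

lemma countable_subcover:
  assumes P: "second_countable P" and ne: "topspace P \<noteq> {}"
    and U: "\<And>x. x \<in> topspace P \<Longrightarrow> \<exists>U\<in>\<U>. openin P U \<and> x \<in> U"
  obtains W :: "nat \<Rightarrow> 'a set" where "\<And>i. W i \<in> \<U>" "\<And>i. openin P (W i)" "topspace P = (\<Union>i. W i)"
proof -
  define \<V> where "\<V> = {U\<in>\<U>. openin P U}"
  have "Lindelof_space P"
    using P by (rule second_countable_imp_Lindelof_space)
  moreover have "\<Union>\<V> = topspace P"
    using U unfolding \<V>_def by (auto dest: openin_subset)
  ultimately have "\<exists>\<W>. countable \<W> \<and> \<W> \<subseteq> \<V> \<and> \<Union>\<W> = topspace P"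
    by (intro Lindelof_spaceD) (auto simp: \<V>_def)
  then obtain \<W> where W: "countable \<W>" "\<W> \<subseteq> \<V>" "\<Union>\<W> = topspace P"
    by blast
  have "\<W> \<noteq> {}"
    using W(3) ne by blast
  then have ran: "range (from_nat_into \<W>) = \<W>"
    using W(1) by (rule range_from_nat_into)
  then have in_W: "from_nat_into \<W> i \<in> \<V>" for i
    using W(2) by (metis rangeI subsetD)
  show ?thesis
  proof (rule that[of "from_nat_into \<W>"])
    show "topspace P = (\<Union>i. from_nat_into \<W> i)"
      using W(3) by (simp only: ran)
  qed (use in_W in \<open>simp_all add: \<V>_def\<close>)
qed

text \<open>Compactness takes the place of completeness. Digit 0 names an open set contained in a
  compact one, and the later digits record membership in the sets of a countable base. The closures
  of the cylinders of a branch have the finite intersection property inside that compact set, hence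
  a common point p. The digits that belong to basic neighbourhoods of p then force the cylinders to
  shrink to p.\<close>

lemma coded_locally_compact:
  assumes P: "locally_compact_space P" "second_countable P" and H: "Hausdorff_space P"
  shows "coded P (topspace P)"
proof (cases "topspace P = {}")
  case True
  then have "coding P (topspace P) (\<lambda>_ _. 0)"
    by (simp add: coding_def)
  then show ?thesis
    unfolding coded_def by blast
next
  case False
  obtain \<B> where \<B>: "countable \<B>" "\<And>V. V \<in> \<B> \<Longrightarrow> openin P V"
    "\<And>U x. openin P U \<Longrightarrow> x \<in> U \<Longrightarrow> \<exists>V\<in>\<B>. x \<in> V \<and> V \<subseteq> U"
    using P(2) unfolding second_countable_def by metis
  have "\<B> \<noteq> {}"
    using \<B>(3)[OF openin_topspace] False by blast
  define B where "B = from_nat_into \<B>"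
  have ranB: "range B = \<B>"
    unfolding B_def using \<open>\<B> \<noteq> {}\<close> \<B>(1) by (rule range_from_nat_into)
  then have openB: "openin P (B i)" for i
    using \<B>(2) by blast
  have "\<exists>U\<in>{U. \<exists>K. compactin P K \<and> U \<subseteq> K}. openin P U \<and> x \<in> U" if "x \<in> topspace P" for x
    using P(1)[unfolded locally_compact_space_def, rule_format, OF that] by blast
  then obtain W :: "nat \<Rightarrow> 'a set" where W: "\<And>i. W i \<in> {U. \<exists>K. compactin P K \<and> U \<subseteq> K}" "\<And>i. openin P (W i)"
    "topspace P = (\<Union>i. W i)"
    by (rule countable_subcover[OF P(2) False]) (assumption, rule that)
  have "\<forall>i. \<exists>K. compactin P K \<and> W i \<subseteq> K"
    using W(1) by simp
  then obtain K where K: "\<And>i. compactin P (K i)" "\<And>i. W i \<subseteq> K i"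
    by metis
  define \<iota> where "\<iota> x = (LEAST i. x \<in> W i)" for x
  have \<iota>: "\<iota> x = n \<longleftrightarrow> x \<in> W n \<and> (\<forall>m<n. x \<notin> W m)" if "x \<in> topspace P" for x n
    unfolding \<iota>_def using that W(3) by (intro Least_eq_iff) auto
  define c where "c j x = (case j of 0 \<Rightarrow> \<iota> x | Suc k \<Rightarrow> of_bool (x \<in> B k))" for j x
  have "coding P (topspace P) c"
  proof (rule codingI)
    show "{x \<in> topspace P. c j x = n} \<in> sets (borel_of P)" for j n
    proof (cases j)
      case 0
      have "{x \<in> topspace P. c j x = n} = W n - (\<Union>m<n. W m)"
        using \<iota>[of _ n] openin_subset[OF W(2)[of n]] by (auto simp: c_def 0)
      moreover have "\<dots> \<in> sets (borel_of P)"
        using W(2) by (intro sets.Diff sets.finite_UN) (auto intro: openin_borel_of)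
      ultimately show ?thesis
        by (simp only:)
    next
      case (Suc k)
      have "{x \<in> topspace P. c j x = n} =
          (if n = 1 then B k else if n = 0 then topspace P - B k else {})"
        using openin_subset[OF openB, of k] by (auto simp: c_def Suc)
      moreover have "B k \<in> sets (borel_of P)" "topspace P - B k \<in> sets (borel_of P)"
        using openin_borel_of[OF openB] sets.compl_sets[OF openin_borel_of[OF openB]] by simp_all
      ultimately show ?thesis
        by simp
    qed
    fix \<alpha> assume ne: "\<And>n. \<exists>x\<in>topspace P. \<forall>j<n. c j x = \<alpha> j"
    define D where "D n = {x \<in> topspace P. \<forall>j<Suc n. c j x = \<alpha> j}" for n
    have D_ne: "D n \<noteq> {}" for n
      using ne[of "Suc n"] unfolding D_def by auto
    have D_mono: "D n \<subseteq> D m" if "m \<le> n" for m n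
      using that unfolding D_def by auto
    have D_K: "D n \<subseteq> K (\<alpha> 0)" for n
    proof
      fix x assume "x \<in> D n"
      then have "x \<in> topspace P" "\<iota> x = \<alpha> 0"
        by (auto simp: D_def c_def)
      then show "x \<in> K (\<alpha> 0)"
        using \<iota> K(2) by blast
    qed
    have "K (\<alpha> 0) \<inter> \<Inter>(range (\<lambda>n. P closure_of D n)) \<noteq> {}"
    proof -
      have "K (\<alpha> 0) \<inter> \<Inter>\<F> \<noteq> {}"
        if fin: "finite \<F>" and sub: "\<F> \<subseteq> range (\<lambda>n. P closure_of D n)" for \<F>
      proof -
        obtain N where N: "finite N" "\<F> = (\<lambda>n. P closure_of D n) ` N"
          using finite_subset_image[OF fin sub] by blast
        obtain k where k: "\<forall>n\<in>N. n \<le> k"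
          using N(1) finite_nat_set_iff_bounded_le by blast
        obtain x where x: "x \<in> D k"
          using D_ne[of k] by blast
        have "x \<in> P closure_of D n" if "n \<in> N" for n
        proof -
          have "x \<in> D n"
            using x D_mono[of n k] k that by blast
          moreover have "D n \<subseteq> P closure_of D n"
            by (rule closure_of_subset) (simp add: D_def)
          ultimately show ?thesis by blast
        qed
        then show ?thesis
          using x D_K N(2) by blast
      qed
      moreover have "closedin P C" if "C \<in> range (\<lambda>n. P closure_of D n)" for C
        using that by auto
      ultimately show ?thesis
        using K(1)[of "\<alpha> 0"] unfolding compactin_fip by meson
    qed
    then obtain p where p: "p \<in> K (\<alpha> 0)" "\<And>n. p \<in> P closure_of D n"
      by auto
    have pP: "p \<in> topspace P"
      using p(2)[of 0] by (simp add: in_closure_of)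
    have "\<exists>n. \<forall>x\<in>topspace P. (\<forall>j<n. c j x = \<alpha> j) \<longrightarrow> x \<in> U" if U: "openin P U" "p \<in> U" for U
    proof -
      have "\<exists>V\<in>range B. p \<in> V \<and> V \<subseteq> U"
        unfolding ranB using \<B>(3)[OF U] .
      then obtain k where k: "p \<in> B k" "B k \<subseteq> U"
        by blast
      \<comment> \<open>All points of \<open>D (Suc k)\<close> share the digit \<open>Suc k\<close>,
        the one recording membership in \<open>B k\<close>. Since p is in its closure, one of these
        points lies in \<open>B k\<close>, so the shared digit is 1 and the whole cylinder lies in
        \<open>B k\<close>.\<close>
      then obtain y where y: "y \<in> D (Suc k)" "y \<in> B k"
        using p(2)[of "Suc k"] openB[of k] unfolding in_closure_of by blast
      then have \<alpha>1: "\<alpha> (Suc k) = 1"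
        by (auto simp: D_def c_def)
      have "x \<in> U" if "x \<in> topspace P" "\<forall>j<Suc (Suc k). c j x = \<alpha> j" for x
      proof -
        have "c (Suc k) x = 1"
          using that(2) \<alpha>1 by simp
        then have "x \<in> B k"
          by (cases "x \<in> B k") (simp_all add: c_def)
        then show ?thesis
          using k(2) by blast
      qed
      then show ?thesis
        by (intro exI[of _ "Suc (Suc k)"]) simp
    qed
    then show "\<exists>p\<in>topspace P. \<forall>U. openin P U \<and> p \<in> U \<longrightarrow>
        (\<exists>n. \<forall>x\<in>topspace P. (\<forall>j<n. c j x = \<alpha> j) \<longrightarrow> x \<in> U)"
      using pP by (intro bexI[of _ p]) simp_all
  qed simp
  then show ?thesis
    unfolding coded_def by blast
qed

section \<open>Borel sets of finite products\<close>

lemma second_countable_base: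
  assumes "second_countable P"
  obtains \<B> where "countable \<B>" "\<And>V. V \<in> \<B> \<Longrightarrow> openin P V"
    "\<And>U x. openin P U \<Longrightarrow> x \<in> U \<Longrightarrow> \<exists>V\<in>\<B>. x \<in> V \<and> V \<subseteq> U"
  using assms unfolding second_countable_def by metis

text \<open>Every open set is a countable union of basic ones, so only a countable base has to be
  checked. In the applications it consists of open boxes, which are plainly in the product
  sigma-algebra.\<close>

lemma sets_borel_of_subset:
  assumes \<B>: "countable \<B>" "\<And>V. V \<in> \<B> \<Longrightarrow> V \<in> sets N"
    "\<And>U x. openin P U \<Longrightarrow> x \<in> U \<Longrightarrow> \<exists>V\<in>\<B>. x \<in> V \<and> V \<subseteq> U"
    and N: "space N = topspace P"
  shows "sets (borel_of P) \<subseteq> sets N"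
proof -
  have "U \<in> sets N" if "openin P U" for U
  proof -
    have "U = \<Union>{V\<in>\<B>. V \<subseteq> U}"
      using \<B>(3)[OF that] by auto
    moreover have "\<Union>{V\<in>\<B>. V \<subseteq> U} \<in> sets N"
      using \<B>(1,2) by (intro sets.countable_Union) auto
    ultimately show ?thesis
      by (simp only:)
  qed
  then show ?thesis
    unfolding sets_borel_of N[symmetric] by (intro sets.sigma_sets_subset) auto
qed

lemma sets_borel_of_prod:
  assumes "second_countable P" "second_countable Q"
  shows "sets (borel_of (prod_topology P Q)) = sets (borel_of P \<Otimes>\<^sub>M borel_of Q)"
proof (rule subset_antisym)
  show "sets (borel_of P \<Otimes>\<^sub>M borel_of Q) \<subseteq> sets (borel_of (prod_topology P Q))"
    using Times_in_borel_of_prod by (intro sets_pair_in_sets) blast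
  obtain \<A> where \<A>: "countable \<A>" "\<And>V. V \<in> \<A> \<Longrightarrow> openin P V"
    "\<And>U x. openin P U \<Longrightarrow> x \<in> U \<Longrightarrow> \<exists>V\<in>\<A>. x \<in> V \<and> V \<subseteq> U"
    by (rule second_countable_base[OF assms(1)]) (rule that)
  obtain \<B> where \<B>: "countable \<B>" "\<And>V. V \<in> \<B> \<Longrightarrow> openin Q V"
    "\<And>U x. openin Q U \<Longrightarrow> x \<in> U \<Longrightarrow> \<exists>V\<in>\<B>. x \<in> V \<and> V \<subseteq> U"
    by (rule second_countable_base[OF assms(2)]) (rule that)
  show "sets (borel_of (prod_topology P Q)) \<subseteq> sets (borel_of P \<Otimes>\<^sub>M borel_of Q)"
  proof (rule sets_borel_of_subset[of "(\<lambda>(a, b). a \<times> b) ` (\<A> \<times> \<B>)"])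
    show "countable ((\<lambda>(a, b). a \<times> b) ` (\<A> \<times> \<B>))"
      using \<A>(1) \<B>(1) by auto
    show "V \<in> sets (borel_of P \<Otimes>\<^sub>M borel_of Q)" if "V \<in> (\<lambda>(a, b). a \<times> b) ` (\<A> \<times> \<B>)" for V
      using that \<A>(2) \<B>(2) by (auto intro!: pair_measureI openin_borel_of)
    show "\<exists>V\<in>(\<lambda>(a, b). a \<times> b) ` (\<A> \<times> \<B>). z \<in> V \<and> V \<subseteq> U"
      if U: "openin (prod_topology P Q) U" "z \<in> U" for U z
    proof -
      obtain x y where z: "z = (x, y)" by fastforce
      then obtain A B where AB: "openin P A" "openin Q B" "x \<in> A" "y \<in> B" "A \<times> B \<subseteq> U"
        using U unfolding openin_prod_topology_alt by metis
      obtain A' where A': "A' \<in> \<A>" "x \<in> A'" "A' \<subseteq> A"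
        using \<A>(3)[OF AB(1,3)] by blast
      obtain B' where B': "B' \<in> \<B>" "y \<in> B'" "B' \<subseteq> B"
        using \<B>(3)[OF AB(2,4)] by blast
      have "z \<in> A' \<times> B'" "A' \<times> B' \<subseteq> U"
        using A' B' AB(5) z by auto
      moreover have "A' \<times> B' \<in> (\<lambda>(a, b). a \<times> b) ` (\<A> \<times> \<B>)"
        using A' B' by force
      ultimately show ?thesis
        by (intro bexI[of _ "A' \<times> B'"]) simp_all
    qed
  qed (simp add: space_pair_measure)
qed

lemma finite_product_base:
  assumes I: "finite I" and X: "\<And>i. i \<in> I \<Longrightarrow> second_countable (X i)"
  obtains \<B> where "countable \<B>"
    "\<And>V. V \<in> \<B> \<Longrightarrow> \<exists>U. V = Pi\<^sub>E I U \<and> (\<forall>i\<in>I. openin (X i) (U i))"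
    "\<And>U x. openin (product_topology X I) U \<Longrightarrow> x \<in> U \<Longrightarrow> \<exists>V\<in>\<B>. x \<in> V \<and> V \<subseteq> U"
proof -
  have "\<exists>\<B>. countable \<B> \<and> (\<forall>V\<in>\<B>. openin (X i) V) \<and>
      (\<forall>U x. openin (X i) U \<and> x \<in> U \<longrightarrow> (\<exists>V\<in>\<B>. x \<in> V \<and> V \<subseteq> U))" if "i \<in> I" for i
    using X[OF that] unfolding second_countable_def .
  then obtain \<B> where \<B>: "\<And>i. i \<in> I \<Longrightarrow> countable (\<B> i)" "\<And>i V. i \<in> I \<Longrightarrow> V \<in> \<B> i \<Longrightarrow> openin (X i) V"
    "\<And>i U x. i \<in> I \<Longrightarrow> openin (X i) U \<Longrightarrow> x \<in> U \<Longrightarrow> \<exists>V\<in>\<B> i. x \<in> V \<and> V \<subseteq> U"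
    by metis
  show ?thesis
  proof (rule that[of "Pi\<^sub>E I ` Pi\<^sub>E I \<B>"])
    show "countable (Pi\<^sub>E I ` Pi\<^sub>E I \<B>)"
      using \<B>(1) I by (intro countable_image countable_PiE) auto
    show "\<exists>U. V = Pi\<^sub>E I U \<and> (\<forall>i\<in>I. openin (X i) (U i))" if V: "V \<in> Pi\<^sub>E I ` Pi\<^sub>E I \<B>" for V
    proof -
      obtain U where U: "V = Pi\<^sub>E I U" "U \<in> Pi\<^sub>E I \<B>"
        using V by blast
      then have "\<forall>i\<in>I. openin (X i) (U i)"
        using \<B>(2) by (simp add: PiE_iff)
      then show ?thesis
        using U(1) by blast
    qed
    show "\<exists>V\<in>Pi\<^sub>E I ` Pi\<^sub>E I \<B>. x \<in> V \<and> V \<subseteq> U"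
      if U: "openin (product_topology X I) U" "x \<in> U" for U x
    proof -
      obtain W where W: "\<forall>i\<in>I. openin (X i) (W i)" "x \<in> Pi\<^sub>E I W" "Pi\<^sub>E I W \<subseteq> U"
        using U unfolding openin_product_topology_alt by metis
      have "\<forall>i\<in>I. \<exists>V. V \<in> \<B> i \<and> x i \<in> V \<and> V \<subseteq> W i"
        using \<B>(3) W(1,2) by (meson PiE_mem)
      then obtain V where V: "\<forall>i\<in>I. V i \<in> \<B> i \<and> x i \<in> V i \<and> V i \<subseteq> W i"
        by (rule bchoice[THEN exE])
      have eq: "Pi\<^sub>E I (restrict V I) = Pi\<^sub>E I V"
        by (intro PiE_cong) simp
      have "restrict V I \<in> Pi\<^sub>E I \<B>"
        using V by simp
      moreover have "x \<in> Pi\<^sub>E I V"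
        using V W(2) by (simp add: PiE_iff)
      moreover have "Pi\<^sub>E I V \<subseteq> U"
        using V W(3) PiE_mono[of I V W] by simp
      ultimately show ?thesis
        by (intro bexI[of _ "Pi\<^sub>E I (restrict V I)"] imageI) (simp_all only: eq simp_thms)
    qed
  qed
qed

lemma sets_borel_of_product:
  assumes I: "finite I" and X: "\<And>i. i \<in> I \<Longrightarrow> second_countable (X i)"
  shows "sets (borel_of (product_topology X I)) = sets (PiM I (\<lambda>i. borel_of (X i)))"
proof (rule subset_antisym)
  show "sets (PiM I (\<lambda>i. borel_of (X i))) \<subseteq> sets (borel_of (product_topology X I))"
  proof (rule sets_PiM_in_sets)
    fix i A assume i: "i \<in> I" and A: "A \<in> sets (borel_of (X i))"
    have "(\<lambda>x. x i) -` A \<inter> space (borel_of (product_topology X I)) \<in> sets (borel_of (product_topology X I))"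
      using continuous_map_measurable[OF continuous_map_product_projection[OF i]] A by (rule measurable_sets)
    also have "(\<lambda>x. x i) -` A \<inter> space (borel_of (product_topology X I)) =
        {x \<in> space (borel_of (product_topology X I)). x i \<in> A}"
      by auto
    finally show "{x \<in> space (borel_of (product_topology X I)). x i \<in> A} \<in> sets (borel_of (product_topology X I))" .
  qed simp
  obtain \<B> where \<B>: "countable \<B>"
    "\<And>V. V \<in> \<B> \<Longrightarrow> \<exists>U. V = Pi\<^sub>E I U \<and> (\<forall>i\<in>I. openin (X i) (U i))"
    "\<And>U x. openin (product_topology X I) U \<Longrightarrow> x \<in> U \<Longrightarrow> \<exists>V\<in>\<B>. x \<in> V \<and> V \<subseteq> U"
    by (rule finite_product_base[of I X, OF I X]) (assumption, rule that)
  show "sets (borel_of (product_topology X I)) \<subseteq> sets (PiM I (\<lambda>i. borel_of (X i)))"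
  proof (rule sets_borel_of_subset[of \<B>])
    show "V \<in> sets (PiM I (\<lambda>i. borel_of (X i)))" if V: "V \<in> \<B>" for V
    proof -
      obtain U where "V = Pi\<^sub>E I U" "\<forall>i\<in>I. openin (X i) (U i)"
        using \<B>(2)[OF V] by blast
      then show ?thesis
        using I by (auto intro!: sets_PiM_I_finite openin_borel_of)
    qed
  qed (use \<B> in \<open>simp_all add: space_PiM\<close>)
qed

lemma second_countable_product:
  assumes I: "finite I" and X: "\<And>i. i \<in> I \<Longrightarrow> second_countable (X i)"
  shows "second_countable (product_topology X I)"
proof -
  obtain \<B> where \<B>: "countable \<B>"
    "\<And>V. V \<in> \<B> \<Longrightarrow> \<exists>U. V = Pi\<^sub>E I U \<and> (\<forall>i\<in>I. openin (X i) (U i))"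
    "\<And>U x. openin (product_topology X I) U \<Longrightarrow> x \<in> U \<Longrightarrow> \<exists>V\<in>\<B>. x \<in> V \<and> V \<subseteq> U"
    by (rule finite_product_base[of I X, OF I X]) (assumption, rule that)
  have "\<forall>V\<in>\<B>. openin (product_topology X I) V"
  proof
    fix V assume "V \<in> \<B>"
    then obtain U where "V = Pi\<^sub>E I U" "\<forall>i\<in>I. openin (X i) (U i)"
      using \<B>(2) by blast
    then show "openin (product_topology X I) V"
      using I by (simp add: openin_PiE)
  qed
  then show ?thesis
    using \<B>(1,3) unfolding second_countable_def by (intro exI[of _ \<B>]) simp
qed

lemma polish_product:
  assumes I: "finite I" and X: "\<And>i. i \<in> I \<Longrightarrow> polish (X i)"
  shows "polish (product_topology X I)"
proof -
  have "second_countable (product_topology X I)"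
    using I X polish_second_countable by (intro second_countable_product) auto
  then have "separable_space (product_topology X I)"
    by (rule second_countable_imp_separable_space)
  moreover have "completely_metrizable_space (product_topology X I)"
    using X I unfolding completely_metrizable_space_product_topology polish_def
    by (auto intro!: disjI2 countable_finite)
  ultimately show ?thesis
    unfolding polish_def by simp
qed

text \<open>The diagonal is closed in a Hausdorff space, and by second countability it then belongs
  to the product sigma-algebra.\<close>

lemma measurable_diagonal:
  assumes P: "second_countable P" "Hausdorff_space P"
    and f: "f \<in> M \<rightarrow>\<^sub>M borel_of P" and g: "g \<in> M \<rightarrow>\<^sub>M borel_of P"
  shows "{x \<in> space M. f x = g x} \<in> sets M"
proof -
  have "closedin (prod_topology P P) ((\<lambda>x. (x, x)) ` topspace P)"
    using P(2) by (simp add: Hausdorff_space_closedin_diagonal)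
  then have D: "(\<lambda>x. (x, x)) ` topspace P \<in> sets (borel_of P \<Otimes>\<^sub>M borel_of P)"
    using sets_borel_of_prod[OF P(1) P(1)] closedin_borel_of by blast
  have "(\<lambda>x. (f x, g x)) \<in> M \<rightarrow>\<^sub>M borel_of P \<Otimes>\<^sub>M borel_of P"
    using f g by measurable
  from measurable_sets[OF this D]
  have "(\<lambda>x. (f x, g x)) -` (\<lambda>x. (x, x)) ` topspace P \<inter> space M \<in> sets M" .
  also have "(\<lambda>x. (f x, g x)) -` (\<lambda>x. (x, x)) ` topspace P \<inter> space M = {x \<in> space M. f x = g x}"
    using measurable_space[OF f] measurable_space[OF g] by (auto simp: image_iff)
  finally show ?thesis .
qed

section \<open>Sums over countable sets\<close>

lemma nn_integral_count_space_suminf: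
  fixes f :: "nat \<Rightarrow> ennreal"
  shows "(\<integral>\<^sup>+i. f i \<partial>count_space A) = (\<Sum>i. if i \<in> A then f i else 0)"
proof -
  have "(\<integral>\<^sup>+i. f i \<partial>count_space A) = (\<integral>\<^sup>+i. f i * indicator A i \<partial>count_space UNIV)"
    by (simp add: nn_integral_count_space_indicator)
  also have "\<dots> = (\<Sum>i. f i * indicator A i)"
    by (rule nn_integral_count_space_nat)
  also have "\<dots> = (\<Sum>i. if i \<in> A then f i else 0)"
    by (intro suminf_cong) (simp add: indicator_def)
  finally show ?thesis .
qed

text \<open>Both sides are suprema of finite partial sums. The unordered sum of the definition of
  transverse measures becomes an integral, for which monotone convergence and exchange of summation
  are at hand.\<close>

lemma infsum_eq_nn_integral_count_space:
  fixes f :: "'a \<Rightarrow> ennreal" and A :: "nat set"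
  assumes bij: "bij_betw b A B"
  shows "infsum f B = (\<integral>\<^sup>+x. f x \<partial>count_space B)"
proof -
  have "infsum f B = infsum (\<lambda>i. f (b i)) A"
    using infsum_reindex_bij_betw[OF bij, of f] by simp
  also have "\<dots> = (\<integral>\<^sup>+i. f (b i) \<partial>count_space A)"
  proof (rule antisym)
    have "sum (\<lambda>i. f (b i)) F \<le> (\<integral>\<^sup>+i. f (b i) \<partial>count_space A)" if F: "finite F" "F \<subseteq> A" for F
    proof -
      have "sum (\<lambda>i. f (b i)) F = (\<integral>\<^sup>+i. f (b i) * indicator F i \<partial>count_space A)"
        using F by (subst nn_integral_count_space'[of F]) (auto simp: indicator_def intro!: sum.cong)
      also have "\<dots> \<le> (\<integral>\<^sup>+i. f (b i) \<partial>count_space A)"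
        by (intro nn_integral_mono) (simp add: indicator_def)
      finally show ?thesis .
    qed
    then show "infsum (\<lambda>i. f (b i)) A \<le> (\<integral>\<^sup>+i. f (b i) \<partial>count_space A)"
      by (subst nonneg_infsum_complete) (auto intro!: SUP_least)
    have "(\<integral>\<^sup>+i. f (b i) \<partial>count_space A) = (SUP n. \<Sum>i<n. if i \<in> A then f (b i) else 0)"
      unfolding nn_integral_count_space_suminf by (rule suminf_eq_SUP)
    also have "\<dots> \<le> infsum (\<lambda>i. f (b i)) A"
    proof (rule SUP_least)
      fix n
      have "(\<Sum>i<n. if i \<in> A then f (b i) else 0) = sum (\<lambda>i. f (b i)) ({..<n} \<inter> A)"
        by (rule sum.inter_restrict[symmetric]) simp
      also have "\<dots> \<le> infsum (\<lambda>i. f (b i)) A"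
        by (subst nonneg_infsum_complete) (auto intro!: SUP_upper)
      finally show "(\<Sum>i<n. if i \<in> A then f (b i) else 0) \<le> infsum (\<lambda>i. f (b i)) A" .
    qed
    finally show "(\<integral>\<^sup>+i. f (b i) \<partial>count_space A) \<le> infsum (\<lambda>i. f (b i)) A" .
  qed
  also have "\<dots> = (\<integral>\<^sup>+x. f x \<partial>count_space B)"
    by (rule nn_integral_bij_count_space[OF bij])
  finally show ?thesis .
qed

section \<open>Locally compact groups and Haar measure\<close>

context lcsc_group
begin

lemma measurable_mult: "(\<lambda>p. fst p \<otimes> snd p) \<in> borel_of T \<Otimes>\<^sub>M borel_of T \<rightarrow>\<^sub>M borel_of T"
proof -
  have "(\<lambda>(g, h). g \<otimes> h) \<in> borel_of (prod_topology T T) \<rightarrow>\<^sub>M borel_of T"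
    by (rule continuous_map_measurable[OF continuous_mult])
  also have "borel_of (prod_topology T T) \<rightarrow>\<^sub>M borel_of T = borel_of T \<Otimes>\<^sub>M borel_of T \<rightarrow>\<^sub>M borel_of T"
    by (rule measurable_cong_sets[OF sets_borel_of_prod[OF second_countable second_countable] refl])
  finally show ?thesis
    by (simp add: case_prod_beta')
qed

lemma measurable_group_mult:
  assumes "f \<in> M \<rightarrow>\<^sub>M borel_of T" "g \<in> M \<rightarrow>\<^sub>M borel_of T"
  shows "(\<lambda>x. f x \<otimes> g x) \<in> M \<rightarrow>\<^sub>M borel_of T"
  using measurable_compose[OF measurable_Pair[OF assms] measurable_mult] by simp

lemma measurable_group_inv:
  assumes "f \<in> M \<rightarrow>\<^sub>M borel_of T"
  shows "(\<lambda>x. inv (f x)) \<in> M \<rightarrow>\<^sub>M borel_of T"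
  by (rule measurable_compose[OF assms continuous_map_measurable[OF continuous_inv]])

lemma continuous_left_mult:
  assumes "g \<in> carrier G"
  shows "continuous_map T T (\<lambda>h. g \<otimes> h)"
proof -
  have "continuous_map T (prod_topology T T) (\<lambda>h. (g, h))"
    using assms unfolding continuous_map_paired by (simp add: topspace_eq)
  from continuous_map_compose[OF this continuous_mult] show ?thesis
    by (simp add: o_def)
qed

lemma openin_left_translate:
  assumes "openin T V" "g \<in> carrier G"
  shows "openin T {h \<in> carrier G. g \<otimes> h \<in> V}"
  using continuous_left_mult[OF assms(2)] assms(1) by (simp add: continuous_map_def topspace_eq)

lemma small_neighbourhood:
  assumes U: "openin T U" "\<one> \<in> U"
  obtains V where "openin T V" "\<one> \<in> V" "\<And>g h. g \<in> V \<Longrightarrow> h \<in> V \<Longrightarrow> inv g \<otimes> h \<in> U"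
    "\<exists>K. compactin T K \<and> V \<subseteq> K"
proof -
  have "continuous_map (prod_topology T T) T (\<lambda>p. inv (fst p) \<otimes> snd p)"
  proof -
    have "continuous_map (prod_topology T T) (prod_topology T T) (\<lambda>p. (inv (fst p), snd p))"
      using continuous_map_compose[OF continuous_map_fst continuous_inv, of T]
      unfolding continuous_map_paired by (simp add: continuous_map_snd o_def)
    from continuous_map_compose[OF this continuous_mult] show ?thesis
      by (simp add: o_def)
  qed
  then have op: "openin (prod_topology T T) {p \<in> topspace (prod_topology T T). inv (fst p) \<otimes> snd p \<in> U}"
    using U(1) by (simp add: continuous_map_def)
  have mem: "(\<one>, \<one>) \<in> {p \<in> topspace (prod_topology T T). inv (fst p) \<otimes> snd p \<in> U}"
    using U(2) by (simp add: topspace_eq)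
  obtain A B where AB: "openin T A" "openin T B" "\<one> \<in> A" "\<one> \<in> B"
    "A \<times> B \<subseteq> {p \<in> topspace (prod_topology T T). inv (fst p) \<otimes> snd p \<in> U}"
    using openin_prod_topology_alt[THEN iffD1, OF op, rule_format, OF mem] by (elim exE conjE)
  have one: "\<one> \<in> topspace T"
    by (simp add: topspace_eq)
  obtain W K where WK: "openin T W" "compactin T K" "\<one> \<in> W" "W \<subseteq> K"
    using locally_compact[unfolded locally_compact_space_def, rule_format, OF one] by (elim exE conjE)
  show ?thesis
  proof (rule that[of "A \<inter> B \<inter> W"])
    show "inv g \<otimes> h \<in> U" if "g \<in> A \<inter> B \<inter> W" "h \<in> A \<inter> B \<inter> W" for g h
      using AB(5) that by auto
    show "\<exists>K. compactin T K \<and> A \<inter> B \<inter> W \<subseteq> K"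
      using WK by blast
  qed (use AB WK in auto)
qed

lemma carrier_nonempty: "topspace T \<noteq> {}"
  unfolding topspace_eq using one_closed by blast

end

section \<open>Haar measure: translations, open sets, sigma-finiteness\<close>

locale haar_group = lcsc_group G T for G (structure) and T +
  fixes m :: "'a measure"
  assumes haar: "haar_measure G T m"
begin

lemma sets_m: "sets m = sets (borel_of T)"
  using haar unfolding haar_measure_def by simp

lemma space_m [simp]: "space m = carrier G"
  using sets_eq_imp_space_eq[OF sets_m] by (simp add: topspace_eq)

lemma l_coset_eq_vimage:
  assumes "g \<in> carrier G" "A \<subseteq> carrier G"
  shows "(\<lambda>h. g \<otimes> h) -` A \<inter> carrier G = inv g <# A"
proof (rule subset_antisym)
  show "(\<lambda>h. g \<otimes> h) -` A \<inter> carrier G \<subseteq> inv g <# A"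
  proof
    fix h assume h: "h \<in> (\<lambda>h. g \<otimes> h) -` A \<inter> carrier G"
    then have "h = inv g \<otimes> (g \<otimes> h)"
      using assms by (simp add: m_assoc[symmetric])
    then show "h \<in> inv g <# A"
      using h unfolding l_coset_def by auto
  qed
  show "inv g <# A \<subseteq> (\<lambda>h. g \<otimes> h) -` A \<inter> carrier G"
    using assms by (auto simp: l_coset_def m_assoc[symmetric])
qed

lemma r_coset_eq_vimage:
  assumes "g \<in> carrier G" "A \<subseteq> carrier G"
  shows "(\<lambda>h. h \<otimes> g) -` A \<inter> carrier G = A #> inv g"
proof (rule subset_antisym)
  show "(\<lambda>h. h \<otimes> g) -` A \<inter> carrier G \<subseteq> A #> inv g"
  proof
    fix h assume h: "h \<in> (\<lambda>h. h \<otimes> g) -` A \<inter> carrier G"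
    then have "h = (h \<otimes> g) \<otimes> inv g"
      using assms by (simp add: m_assoc)
    then show "h \<in> A #> inv g"
      using h unfolding r_coset_def by auto
  qed
  show "A #> inv g \<subseteq> (\<lambda>h. h \<otimes> g) -` A \<inter> carrier G"
    using assms by (auto simp: r_coset_def m_assoc subset_iff)
qed

lemma distr_left_mult:
  assumes g: "g \<in> carrier G"
  shows "distr m m (\<lambda>h. g \<otimes> h) = m"
proof (rule measure_eqI)
  have meas: "(\<lambda>h. g \<otimes> h) \<in> m \<rightarrow>\<^sub>M m"
    using continuous_map_measurable[OF continuous_left_mult[OF g]]
    by (simp add: measurable_cong_sets[OF sets_m sets_m])
  fix A assume "A \<in> sets (distr m m (\<lambda>h. g \<otimes> h))"
  then have A: "A \<in> sets m" by simp
  then have "A \<subseteq> carrier G"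
    using sets.sets_into_space by fastforce
  then show "emeasure (distr m m (\<lambda>h. g \<otimes> h)) A = emeasure m A"
    using haar A g unfolding haar_measure_def
    by (simp add: emeasure_distr[OF meas A] l_coset_eq_vimage)
qed simp

lemma nn_integral_left_mult:
  assumes g: "g \<in> carrier G" and f: "f \<in> borel_measurable m"
  shows "(\<integral>\<^sup>+h. f (g \<otimes> h) \<partial>m) = (\<integral>\<^sup>+h. f h \<partial>m)"
proof -
  have meas: "(\<lambda>h. g \<otimes> h) \<in> m \<rightarrow>\<^sub>M m"
    using continuous_map_measurable[OF continuous_left_mult[OF g]]
    by (simp add: measurable_cong_sets[OF sets_m sets_m])
  show ?thesis
    using nn_integral_distr[OF meas, of f] f by (simp add: distr_left_mult[OF g])
qed

text \<open>If V were a null set, so would be its left translates; countably many of them cover the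
  group, which has nonzero measure.\<close>

lemma emeasure_open_nonzero:
  assumes V: "openin T V" "V \<noteq> {}"
  shows "emeasure m V \<noteq> 0"
proof
  assume 0: "emeasure m V = 0"
  obtain v where v: "v \<in> V" using V(2) by blast
  then have vG: "v \<in> carrier G"
    using openin_subset[OF V(1)] topspace_eq by auto
  have "\<exists>U\<in>{U. openin T U \<and> emeasure m U = 0}. openin T U \<and> x \<in> U" if "x \<in> topspace T" for x
  proof -
    have x: "x \<in> carrier G" using that topspace_eq by simp
    let ?g = "v \<otimes> inv x"
    have g: "?g \<in> carrier G" using vG x by simp
    let ?U = "{h \<in> carrier G. ?g \<otimes> h \<in> V}"
    have "?U = inv ?g <# V"
      using l_coset_eq_vimage[OF g, of V] openin_subset[OF V(1)] topspace_eq by auto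
    moreover have "emeasure m (inv ?g <# V) = emeasure m V"
      using haar g openin_borel_of[OF V(1)] unfolding haar_measure_def by simp
    ultimately have "emeasure m ?U = 0"
      using 0 by simp
    moreover have "openin T ?U"
      using openin_left_translate[OF V(1) g] .
    moreover have "x \<in> ?U"
      using v vG x by (simp add: m_assoc)
    ultimately show ?thesis
      by (intro bexI[of _ ?U]) simp_all
  qed
  then obtain W :: "nat \<Rightarrow> 'a set" where W: "\<And>i. W i \<in> {U. openin T U \<and> emeasure m U = 0}"
    "\<And>i. openin T (W i)" "topspace T = (\<Union>i. W i)"
    by (rule countable_subcover[OF second_countable carrier_nonempty]) (assumption, rule that)
  have "W i \<in> null_sets m" for i
    using W(1)[of i] openin_borel_of by (auto simp: null_sets_def sets_m)
  then have "(\<Union>i. W i) \<in> null_sets m"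
    by (rule null_sets_UN)
  then show False
    using W(3) haar unfolding haar_measure_def by (simp add: topspace_eq null_setsD1)
qed

lemma emeasure_compact_finite: "compactin T K \<Longrightarrow> emeasure m K < \<infinity>"
  using haar unfolding haar_measure_def by blast

lemma emeasure_subset_compact_finite:
  assumes "compactin T K" "V \<subseteq> K"
  shows "emeasure m V < \<infinity>"
proof -
  have "K \<in> sets m"
    using compactin_imp_closedin[OF Hausdorff assms(1)] closedin_borel_of sets_m by blast
  then have "emeasure m V \<le> emeasure m K"
    by (rule emeasure_mono[OF assms(2)])
  then show ?thesis
    using emeasure_compact_finite[OF assms(1)] by simp
qed

sublocale sigma_finite_measure m
proof
  have "\<exists>U\<in>{U. \<exists>K. compactin T K \<and> U \<subseteq> K}. openin T U \<and> x \<in> U" if x: "x \<in> topspace T" for x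
  proof -
    obtain U K where "openin T U" "compactin T K" "x \<in> U" "U \<subseteq> K"
      using locally_compact[unfolded locally_compact_space_def, rule_format, OF x] by (elim exE conjE)
    then show ?thesis
      by (intro bexI[of _ U]) auto
  qed
  then obtain W :: "nat \<Rightarrow> 'a set" where W: "\<And>i. W i \<in> {U. \<exists>K. compactin T K \<and> U \<subseteq> K}"
    "\<And>i. openin T (W i)" "topspace T = (\<Union>i. W i)"
    by (rule countable_subcover[OF second_countable carrier_nonempty]) (assumption, rule that)
  have "emeasure m (W i) \<noteq> \<infinity>" for i
  proof -
    obtain K where "compactin T K" "W i \<subseteq> K"
      using W(1)[of i] by blast
    then show ?thesis
      using emeasure_subset_compact_finite[of K "W i"] by (simp add: less_top)
  qed
  moreover have "W i \<in> sets m" for i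
    using openin_borel_of[OF W(2)] by (simp only: sets_m)
  moreover have "\<Union> (range W) = space m"
    using W(3) topspace_eq space_m by (simp only:)
  ultimately show "\<exists>A. countable A \<and> A \<subseteq> sets m \<and> \<Union> A = space m \<and> (\<forall>a\<in>A. emeasure m a \<noteq> \<infinity>)"
    by (intro exI[of _ "range W"] conjI) auto
qed

end

locale unimodular_group = haar_group +
  assumes unimod: "unimodular G T"
begin

lemma measurable_right_mult:
  assumes g: "g \<in> carrier G"
  shows "(\<lambda>h. h \<otimes> g) \<in> m \<rightarrow>\<^sub>M m"
proof -
  have "(\<lambda>h. h \<otimes> g) \<in> borel_of T \<rightarrow>\<^sub>M borel_of T"
    using g by (intro measurable_group_mult measurable_ident measurable_const) (simp_all add: topspace_eq)
  then show ?thesis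
    by (simp add: measurable_cong_sets[OF sets_m sets_m])
qed

lemma distr_right_mult:
  assumes g: "g \<in> carrier G"
  shows "distr m m (\<lambda>h. h \<otimes> g) = m"
proof (rule measure_eqI)
  fix A assume "A \<in> sets (distr m m (\<lambda>h. h \<otimes> g))"
  then have A: "A \<in> sets m" by simp
  then have "A \<subseteq> carrier G"
    using sets.sets_into_space by fastforce
  then show "emeasure (distr m m (\<lambda>h. h \<otimes> g)) A = emeasure m A"
    using unimod haar A g unfolding unimodular_def
    by (simp add: emeasure_distr[OF measurable_right_mult[OF g] A] r_coset_eq_vimage)
qed simp

lemma nn_integral_right_mult:
  assumes g: "g \<in> carrier G" and f: "f \<in> borel_measurable m"
  shows "(\<integral>\<^sup>+h. f (h \<otimes> g) \<partial>m) = (\<integral>\<^sup>+h. f h \<partial>m)"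
  using nn_integral_distr[OF measurable_right_mult[OF g], of f] f by (simp add: distr_right_mult[OF g])

end

section \<open>Fibre sums over return times\<close>

locale borel_flow = lcsc_group G T for G (structure) and T +
  fixes S :: "'s measure" and \<phi> :: "'a \<Rightarrow> 's \<Rightarrow> 's"
  assumes action: "group_action G (space S) \<phi>"
    and measurable_action: "(\<lambda>(h, s). \<phi> h s) \<in> borel_of T \<Otimes>\<^sub>M S \<rightarrow>\<^sub>M S"
begin

lemma act_closed: "g \<in> carrier G \<Longrightarrow> x \<in> space S \<Longrightarrow> \<phi> g x \<in> space S"
  using group_action.element_image[OF action] by blast

lemma act_one: "x \<in> space S \<Longrightarrow> \<phi> \<one> x = x"
  using group_action.id_eq_one[OF action] by (metis restrict_apply')

lemma act_mult:
  "g \<in> carrier G \<Longrightarrow> h \<in> carrier G \<Longrightarrow> x \<in> space S \<Longrightarrow> \<phi> (g \<otimes> h) x = \<phi> g (\<phi> h x)"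
  using group_action.composition_rule[OF action] by blast

lemma act_inv: "g \<in> carrier G \<Longrightarrow> x \<in> space S \<Longrightarrow> \<phi> (inv g) (\<phi> g x) = x"
  using act_mult[of "inv g" g x] by (simp add: act_one)

lemma act_inv': "g \<in> carrier G \<Longrightarrow> x \<in> space S \<Longrightarrow> \<phi> g (\<phi> (inv g) x) = x"
  using act_mult[of g "inv g" x] by (simp add: act_one)

lemma measurable_act:
  assumes "f \<in> M \<rightarrow>\<^sub>M borel_of T" "g \<in> M \<rightarrow>\<^sub>M S"
  shows "(\<lambda>x. \<phi> (f x) (g x)) \<in> M \<rightarrow>\<^sub>M S"
  using measurable_compose[OF measurable_Pair[OF assms] measurable_action] by simp

end

text \<open>The return times of x are listed by countably many Borel branches; branch i exists at x
  when x is in \<open>D i\<close>. The inverse of the return time is stored, because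
  \<open>\<gamma> i x\<close> is then the group coordinate of the corresponding point above x in
  \<open>G \<times> Z\<close>.\<close>

locale section_flow = borel_flow G T S \<phi> for G (structure) and T and S :: "'s measure" and \<phi> +
  fixes Z :: "'s set" and D :: "nat \<Rightarrow> 's set" and \<gamma> :: "nat \<Rightarrow> 's \<Rightarrow> 'a"
  assumes Z: "Z \<in> sets S"
    and D: "D i \<in> sets S"
    and \<gamma>: "\<gamma> i \<in> S \<rightarrow>\<^sub>M borel_of T"
    and enum: "x \<in> space S \<Longrightarrow> bij_betw (\<lambda>i. inv (\<gamma> i x)) {i. x \<in> D i} (return_set G \<phi> Z x)"
begin

text \<open>The pairs \<open>(inv h, \<phi> h x)\<close> are the preimages of x under the action map
  on \<open>G \<times> Z\<close>, so this sums F over a fibre of that map.\<close>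

definition fibre_sum :: "('a \<times> 's \<Rightarrow> ennreal) \<Rightarrow> 's \<Rightarrow> ennreal" where
  "fibre_sum F x = (\<integral>\<^sup>+h. F (inv h, \<phi> h x) \<partial>count_space (return_set G \<phi> Z x))"

lemma \<gamma>_closed: "x \<in> space S \<Longrightarrow> \<gamma> i x \<in> carrier G"
  using measurable_space[OF \<gamma>] by (simp add: topspace_eq)

lemma Z_space: "Z \<subseteq> space S"
  using Z by (rule sets.sets_into_space)

lemma space_Z: "space (restrict_space S Z) = Z"
  using Z_space by (auto simp: space_restrict_space)

lemma enum_in_Z:
  assumes "x \<in> D i"
  shows "\<phi> (inv (\<gamma> i x)) x \<in> Z"
proof -
  have "x \<in> space S"
    using D assms sets.sets_into_space by blast
  then have "inv (\<gamma> i x) \<in> return_set G \<phi> Z x"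
    using enum assms by (blast dest: bij_betwE)
  then show ?thesis
    by (simp add: return_set_def)
qed

lemma fibre_sum_suminf:
  assumes x: "x \<in> space S"
  shows "fibre_sum F x = (\<Sum>i. if x \<in> D i then F (\<gamma> i x, \<phi> (inv (\<gamma> i x)) x) else 0)"
proof -
  have "fibre_sum F x = (\<integral>\<^sup>+i. F (inv (inv (\<gamma> i x)), \<phi> (inv (\<gamma> i x)) x) \<partial>count_space {i. x \<in> D i})"
    unfolding fibre_sum_def by (rule nn_integral_bij_count_space[OF enum[OF x], symmetric])
  also have "\<dots> = (\<integral>\<^sup>+i. F (\<gamma> i x, \<phi> (inv (\<gamma> i x)) x) \<partial>count_space {i. x \<in> D i})"
    using \<gamma>_closed[OF x] by (intro nn_integral_cong) simp
  finally show ?thesis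
    by (simp add: nn_integral_count_space_suminf)
qed

lemma measurable_enum:
  "(\<lambda>x. (\<gamma> i x, \<phi> (inv (\<gamma> i x)) x)) \<in> restrict_space S (D i) \<rightarrow>\<^sub>M borel_of T \<Otimes>\<^sub>M restrict_space S Z"
proof (rule measurable_Pair)
  have g: "\<gamma> i \<in> restrict_space S (D i) \<rightarrow>\<^sub>M borel_of T"
    by (rule measurable_restrict_space1[OF \<gamma>])
  then show "\<gamma> i \<in> restrict_space S (D i) \<rightarrow>\<^sub>M borel_of T" .
  have "(\<lambda>x. \<phi> (inv (\<gamma> i x)) x) \<in> restrict_space S (D i) \<rightarrow>\<^sub>M S"
    by (intro measurable_act measurable_group_inv g measurable_restrict_space1) simp
  then show "(\<lambda>x. \<phi> (inv (\<gamma> i x)) x) \<in> restrict_space S (D i) \<rightarrow>\<^sub>M restrict_space S Z"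
    by (rule measurable_restrict_space2[rotated]) (auto simp: space_restrict_space enum_in_Z)
qed

text \<open>The enumeration turns a sum whose index set varies with x into a series of Borel
  functions.\<close>

lemma measurable_fibre_sum:
  assumes F: "F \<in> borel_measurable (borel_of T \<Otimes>\<^sub>M restrict_space S Z)"
  shows "fibre_sum F \<in> borel_measurable S"
proof -
  have "(\<lambda>x. if x \<in> D i then F (\<gamma> i x, \<phi> (inv (\<gamma> i x)) x) else 0) \<in> borel_measurable S" for i
  proof (subst measurable_If_restrict_space_iff)
    show "{x \<in> space S. x \<in> D i} \<in> sets S"
      using D by simp
    have "D i = {x. x \<in> D i}" by simp
    then show "(\<lambda>x. F (\<gamma> i x, \<phi> (inv (\<gamma> i x)) x)) \<in> borel_measurable (restrict_space S {x. x \<in> D i}) \<and>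
        (\<lambda>x. 0) \<in> borel_measurable (restrict_space S {x. x \<notin> D i})"
      using measurable_compose[OF measurable_enum F] by simp
  qed
  then have "(\<lambda>x. \<Sum>i. if x \<in> D i then F (\<gamma> i x, \<phi> (inv (\<gamma> i x)) x) else 0) \<in> borel_measurable S"
    by measurable
  then show ?thesis
    by (subst measurable_cong[OF fibre_sum_suminf])
qed

lemma infsum_return_set:
  assumes x: "x \<in> space S"
  shows "(\<Sum>\<^sub>\<infinity>h\<in>return_set G \<phi> Z x. F (inv h, \<phi> h x)) = fibre_sum F x"
  unfolding fibre_sum_def by (rule infsum_eq_nn_integral_count_space[OF enum[OF x]])

lemma fibre_sum_mono:
  assumes "\<And>h z. h \<in> carrier G \<Longrightarrow> z \<in> Z \<Longrightarrow> F (h, z) \<le> F' (h, z)"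
  shows "fibre_sum F x \<le> fibre_sum F' x"
  unfolding fibre_sum_def using assms by (intro nn_integral_mono) (auto simp: return_set_def)

lemma fibre_sum_SUP:
  assumes "incseq F"
  shows "fibre_sum (\<lambda>p. SUP n. F n p) x = (SUP n. fibre_sum (F n) x)"
  unfolding fibre_sum_def
  using assms by (intro nn_integral_monotone_convergence_SUP) (auto simp: incseq_def le_fun_def)

lemma transverseI:
  assumes "sets \<mu> = sets S" "sets \<nu> = sets (restrict_space S Z)"
    and "\<And>F. F \<in> borel_measurable (borel_of T \<Otimes>\<^sub>M restrict_space S Z) \<Longrightarrow>
      (\<integral>\<^sup>+x. fibre_sum F x \<partial>\<mu>) = (\<integral>\<^sup>+h. \<integral>\<^sup>+t. F (h, t) \<partial>\<nu> \<partial>m)"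
  shows "transverse_measure G T m S \<phi> Z \<mu> \<nu>"
  unfolding transverse_measure_def
proof (intro conjI allI impI assms(2))
  fix f :: "'a \<times> 's \<Rightarrow> real"
  assume f: "f \<in> borel_measurable (borel_of T \<Otimes>\<^sub>M restrict_space S Z)"
  have "(\<integral>\<^sup>+x. (\<Sum>\<^sub>\<infinity>h\<in>return_set G \<phi> Z x. ennreal (f (inv h, \<phi> h x))) \<partial>\<mu>) =
      (\<integral>\<^sup>+x. fibre_sum (\<lambda>p. ennreal (f p)) x \<partial>\<mu>)"
    using sets_eq_imp_space_eq[OF assms(1)]
    by (intro nn_integral_cong) (auto simp: infsum_return_set[where F = "\<lambda>p. ennreal (f p)"])
  also have "\<dots> = (\<integral>\<^sup>+h. \<integral>\<^sup>+t. ennreal (f (h, t)) \<partial>\<nu> \<partial>m)"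
    using f by (intro assms(3)) simp
  finally show "(\<integral>\<^sup>+x. (\<Sum>\<^sub>\<infinity>h\<in>return_set G \<phi> Z x. ennreal (f (inv h, \<phi> h x))) \<partial>\<mu>) =
      (\<integral>\<^sup>+h. \<integral>\<^sup>+t. ennreal (f (h, t)) \<partial>\<nu> \<partial>m)" .
qed

lemma transverse_bounded:
  assumes tr: "transverse_measure G T m S \<phi> Z \<mu> \<nu>" and \<mu>: "sets \<mu> = sets S"
    and f: "f \<in> borel_measurable (borel_of T \<Otimes>\<^sub>M restrict_space S Z)"
    and nonneg: "\<And>p. 0 \<le> f p" and bdd: "\<And>p. f p \<le> B"
  shows "(\<integral>\<^sup>+x. fibre_sum (\<lambda>p. ennreal (f p)) x \<partial>\<mu>) = (\<integral>\<^sup>+h. \<integral>\<^sup>+t. ennreal (f (h, t)) \<partial>\<nu> \<partial>m)"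
proof -
  have "bounded (f ` (carrier G \<times> Z))"
    unfolding bounded_iff using nonneg bdd by (intro exI[of _ B]) auto
  then have "(\<integral>\<^sup>+x. (\<Sum>\<^sub>\<infinity>h\<in>return_set G \<phi> Z x. ennreal (f (inv h, \<phi> h x))) \<partial>\<mu>) =
      (\<integral>\<^sup>+h. \<integral>\<^sup>+t. ennreal (f (h, t)) \<partial>\<nu> \<partial>m)"
    using tr f nonneg unfolding transverse_measure_def by blast
  moreover have "(\<integral>\<^sup>+x. (\<Sum>\<^sub>\<infinity>h\<in>return_set G \<phi> Z x. ennreal (f (inv h, \<phi> h x))) \<partial>\<mu>) =
      (\<integral>\<^sup>+x. fibre_sum (\<lambda>p. ennreal (f p)) x \<partial>\<mu>)"
    using sets_eq_imp_space_eq[OF \<mu>]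
    by (intro nn_integral_cong) (auto simp: infsum_return_set[where F = "\<lambda>p. ennreal (f p)"])
  ultimately show ?thesis by simp
qed

text \<open>The definition tests bounded real functions only. Truncation at n and monotone
  convergence on both sides extend the identity to all measurable functions with values in
  [0, \<infinity>].\<close>

lemma transverseD:
  assumes tr: "transverse_measure G T m S \<phi> Z \<mu> \<nu>" and \<mu>: "sets \<mu> = sets S"
    and m: "sets m = sets (borel_of T)" and \<nu>: "sigma_finite_measure \<nu>"
    and F: "F \<in> borel_measurable (borel_of T \<Otimes>\<^sub>M restrict_space S Z)"
  shows "(\<integral>\<^sup>+x. fibre_sum F x \<partial>\<mu>) = (\<integral>\<^sup>+h. \<integral>\<^sup>+t. F (h, t) \<partial>\<nu> \<partial>m)"
proof -
  interpret \<nu>: sigma_finite_measure \<nu> by fact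
  have sets_\<nu>: "sets \<nu> = sets (restrict_space S Z)"
    using tr unfolding transverse_measure_def by simp
  have pair: "sets (m \<Otimes>\<^sub>M \<nu>) = sets (borel_of T \<Otimes>\<^sub>M restrict_space S Z)"
    by (rule sets_pair_measure_cong[OF m sets_\<nu>])
  define H where "H n p = min (F p) (of_nat n)" for n :: nat and p
  have H: "H n \<in> borel_measurable (borel_of T \<Otimes>\<^sub>M restrict_space S Z)" for n
    unfolding H_def using F by measurable
  then have H': "H n \<in> borel_measurable (m \<Otimes>\<^sub>M \<nu>)" for n
    by (simp add: measurable_cong_sets[OF pair refl])
  have inc: "incseq H"
    unfolding H_def incseq_def le_fun_def by (intro allI impI min.mono order_refl of_nat_mono)
  have SUP_H: "F p = (SUP n. H n p)" for p
  proof -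
    have "(SUP n. H n p) = min (F p) (SUP n. of_nat n)"
      unfolding H_def by (simp add: inf_min[symmetric] inf_SUP)
    then show ?thesis
      by (simp add: ennreal_SUP_of_nat_eq_top)
  qed
  have eq: "(\<integral>\<^sup>+x. fibre_sum (H n) x \<partial>\<mu>) = (\<integral>\<^sup>+h. \<integral>\<^sup>+t. H n (h, t) \<partial>\<nu> \<partial>m)" for n
  proof -
    have lt: "H n p < \<infinity>" for p
      unfolding H_def by (auto simp: min_less_iff_disj ennreal_of_nat_eq_real_of_nat)
    then have e: "ennreal (enn2real (H n p)) = H n p" for p
      by (simp add: less_top)
    have "enn2real (H n p) \<le> real n" for p
      unfolding H_def by (rule enn2real_leI) (simp_all add: ennreal_of_nat_eq_real_of_nat)
    then show ?thesis
      using transverse_bounded[OF tr \<mu>, of "\<lambda>p. enn2real (H n p)" "real n"] H[of n] by (simp add: e)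
  qed
  have "(\<integral>\<^sup>+x. fibre_sum F x \<partial>\<mu>) = (\<integral>\<^sup>+x. (SUP n. fibre_sum (H n) x) \<partial>\<mu>)"
  proof -
    have "F = (\<lambda>p. SUP n. H n p)"
      using SUP_H by (intro ext)
    then show ?thesis
      using fibre_sum_SUP[OF inc] by simp
  qed
  also have "\<dots> = (SUP n. \<integral>\<^sup>+x. fibre_sum (H n) x \<partial>\<mu>)"
  proof (rule nn_integral_monotone_convergence_SUP)
    show "incseq (\<lambda>n. fibre_sum (H n))"
      using inc by (auto simp: incseq_def le_fun_def intro!: fibre_sum_mono)
    show "fibre_sum (H n) \<in> borel_measurable \<mu>" for n
      using measurable_fibre_sum[OF H] by (simp add: measurable_cong_sets[OF \<mu> refl])
  qed
  also have "\<dots> = (SUP n. \<integral>\<^sup>+h. \<integral>\<^sup>+t. H n (h, t) \<partial>\<nu> \<partial>m)"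
    by (simp add: eq)
  also have "\<dots> = (\<integral>\<^sup>+h. (SUP n. \<integral>\<^sup>+t. H n (h, t) \<partial>\<nu>) \<partial>m)"
  proof (rule nn_integral_monotone_convergence_SUP[symmetric])
    show "incseq (\<lambda>n h. \<integral>\<^sup>+t. H n (h, t) \<partial>\<nu>)"
      using inc by (auto simp: incseq_def le_fun_def intro!: nn_integral_mono)
    show "(\<lambda>h. \<integral>\<^sup>+t. H n (h, t) \<partial>\<nu>) \<in> borel_measurable m" for n
      by (rule \<nu>.borel_measurable_nn_integral_fst[OF H'])
  qed
  also have "\<dots> = (\<integral>\<^sup>+h. \<integral>\<^sup>+t. (SUP n. H n (h, t)) \<partial>\<nu> \<partial>m)"
  proof (rule nn_integral_cong)
    fix h assume "h \<in> space m"
    then show "(SUP n. \<integral>\<^sup>+t. H n (h, t) \<partial>\<nu>) = (\<integral>\<^sup>+t. (SUP n. H n (h, t)) \<partial>\<nu>)"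
      using inc measurable_compose[OF measurable_Pair1' H']
      by (intro nn_integral_monotone_convergence_SUP[symmetric]) (auto simp: incseq_def le_fun_def)
  qed
  finally show ?thesis
    by (simp add: SUP_H[symmetric])
qed

end

text \<open>V is so small that inv h g lies in the separating neighbourhood for g, h in V. If g z =
  h z', then inv h g moves z to z' within Z and must be the identity. The last property says the
  same about return times: at most one of them has its inverse in V.\<close>

lemma (in borel_flow) separated_return_times:
  assumes sep: "separated_cross_section G T S \<phi> Z"
  obtains V where "openin T V" "\<one> \<in> V" "\<exists>K. compactin T K \<and> V \<subseteq> K"
    "\<And>g h z z'. g \<in> V \<Longrightarrow> h \<in> V \<Longrightarrow> z \<in> Z \<Longrightarrow> z' \<in> Z \<Longrightarrow> \<phi> g z = \<phi> h z' \<Longrightarrow> g = h"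
    "\<And>x h h'. x \<in> space S \<Longrightarrow> h \<in> return_set G \<phi> Z x \<Longrightarrow> h' \<in> return_set G \<phi> Z x \<Longrightarrow>
      inv h \<in> V \<Longrightarrow> inv h' \<in> V \<Longrightarrow> h = h'"
proof -
  obtain U where U: "openin T U" "\<one> \<in> U" "{h \<in> carrier G. \<phi> h ` Z \<inter> Z \<noteq> {}} \<inter> U = {\<one>}"
    using sep unfolding separated_cross_section_def by blast
  obtain V where V: "openin T V" "\<one> \<in> V" "\<And>g h. g \<in> V \<Longrightarrow> h \<in> V \<Longrightarrow> inv g \<otimes> h \<in> U"
    "\<exists>K. compactin T K \<and> V \<subseteq> K"
    by (rule small_neighbourhood[OF U(1,2)]) (rule that)
  have Zs: "Z \<subseteq> space S"
    using sep sets.sets_into_space unfolding separated_cross_section_def by blast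
  have VG: "V \<subseteq> carrier G"
    using openin_subset[OF V(1)] topspace_eq by simp
  have eq: "g = h" if gh: "g \<in> V" "h \<in> V" and z: "z \<in> Z" "z' \<in> Z" "\<phi> g z = \<phi> h z'" for g h z z'
  proof -
    have G: "g \<in> carrier G" "h \<in> carrier G"
      using gh VG by auto
    have "\<phi> (inv h \<otimes> g) z = \<phi> (inv h) (\<phi> g z)"
      using G z Zs by (intro act_mult) auto
    also have "\<dots> = z'"
      using G z Zs act_inv[of h z'] by auto
    finally have "inv h \<otimes> g \<in> {h \<in> carrier G. \<phi> h ` Z \<inter> Z \<noteq> {}} \<inter> U"
      using G z V(3)[OF gh(2,1)] by blast
    then have "inv h \<otimes> g = \<one>"
      using U(3) by auto
    then show ?thesis
      using G by (metis inv_equality inv_inv inv_closed)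
  qed
  show ?thesis
  proof (rule that[OF V(1,2,4) eq])
    fix x h h' assume x: "x \<in> space S"
      and h: "h \<in> return_set G \<phi> Z x" "h' \<in> return_set G \<phi> Z x" "inv h \<in> V" "inv h' \<in> V"
    have "inv h = inv h'"
      using h x by (intro eq[of _ _ "\<phi> h x" "\<phi> h' x"]) (auto simp: return_set_def act_inv)
    then show "h = h'"
      using h by (metis (mono_tags, lifting) inv_inv mem_Collect_eq return_set_def)
  qed
qed

section \<open>Enumerating return times\<close>

lemma (in lcsc_group) borel_flow_continuous:
  assumes X: "polish X" and \<phi>: "jointly_continuous_action G T X \<phi>"
  shows "borel_flow G T (borel_of X) \<phi>"
proof (intro borel_flow.intro borel_flow_axioms.intro lcsc_group_axioms)
  show "group_action G (space (borel_of X)) \<phi>"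
    using \<phi> unfolding jointly_continuous_action_def by simp
  have "(\<lambda>(h, s). \<phi> h s) \<in> borel_of (prod_topology T X) \<rightarrow>\<^sub>M borel_of X"
    using \<phi> unfolding jointly_continuous_action_def by (intro continuous_map_measurable) simp
  then show "(\<lambda>(h, s). \<phi> h s) \<in> borel_of T \<Otimes>\<^sub>M borel_of X \<rightarrow>\<^sub>M borel_of X"
    using measurable_cong_sets[OF sets_borel_of_prod[OF second_countable polish_second_countable[OF X]] refl]
    by blast
qed

text \<open>Countably many translates of a small V cover the group, and on each translate times Z
  the action map is injective, since the translating element can be cancelled. By Lusin-Souslin the
  image of a whole piece, the domain of the branch, is Borel; images of Borel parts of a piece give
  the measurability of the branch.\<close>

lemma (in lcsc_group) return_time_enumeration:
  assumes X: "polish X" and \<phi>: "jointly_continuous_action G T X \<phi>"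
    and sep: "separated_cross_section G T (borel_of X) \<phi> Z"
  shows "\<exists>D \<gamma>. section_flow G T (borel_of X) \<phi> Z D \<gamma>"
proof -
  interpret F: borel_flow G T "borel_of X" \<phi>
    by (rule borel_flow_continuous[OF X \<phi>])
  obtain V where V: "openin T V" "\<one> \<in> V"
    and inj: "\<And>g h z z'. g \<in> V \<Longrightarrow> h \<in> V \<Longrightarrow> z \<in> Z \<Longrightarrow> z' \<in> Z \<Longrightarrow> \<phi> g z = \<phi> h z' \<Longrightarrow> g = h"
    by (rule F.separated_return_times[OF sep]) (rule that)
  have Z: "Z \<in> sets (borel_of X)"
    using sep unfolding separated_cross_section_def by simp
  then have ZX: "Z \<subseteq> topspace X"
    using sets.sets_into_space by fastforce
  define tr where "tr g = {h \<in> carrier G. inv g \<otimes> h \<in> V}" for g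
  have "\<exists>U\<in>tr ` carrier G. openin T U \<and> x \<in> U" if "x \<in> topspace T" for x
  proof -
    have x: "x \<in> carrier G"
      using that topspace_eq by simp
    then have "openin T (tr x)"
      unfolding tr_def by (intro openin_left_translate[OF V(1)]) simp
    moreover have "x \<in> tr x"
      using x V(2) by (simp add: tr_def)
    ultimately show ?thesis
      using x by (intro bexI[of _ "tr x"]) auto
  qed
  then obtain W :: "nat \<Rightarrow> 'a set" where W: "\<And>i. W i \<in> tr ` carrier G" "\<And>i. openin T (W i)" "topspace T = (\<Union>i. W i)"
    by (rule countable_subcover[OF second_countable carrier_nonempty]) (assumption, rule that)
  \<comment> \<open>Disjoint pieces ensure that a return time is listed under a single
    index.\<close>
  define W' where "W' = disjointed W"
  have W'_sets: "W' i \<in> sets (borel_of T)" for i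
    unfolding W'_def disjointed_def by (intro sets.Diff sets.finite_UN openin_borel_of W(2)) auto
  have W'_sub: "W' i \<subseteq> carrier G" for i
    using sets.sets_into_space[OF W'_sets, of i] by (simp add: topspace_eq)
  have W'_UN: "(\<Union>i. W' i) = carrier G"
    unfolding W'_def UN_disjointed_eq using W(3) topspace_eq by simp
  have W'_disj: "i = j" if "g \<in> W' i" "g \<in> W' j" for g i j
    using disjoint_family_disjointed[of W] that unfolding W'_def disjoint_family_on_def by blast
  have W'_inj: "g = g'" if g: "g \<in> W' i" "g' \<in> W' i" and z: "z \<in> Z" "z' \<in> Z" "\<phi> g z = \<phi> g' z'" for g g' z z' i
  proof -
    obtain k where k: "k \<in> carrier G" "W i = tr k"
      using W(1)[of i] by blast
    have gG: "g \<in> carrier G" "g' \<in> carrier G"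
      using g W'_sub by auto
    have "g \<in> tr k" "g' \<in> tr k"
      using g disjointed_subset[of W i] k(2) unfolding W'_def by auto
    then have "inv k \<otimes> g \<in> V" "inv k \<otimes> g' \<in> V"
      by (simp_all add: tr_def)
    moreover have "\<phi> (inv k \<otimes> g) z = \<phi> (inv k \<otimes> g') z'"
    proof -
      have "z \<in> topspace X" "z' \<in> topspace X"
        using z ZX by auto
      then show ?thesis
        using F.act_mult[of "inv k" g z] F.act_mult[of "inv k" g' z'] gG k(1) z(3) by simp
    qed
    ultimately have "inv k \<otimes> g = inv k \<otimes> g'"
      using inj z by blast
    then show ?thesis
      using gG k(1) by simp
  qed
  define a where "a = (\<lambda>(g, x). \<phi> g x)"
  have a_cont: "continuous_map (prod_topology T X) X a"
    using \<phi> unfolding jointly_continuous_action_def a_def by simp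
  have coded: "coded T B" if "B \<in> sets (borel_of T)" for B
    by (rule coded_borel[OF Hausdorff locally_compact_Hausdorff_imp_regular_space[OF locally_compact Hausdorff]
          second_countable coded_locally_compact[OF locally_compact second_countable Hausdorff] that])
  have coded': "coded X B" if "B \<in> sets (borel_of X)" for B
    by (rule coded_borel[OF polish_Hausdorff[OF X] polish_regular[OF X] polish_second_countable[OF X]
          coded_polish[OF X] that])
  have image: "a ` (B \<times> Z) \<in> sets (borel_of X)" if B: "B \<in> sets (borel_of T)" "B \<subseteq> W' i" for B i
  proof -
    obtain c where c: "coding (prod_topology T X) (B \<times> Z) c"
      and cyl: "\<forall>n \<alpha>. \<exists>A'\<in>sets (borel_of T). \<exists>B'\<in>sets (borel_of X).
        {x \<in> B \<times> Z. \<forall>j<n. c j x = \<alpha> j} = A' \<times> B'"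
      using coded_Times(2)[OF coded[OF B(1)] coded'[OF Z]] by (elim exE conjE)
    show ?thesis
    proof (rule borel_injective_image[OF polish_Hausdorff[OF X] a_cont _ c])
      show "inj_on a (B \<times> Z)"
      proof (rule inj_onI)
        fix p q assume pq: "p \<in> B \<times> Z" "q \<in> B \<times> Z" "a p = a q"
        obtain g z h w where p: "p = (g, z)" and q: "q = (h, w)"
          by (metis prod.exhaust)
        have mem: "g \<in> W' i" "h \<in> W' i" "z \<in> Z" "w \<in> Z"
          using pq B(2) p q by auto
        have eq: "\<phi> g z = \<phi> h w"
          using pq(3) by (simp add: p q a_def)
        then have "g = h"
          by (rule W'_inj[OF mem])
        moreover have "z = w"
          using eq \<open>g = h\<close> F.act_inv[of g] mem W'_sub[of i] ZX
          by (metis (no_types, lifting) space_borel_of subset_iff)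
        ultimately show "p = q"
          using p q by simp
      qed
      fix n \<alpha>
      obtain A' B' where AB: "A' \<in> sets (borel_of T)" "B' \<in> sets (borel_of X)"
        "{x \<in> B \<times> Z. \<forall>j<n. c j x = \<alpha> j} = A' \<times> B'"
        using cyl[rule_format, of n \<alpha>] by (elim bexE)
      show "coded (prod_topology T X) {x \<in> B \<times> Z. \<forall>j<n. c j x = \<alpha> j}"
        unfolding AB(3) by (rule coded_Times(1)[OF coded[OF AB(1)] coded'[OF AB(2)]])
    qed
  qed
  define D where "D i = a ` (W' i \<times> Z)" for i
  \<comment> \<open>The default value \<one> keeps the branch total with values in the group; it
    adds the complement of \<open>D i\<close> to the preimage of B exactly when B contains
    \<one>.\<close>
  define \<gamma> where "\<gamma> i x = (if x \<in> D i then (THE g. g \<in> W' i \<and> \<phi> (inv g) x \<in> Z) else \<one>)" for i x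
  have D_space: "D i \<subseteq> topspace X" for i
    using W'_sub[of i] ZX F.act_closed unfolding D_def a_def by auto
  have the: "\<gamma> i x = g" if g: "g \<in> W' i" "\<phi> (inv g) x \<in> Z" and x: "x \<in> topspace X" for g x i
  proof -
    have gG: "g \<in> carrier G" using g W'_sub by auto
    have "x = a (g, \<phi> (inv g) x)"
      using F.act_inv'[of g x] gG x by (simp add: a_def)
    then have xD: "x \<in> D i"
      unfolding D_def using g by (metis SigmaI image_eqI)
    have "h = g" if h: "h \<in> W' i \<and> \<phi> (inv h) x \<in> Z" for h
    proof (rule W'_inj[of h i g])
      have "h \<in> carrier G" using h W'_sub by auto
      then show "\<phi> h (\<phi> (inv h) x) = \<phi> g (\<phi> (inv g) x)"
        using F.act_inv'[of h x] F.act_inv'[of g x] gG x by simp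
    qed (use h g in auto)
    then have "(THE g. g \<in> W' i \<and> \<phi> (inv g) x \<in> Z) = g"
      by (rule the_equality[of "\<lambda>g. g \<in> W' i \<and> \<phi> (inv g) x \<in> Z", OF conjI[OF g]])
    then show ?thesis
      by (simp only: \<gamma>_def xD if_True)
  qed
  have D_iff: "x \<in> D i \<longleftrightarrow> x \<in> topspace X \<and> (\<exists>g\<in>W' i. \<phi> (inv g) x \<in> Z)" for x i
  proof
    assume "x \<in> D i"
    then obtain g z where gz: "g \<in> W' i" "z \<in> Z" "x = \<phi> g z"
      unfolding D_def a_def by auto
    then have "\<phi> (inv g) x = z"
      using F.act_inv[of g z] W'_sub[of i] ZX by auto
    then show "x \<in> topspace X \<and> (\<exists>g\<in>W' i. \<phi> (inv g) x \<in> Z)"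
      using gz D_space \<open>x \<in> D i\<close> by blast
  next
    assume r: "x \<in> topspace X \<and> (\<exists>g\<in>W' i. \<phi> (inv g) x \<in> Z)"
    then obtain g where g: "g \<in> W' i" "\<phi> (inv g) x \<in> Z" by blast
    have "x = a (g, \<phi> (inv g) x)"
      using F.act_inv'[of g x] g W'_sub[of i] r by (auto simp: a_def)
    then show "x \<in> D i"
      unfolding D_def using g by (metis SigmaI image_eqI)
  qed
  have D_mem: "\<gamma> i x \<in> W' i" "\<phi> (inv (\<gamma> i x)) x \<in> Z" if "x \<in> D i" for x i
    using D_iff[of x i] that the[of _ i x] by auto
  have D_sets: "D i \<in> sets (borel_of X)" for i
    unfolding D_def by (rule image[OF W'_sets order_refl])
  have \<gamma>_G: "\<gamma> i x \<in> carrier G" for i x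
  proof (cases "x \<in> D i")
    case True
    then show ?thesis using D_mem(1) W'_sub by blast
  qed (simp add: \<gamma>_def)
  have "section_flow G T (borel_of X) \<phi> Z D \<gamma>"
  proof unfold_locales
    show "\<gamma> i \<in> borel_of X \<rightarrow>\<^sub>M borel_of T" for i
    proof (rule measurableI)
      fix B assume B: "B \<in> sets (borel_of T)"
      have eq: "\<gamma> i -` B \<inter> space (borel_of X) =
          a ` ((B \<inter> W' i) \<times> Z) \<union> (if \<one> \<in> B then topspace X - D i else {})"
      proof (rule Set.set_eqI)
        fix x
        have "x \<in> a ` ((B \<inter> W' i) \<times> Z) \<longleftrightarrow> x \<in> D i \<and> \<gamma> i x \<in> B"
        proof
          assume "x \<in> a ` ((B \<inter> W' i) \<times> Z)"
          then obtain g z where gz: "g \<in> B" "g \<in> W' i" "z \<in> Z" "x = \<phi> g z"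
            by (auto simp: a_def)
          then have "x \<in> D i"
            unfolding D_def a_def by force
          moreover have "\<phi> (inv g) x = z"
            using gz F.act_inv[of g z] W'_sub[of i] ZX by auto
          then have "\<gamma> i x = g"
            using gz D_space \<open>x \<in> D i\<close> by (intro the) auto
          ultimately show "x \<in> D i \<and> \<gamma> i x \<in> B"
            using gz by simp
        next
          assume r: "x \<in> D i \<and> \<gamma> i x \<in> B"
          then have "x = a (\<gamma> i x, \<phi> (inv (\<gamma> i x)) x)"
            using F.act_inv'[of "\<gamma> i x" x] \<gamma>_G D_space[of i] by (auto simp: a_def)
          then show "x \<in> a ` ((B \<inter> W' i) \<times> Z)"
            using D_mem r by (metis IntI SigmaI image_eqI)
        qed
        moreover have "\<gamma> i x = \<one>" if "x \<notin> D i"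
          using that by (simp add: \<gamma>_def)
        ultimately show "x \<in> \<gamma> i -` B \<inter> space (borel_of X) \<longleftrightarrow>
            x \<in> a ` ((B \<inter> W' i) \<times> Z) \<union> (if \<one> \<in> B then topspace X - D i else {})"
          using D_space[of i] by auto
      qed
      have "a ` ((B \<inter> W' i) \<times> Z) \<in> sets (borel_of X)"
        by (rule image[of _ i]) (use B W'_sets in auto)
      moreover have "topspace X - D i \<in> sets (borel_of X)"
        using sets.compl_sets[OF D_sets] by simp
      ultimately show "\<gamma> i -` B \<inter> space (borel_of X) \<in> sets (borel_of X)"
        unfolding eq by auto
    qed (simp add: \<gamma>_G topspace_eq)
    fix x assume "x \<in> space (borel_of X)"
    then have x: "x \<in> topspace X" by simp
    show "bij_betw (\<lambda>i. inv (\<gamma> i x)) {i. x \<in> D i} (return_set G \<phi> Z x)"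
    proof (rule bij_betwI')
      fix i j assume ij: "i \<in> {i. x \<in> D i}" "j \<in> {i. x \<in> D i}"
      show "(inv (\<gamma> i x) = inv (\<gamma> j x)) = (i = j)"
      proof
        assume "inv (\<gamma> i x) = inv (\<gamma> j x)"
        then have "\<gamma> i x = \<gamma> j x"
          using \<gamma>_G by (metis inv_inv)
        then show "i = j"
          using D_mem(1)[of x i] D_mem(1)[of x j] ij W'_disj[of "\<gamma> i x" i j] by simp
      qed simp
    next
      fix i assume "i \<in> {i. x \<in> D i}"
      then show "inv (\<gamma> i x) \<in> return_set G \<phi> Z x"
        using D_mem \<gamma>_G by (simp add: return_set_def)
    next
      fix h assume "h \<in> return_set G \<phi> Z x"
      then have h: "h \<in> carrier G" "\<phi> h x \<in> Z"
        by (simp_all add: return_set_def)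
      then have "inv h \<in> (\<Union>i. W' i)"
        unfolding W'_UN by simp
      then obtain i where i: "inv h \<in> W' i" by blast
      have "\<phi> (inv (inv h)) x \<in> Z"
        using h by simp
      then have "x \<in> D i" "\<gamma> i x = inv h"
        using i x D_iff the by blast+
      then show "\<exists>i\<in>{i. x \<in> D i}. h = inv (\<gamma> i x)"
        using h by (intro bexI[of _ i]) auto
    qed
  qed (use Z D_sets in auto)
  then show ?thesis
    by blast
qed

lemma nn_integral_count_space_le_one:
  fixes f :: "'a \<Rightarrow> ennreal"
  assumes "\<And>x. x \<in> A \<Longrightarrow> f x \<le> 1"
    and "\<And>x y. x \<in> A \<Longrightarrow> y \<in> A \<Longrightarrow> f x \<noteq> 0 \<Longrightarrow> f y \<noteq> 0 \<Longrightarrow> x = y"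
  shows "(\<integral>\<^sup>+x. f x \<partial>count_space A) \<le> 1"
proof (cases "\<exists>x\<in>A. f x \<noteq> 0")
  case True
  then obtain x where x: "x \<in> A" "f x \<noteq> 0" by blast
  have "(\<integral>\<^sup>+x. f x \<partial>count_space A) = sum f {x}"
    using x assms(2) by (intro nn_integral_count_space') auto
  then show ?thesis
    using assms(1) x by simp
next
  case False
  then have "(\<integral>\<^sup>+x. f x \<partial>count_space A) = (\<integral>\<^sup>+x. 0 \<partial>count_space A)"
    by (intro nn_integral_cong) auto
  then show ?thesis by simp
qed

text \<open>Test the identity on the indicator of \<open>V \<times> Z\<close>, where V is so small
  that at most one return time of each point has its inverse in V. The fibre sums are at most 1, so
  m(V) times the mass of \<nu> is at most the mass of \<mu>, and m(V) is not 0.\<close>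

lemma (in section_flow) transverse_finite:
  assumes m: "haar_group G T m" and sep: "separated_cross_section G T S \<phi> Z"
    and tr: "transverse_measure G T m S \<phi> Z \<mu> \<nu>" and \<mu>: "sets \<mu> = sets S" "finite_measure \<mu>"
  shows "finite_measure \<nu>"
proof
  interpret haar_group G T m by fact
  interpret \<mu>: finite_measure \<mu> by fact
  obtain V where V: "openin T V" "\<one> \<in> V"
    and one: "\<And>x h h'. x \<in> space S \<Longrightarrow> h \<in> return_set G \<phi> Z x \<Longrightarrow> h' \<in> return_set G \<phi> Z x \<Longrightarrow>
      inv h \<in> V \<Longrightarrow> inv h' \<in> V \<Longrightarrow> h = h'"
    by (rule separated_return_times[OF sep]) (rule that)
  have Vm: "V \<in> sets (borel_of T)"
    by (rule openin_borel_of[OF V(1)])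
  have "emeasure \<nu> (space \<nu>) * emeasure m V = (\<integral>\<^sup>+h. \<integral>\<^sup>+t. ennreal (indicator V h) \<partial>\<nu> \<partial>m)"
  proof -
    have "(\<integral>\<^sup>+h. \<integral>\<^sup>+t. ennreal (indicator V h) \<partial>\<nu> \<partial>m) = (\<integral>\<^sup>+h. emeasure \<nu> (space \<nu>) * indicator V h \<partial>m)"
      by (simp add: ennreal_indicator mult.commute)
    also have "\<dots> = emeasure \<nu> (space \<nu>) * emeasure m V"
      using Vm by (intro nn_integral_cmult_indicator) (simp add: sets_m)
    finally show ?thesis by simp
  qed
  also have "\<dots> = (\<integral>\<^sup>+x. fibre_sum (\<lambda>p. ennreal (indicator V (fst p))) x \<partial>\<mu>)"
  proof -
    have "(\<lambda>p. indicator V (fst p) :: real) \<in> borel_measurable (borel_of T \<Otimes>\<^sub>M restrict_space S Z)"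
      using Vm by measurable
    from transverse_bounded[OF tr \<mu>(1) this, of 1] show ?thesis
      by (simp add: indicator_def)
  qed
  also have "\<dots> \<le> (\<integral>\<^sup>+x. 1 \<partial>\<mu>)"
  proof (rule nn_integral_mono)
    fix x assume "x \<in> space \<mu>"
    then have "x \<in> space S"
      using sets_eq_imp_space_eq[OF \<mu>(1)] by simp
    then show "fibre_sum (\<lambda>p. ennreal (indicator V (fst p))) x \<le> 1"
      unfolding fibre_sum_def using one[of x]
      by (intro nn_integral_count_space_le_one) (auto simp: indicator_def split: if_splits)
  qed
  also have "\<dots> < \<infinity>"
    using \<mu>.emeasure_finite by (simp add: less_top[symmetric])
  finally have "emeasure \<nu> (space \<nu>) * emeasure m V < \<infinity>" .
  moreover have "emeasure m V \<noteq> 0"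
    using V by (intro emeasure_open_nonzero) auto
  ultimately show "emeasure \<nu> (space \<nu>) \<noteq> \<infinity>"
    by (auto simp: ennreal_top_mult)
qed

section \<open>Finite products of measures\<close>

text \<open>The locale asks for sigma-finiteness at all indices. Outside I the family is filled up
  with the trivial measure, which does not change products over I.\<close>

lemma product_sigma_finite_if:
  assumes "\<And>i. i \<in> I \<Longrightarrow> sigma_finite_measure (M i)"
  shows "product_sigma_finite (\<lambda>i. if i \<in> I then M i else count_space {})"
  using assms by (intro product_sigma_finite.intro) (auto intro: sigma_finite_measure_count_space_finite)

lemma PiM_if: "PiM I (\<lambda>i. if i \<in> I then M i else N i) = PiM I M"
  by (intro PiM_cong) auto

lemma PiM_eqI_sigma_finite:
  assumes I: "finite I" and M: "\<And>i. i \<in> I \<Longrightarrow> sigma_finite_measure (M i)"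
    and P: "sets P = sets (PiM I M)"
    and eq: "\<And>A. (\<And>i. i \<in> I \<Longrightarrow> A i \<in> sets (M i)) \<Longrightarrow> emeasure P (Pi\<^sub>E I A) = (\<Prod>i\<in>I. emeasure (M i) (A i))"
  shows "P = PiM I M"
proof -
  interpret product_sigma_finite "\<lambda>i. if i \<in> I then M i else count_space {}"
    by (rule product_sigma_finite_if[OF M])
  have "P = PiM I (\<lambda>i. if i \<in> I then M i else count_space {})"
    using I P eq by (intro PiM_eqI) (auto simp: PiM_if)
  then show ?thesis
    by (simp add: PiM_if)
qed

lemma sigma_finite_PiM:
  assumes I: "finite I" and M: "\<And>i. i \<in> I \<Longrightarrow> sigma_finite_measure (M i)"
  shows "sigma_finite_measure (PiM I M)"
proof -
  interpret product_sigma_finite "\<lambda>i. if i \<in> I then M i else count_space {}"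
    by (rule product_sigma_finite_if[OF M])
  show ?thesis
    using sigma_finite[OF I] by (simp add: PiM_if)
qed

lemma emeasure_PiM_sigma_finite:
  assumes I: "finite I" and M: "\<And>i. i \<in> I \<Longrightarrow> sigma_finite_measure (M i)"
    and A: "\<And>i. i \<in> I \<Longrightarrow> A i \<in> sets (M i)"
  shows "emeasure (PiM I M) (Pi\<^sub>E I A) = (\<Prod>i\<in>I. emeasure (M i) (A i))"
proof -
  interpret product_sigma_finite "\<lambda>i. if i \<in> I then M i else count_space {}"
    by (rule product_sigma_finite_if[OF M])
  show ?thesis
    using emeasure_PiM[OF I, of A] A by (simp add: PiM_if)
qed

lemma nn_integral_PiM_prod:
  assumes I: "finite I" and M: "\<And>i. i \<in> I \<Longrightarrow> sigma_finite_measure (M i)"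
    and f: "\<And>i. i \<in> I \<Longrightarrow> f i \<in> borel_measurable (M i)"
  shows "(\<integral>\<^sup>+x. (\<Prod>i\<in>I. f i (x i)) \<partial>PiM I M) = (\<Prod>i\<in>I. integral\<^sup>N (M i) (f i))"
proof -
  interpret product_sigma_finite "\<lambda>i. if i \<in> I then M i else count_space {}"
    by (rule product_sigma_finite_if[OF M])
  show ?thesis
    using product_nn_integral_prod[OF I, of f] f by (simp add: PiM_if)
qed

lemma nn_integral_PiM_split:
  assumes I: "finite I" "i \<in> I" and M: "\<And>i. i \<in> I \<Longrightarrow> sigma_finite_measure (M i)"
    and f: "f \<in> borel_measurable (PiM I M)"
  shows "integral\<^sup>N (PiM I M) f = (\<integral>\<^sup>+y. (\<integral>\<^sup>+x. f (x(i := y)) \<partial>PiM (I - {i}) M) \<partial>M i)"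
proof -
  interpret product_sigma_finite "\<lambda>i. if i \<in> I then M i else count_space {}"
    by (rule product_sigma_finite_if[OF M])
  have "PiM (I - {i}) (\<lambda>i. if i \<in> I then M i else count_space {}) = PiM (I - {i}) M"
    by (intro PiM_cong) auto
  moreover have "insert i (I - {i}) = I"
    using I by auto
  ultimately show ?thesis
    using product_nn_integral_insert_rev[of "I - {i}" i f] I f by (simp add: PiM_if)
qed

lemma prod_indicator_PiE:
  assumes "finite I" "x \<in> extensional I"
  shows "(\<Prod>i\<in>I. indicator (A i) (x i)) = (indicator (Pi\<^sub>E I A) x :: ennreal)"
  using assms by (auto simp: indicator_def PiE_iff)

text \<open>Zipping two tuples carries the pair of product measures to the product of the pair
  measures, because both agree on boxes, where all integrals factor. In \<open>lift\<close> this is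
  applied on both sides: to group elements with points of the sections, and to branch indices with
  points of the spaces.\<close>

lemma nn_integral_PiM_pair:
  assumes I: "finite I" and M: "\<And>i. i \<in> I \<Longrightarrow> sigma_finite_measure (M i)"
    and N: "\<And>i. i \<in> I \<Longrightarrow> sigma_finite_measure (N i)"
    and F: "F \<in> borel_measurable (PiM I (\<lambda>i. M i \<Otimes>\<^sub>M N i))"
  shows "integral\<^sup>N (PiM I (\<lambda>i. M i \<Otimes>\<^sub>M N i)) F =
    (\<integral>\<^sup>+z. (\<integral>\<^sup>+g. F (\<lambda>i\<in>I. (g i, z i)) \<partial>PiM I M) \<partial>PiM I N)"
proof -
  interpret PM: sigma_finite_measure "PiM I M"
    by (rule sigma_finite_PiM[OF I M])
  interpret PN: sigma_finite_measure "PiM I N"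
    by (rule sigma_finite_PiM[OF I N])
  define J where "J = (\<lambda>(z, g). \<lambda>i\<in>I. (g i, z i) :: 'b \<times> 'c)"
  have J: "J \<in> PiM I N \<Otimes>\<^sub>M PiM I M \<rightarrow>\<^sub>M PiM I (\<lambda>i. M i \<Otimes>\<^sub>M N i)"
    unfolding J_def case_prod_beta' by measurable
  have pair: "sigma_finite_measure (M i \<Otimes>\<^sub>M N i)" if "i \<in> I" for i
  proof -
    interpret pair_sigma_finite "M i" "N i"
      using M N that by (intro pair_sigma_finite.intro)
    show ?thesis
      by (rule P.sigma_finite_measure_axioms)
  qed
  have "distr (PiM I N \<Otimes>\<^sub>M PiM I M) (PiM I (\<lambda>i. M i \<Otimes>\<^sub>M N i)) J = PiM I (\<lambda>i. M i \<Otimes>\<^sub>M N i)"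
  proof (rule PiM_eqI_sigma_finite[OF I pair])
    fix A assume A: "\<And>i. i \<in> I \<Longrightarrow> A i \<in> sets (M i \<Otimes>\<^sub>M N i)"
    have box: "Pi\<^sub>E I A \<in> sets (PiM I (\<lambda>i. M i \<Otimes>\<^sub>M N i))"
      using A I by (intro sets_PiM_I_finite) auto
    have "emeasure (distr (PiM I N \<Otimes>\<^sub>M PiM I M) (PiM I (\<lambda>i. M i \<Otimes>\<^sub>M N i)) J) (Pi\<^sub>E I A) =
        (\<integral>\<^sup>+p. indicator (Pi\<^sub>E I A) (J p) \<partial>(PiM I N \<Otimes>\<^sub>M PiM I M))"
      using nn_integral_distr[OF J, of "indicator (Pi\<^sub>E I A)"] box by simp
    also have "\<dots> = (\<integral>\<^sup>+z. \<integral>\<^sup>+g. indicator (Pi\<^sub>E I A) (J (z, g)) \<partial>PiM I M \<partial>PiM I N)"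
      by (rule PM.nn_integral_fst[symmetric])
        (rule measurable_compose[OF J borel_measurable_indicator[OF box]])
    also have "\<dots> = (\<integral>\<^sup>+z. \<integral>\<^sup>+g. (\<Prod>i\<in>I. indicator (A i) (g i, z i)) \<partial>PiM I M \<partial>PiM I N)"
      using I by (intro nn_integral_cong) (simp add: J_def prod_indicator_PiE[symmetric])
    also have "\<dots> = (\<integral>\<^sup>+z. (\<Prod>i\<in>I. \<integral>\<^sup>+g. indicator (A i) (g, z i) \<partial>M i) \<partial>PiM I N)"
    proof (rule nn_integral_cong)
      fix z assume z: "z \<in> space (PiM I N)"
      show "(\<integral>\<^sup>+g. (\<Prod>i\<in>I. indicator (A i) (g i, z i)) \<partial>PiM I M) =
          (\<Prod>i\<in>I. \<integral>\<^sup>+g. indicator (A i) (g, z i) \<partial>M i)"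
      proof (rule nn_integral_PiM_prod[OF I M])
        fix i assume i: "i \<in> I"
        then have "z i \<in> space (N i)"
          using z by (auto simp: space_PiM)
        then show "(\<lambda>g. indicator (A i) (g, z i) :: ennreal) \<in> borel_measurable (M i)"
          by (rule measurable_compose[OF measurable_Pair2' borel_measurable_indicator[OF A[OF i]]])
      qed
    qed
    also have "\<dots> = (\<Prod>i\<in>I. \<integral>\<^sup>+z. \<integral>\<^sup>+g. indicator (A i) (g, z) \<partial>M i \<partial>N i)"
    proof (rule nn_integral_PiM_prod[OF I N])
      fix i assume i: "i \<in> I"
      interpret pair_sigma_finite "M i" "N i"
        using M N i by (intro pair_sigma_finite.intro)
      show "(\<lambda>z. \<integral>\<^sup>+g. indicator (A i) (g, z) \<partial>M i) \<in> borel_measurable (N i)"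
        using A[OF i] by measurable
    qed
    also have "\<dots> = (\<Prod>i\<in>I. emeasure (M i \<Otimes>\<^sub>M N i) (A i))"
    proof (rule prod.cong[OF refl])
      fix i assume i: "i \<in> I"
      interpret pair_sigma_finite "M i" "N i"
        using M N i by (intro pair_sigma_finite.intro)
      show "(\<integral>\<^sup>+z. \<integral>\<^sup>+g. indicator (A i) (g, z) \<partial>M i \<partial>N i) = emeasure (M i \<Otimes>\<^sub>M N i) (A i)"
        using A[OF i] by (subst nn_integral_snd) auto
    qed
    finally show "emeasure (distr (PiM I N \<Otimes>\<^sub>M PiM I M) (PiM I (\<lambda>i. M i \<Otimes>\<^sub>M N i)) J) (Pi\<^sub>E I A) =
        (\<Prod>i\<in>I. emeasure (M i \<Otimes>\<^sub>M N i) (A i))" .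
  qed (assumption, rule sets_distr)
  then have "integral\<^sup>N (PiM I (\<lambda>i. M i \<Otimes>\<^sub>M N i)) F = (\<integral>\<^sup>+p. F (J p) \<partial>(PiM I N \<Otimes>\<^sub>M PiM I M))"
    using nn_integral_distr[OF J, of F] F by simp
  also have "\<dots> = (\<integral>\<^sup>+z. (\<integral>\<^sup>+g. F (J (z, g)) \<partial>PiM I M) \<partial>PiM I N)"
    using measurable_compose[OF J F] by (intro PM.nn_integral_fst[symmetric])
  finally show ?thesis
    by (simp add: J_def)
qed

text \<open>Assumption \<open>push\<close> says that \<open>L i\<close> is the image under
  \<open>j i\<close> of the restriction of \<open>M i\<close> to \<open>E i\<close>. On boxes the
  integrals factor, so the product measures are related in the same way.\<close>

lemma nn_integral_PiM_push:
  assumes I: "finite I" and M: "\<And>i. i \<in> I \<Longrightarrow> sigma_finite_measure (M i)"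
    and L: "\<And>i. i \<in> I \<Longrightarrow> sigma_finite_measure (L i)"
    and E: "\<And>i. i \<in> I \<Longrightarrow> E i \<in> sets (M i)"
    and j: "\<And>i. i \<in> I \<Longrightarrow> j i \<in> M i \<rightarrow>\<^sub>M L i"
    and push: "\<And>i A. i \<in> I \<Longrightarrow> A \<in> sets (L i) \<Longrightarrow>
      emeasure (L i) A = (\<integral>\<^sup>+x. indicator (E i) x * indicator A (j i x) \<partial>M i)"
    and F: "F \<in> borel_measurable (PiM I L)"
  shows "integral\<^sup>N (PiM I L) F = (\<integral>\<^sup>+x. indicator (Pi\<^sub>E I E) x * F (\<lambda>i\<in>I. j i (x i)) \<partial>PiM I M)"
proof -
  define J where "J x = (\<lambda>i\<in>I. j i (x i))" for x
  have J: "J \<in> PiM I M \<rightarrow>\<^sub>M PiM I L"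
    unfolding J_def
  proof (rule measurable_restrict)
    fix i assume i: "i \<in> I"
    show "(\<lambda>x. j i (x i)) \<in> PiM I M \<rightarrow>\<^sub>M L i"
      by (rule measurable_compose[of "\<lambda>x. x i" "PiM I M" "M i" "j i", OF measurable_component_singleton[OF i] j[OF i]])
  qed
  have box: "Pi\<^sub>E I E \<in> sets (PiM I M)"
    using E I by (intro sets_PiM_I_finite) auto
  let ?d = "density (PiM I M) (indicator (Pi\<^sub>E I E))"
  have int: "integral\<^sup>N (distr ?d (PiM I L) J) f =
      (\<integral>\<^sup>+x. indicator (Pi\<^sub>E I E) x * f (J x) \<partial>PiM I M)" if f: "f \<in> borel_measurable (PiM I L)" for f
  proof -
    have "integral\<^sup>N (distr ?d (PiM I L) J) f = (\<integral>\<^sup>+x. f (J x) \<partial>?d)"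
      using J f by (intro nn_integral_distr) simp_all
    also have "\<dots> = (\<integral>\<^sup>+x. indicator (Pi\<^sub>E I E) x * f (J x) \<partial>PiM I M)"
      using box measurable_compose[OF J f] by (intro nn_integral_density) auto
    finally show ?thesis .
  qed
  have "distr ?d (PiM I L) J = PiM I L"
  proof (rule PiM_eqI_sigma_finite[OF I L])
    fix A assume A: "\<And>i. i \<in> I \<Longrightarrow> A i \<in> sets (L i)"
    have boxA: "Pi\<^sub>E I A \<in> sets (PiM I L)"
      using A I by (intro sets_PiM_I_finite) auto
    have "emeasure (distr ?d (PiM I L) J) (Pi\<^sub>E I A) =
        (\<integral>\<^sup>+x. indicator (Pi\<^sub>E I E) x * indicator (Pi\<^sub>E I A) (J x) \<partial>PiM I M)"
      using int[of "indicator (Pi\<^sub>E I A)"] boxA by simp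
    also have "\<dots> = (\<integral>\<^sup>+x. (\<Prod>i\<in>I. indicator (E i) (x i) * indicator (A i) (j i (x i))) \<partial>PiM I M)"
    proof (rule nn_integral_cong)
      fix x assume "x \<in> space (PiM I M)"
      then have "x \<in> extensional I"
        by (auto simp: space_PiM PiE_def)
      moreover have "J x \<in> extensional I"
        by (simp add: J_def)
      moreover have "(\<Prod>i\<in>I. indicator (A i) (J x i) :: ennreal) = (\<Prod>i\<in>I. indicator (A i) (j i (x i)))"
        by (intro prod.cong) (simp_all add: J_def)
      ultimately show "indicator (Pi\<^sub>E I E) x * indicator (Pi\<^sub>E I A) (J x) =
          (\<Prod>i\<in>I. indicator (E i) (x i) * indicator (A i) (j i (x i)) :: ennreal)"
        using I by (simp add: prod_indicator_PiE[symmetric] prod.distrib)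
    qed
    also have "\<dots> = (\<Prod>i\<in>I. \<integral>\<^sup>+x. indicator (E i) x * indicator (A i) (j i x) \<partial>M i)"
    proof (rule nn_integral_PiM_prod[OF I M])
      fix i assume i: "i \<in> I"
      show "(\<lambda>x. indicator (E i) x * indicator (A i) (j i x) :: ennreal) \<in> borel_measurable (M i)"
        using E[OF i] measurable_compose[OF j[OF i] borel_measurable_indicator[OF A[OF i]]]
        by (intro borel_measurable_times_ennreal) auto
    qed
    also have "\<dots> = (\<Prod>i\<in>I. emeasure (L i) (A i))"
      using push A by (intro prod.cong) auto
    finally show "emeasure (distr ?d (PiM I L) J) (Pi\<^sub>E I A) = (\<Prod>i\<in>I. emeasure (L i) (A i))" .
  qed (assumption, rule sets_distr)
  then show ?thesis
    using int[OF F] by (simp add: J_def)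
qed

lemma bij_betw_PiE_map:
  assumes bij: "\<And>i. i \<in> I \<Longrightarrow> bij_betw (f i) (A i) (B i)"
  shows "bij_betw (\<lambda>x. \<lambda>i\<in>I. f i (x i)) (Pi\<^sub>E I A) (Pi\<^sub>E I B)"
proof (rule bij_betwI)
  show "(\<lambda>x. \<lambda>i\<in>I. f i (x i)) \<in> Pi\<^sub>E I A \<rightarrow> Pi\<^sub>E I B"
    using bij_betw_apply[OF bij] by (intro Pi_I restrict_PiE_iff[THEN iffD2] ballI) (auto dest: PiE_mem)
  show "(\<lambda>y. \<lambda>i\<in>I. inv_into (A i) (f i) (y i)) \<in> Pi\<^sub>E I B \<rightarrow> Pi\<^sub>E I A"
    using bij_betw_apply[OF bij_betw_inv_into[OF bij]]
    by (intro Pi_I restrict_PiE_iff[THEN iffD2] ballI) (auto dest: PiE_mem)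
  fix x assume x: "x \<in> Pi\<^sub>E I A"
  have "inv_into (A i) (f i) (f i (x i)) = x i" if "i \<in> I" for i
    using bij_betw_inv_into_left[OF bij[OF that] PiE_mem[OF x that]] .
  then show "(\<lambda>i\<in>I. inv_into (A i) (f i) ((\<lambda>i\<in>I. f i (x i)) i)) = x"
    using PiE_arb[OF x] by (intro ext) (simp add: restrict_def)
next
  fix y assume y: "y \<in> Pi\<^sub>E I B"
  have "f i (inv_into (A i) (f i) (y i)) = y i" if "i \<in> I" for i
    using bij_betw_inv_into_right[OF bij[OF that] PiE_mem[OF y that]] .
  then show "(\<lambda>i\<in>I. f i ((\<lambda>i\<in>I. inv_into (A i) (f i) (y i)) i)) = y"
    using PiE_arb[OF y] by (intro ext) (simp add: restrict_def)
qed

section \<open>Return times of several flows\<close>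

text \<open>Nothing makes these counting measures sigma-finite, so both iterated sums are compared
  with counting measure on the set of pairs.\<close>

lemma nn_integral_count_space_swap:
  fixes f :: "'a \<Rightarrow> 'b \<Rightarrow> ennreal"
  shows "(\<integral>\<^sup>+x. \<integral>\<^sup>+y. f x y \<partial>count_space B \<partial>count_space A) =
    (\<integral>\<^sup>+y. \<integral>\<^sup>+x. f x y \<partial>count_space A \<partial>count_space B)"
proof -
  let ?f = "\<lambda>(x, y). f x y * indicator B y * indicator A x"
  have "(\<integral>\<^sup>+x. \<integral>\<^sup>+y. f x y \<partial>count_space B \<partial>count_space A) =
      (\<integral>\<^sup>+x. \<integral>\<^sup>+y. ?f (x, y) \<partial>count_space UNIV \<partial>count_space UNIV)"
    by (simp add: nn_integral_count_space_indicator nn_integral_multc)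
  also have "\<dots> = (\<integral>\<^sup>+y. \<integral>\<^sup>+x. ?f (x, y) \<partial>count_space UNIV \<partial>count_space UNIV)"
    by (simp only: nn_integral_fst_count_space nn_integral_snd_count_space)
  also have "\<dots> = (\<integral>\<^sup>+y. \<integral>\<^sup>+x. f x y \<partial>count_space A \<partial>count_space B)"
    by (simp add: nn_integral_count_space_indicator nn_integral_cmult[symmetric] ac_simps)
  finally show ?thesis .
qed

locale joint_flow = unimodular_group G T m for G (structure) and T and m :: "'a measure" +
  fixes I :: "'i set" and S :: "'i \<Rightarrow> 's measure" and \<phi> :: "'i \<Rightarrow> 'a \<Rightarrow> 's \<Rightarrow> 's"
    and Z :: "'i \<Rightarrow> 's set" and D :: "'i \<Rightarrow> nat \<Rightarrow> 's set" and \<gamma> :: "'i \<Rightarrow> nat \<Rightarrow> 's \<Rightarrow> 'a"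
    and \<mu> \<nu> :: "'i \<Rightarrow> 's measure"
  assumes finite_I: "finite I" and I_ne: "I \<noteq> {}"
    and flow: "k \<in> I \<Longrightarrow> section_flow G T (S k) (\<phi> k) (Z k) (D k) (\<gamma> k)"
    and Z_ne: "k \<in> I \<Longrightarrow> Z k \<noteq> {}"
    and cover: "k \<in> I \<Longrightarrow> x \<in> space (S k) \<Longrightarrow> return_set G (\<phi> k) (Z k) x \<noteq> {}"
    and sets_\<mu>: "k \<in> I \<Longrightarrow> sets (\<mu> k) = sets (S k)"
    and prob_\<mu>: "k \<in> I \<Longrightarrow> prob_space (\<mu> k)"
    and sets_\<nu>: "k \<in> I \<Longrightarrow> sets (\<nu> k) = sets (restrict_space (S k) (Z k))"
    and finite_\<nu>: "k \<in> I \<Longrightarrow> finite_measure (\<nu> k)"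
    and transverse: "k \<in> I \<Longrightarrow> F \<in> borel_measurable (borel_of T \<Otimes>\<^sub>M restrict_space (S k) (Z k)) \<Longrightarrow>
      (\<integral>\<^sup>+x. \<integral>\<^sup>+h. F (inv h, \<phi> k h x) \<partial>count_space (return_set G (\<phi> k) (Z k) x) \<partial>\<mu> k) =
      (\<integral>\<^sup>+h. \<integral>\<^sup>+t. F (h, t) \<partial>\<nu> k \<partial>m)"
begin

abbreviation R :: "'i \<Rightarrow> 's \<Rightarrow> 'a set" where
  "R k x \<equiv> return_set G (\<phi> k) (Z k) x"

abbreviation RR :: "('i \<Rightarrow> 's) \<Rightarrow> ('i \<Rightarrow> 'a) set" where
  "RR x \<equiv> Pi\<^sub>E I (\<lambda>k. R k (x k))"

lemma space_\<mu>: "k \<in> I \<Longrightarrow> space (\<mu> k) = space (S k)"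
  using sets_eq_imp_space_eq[OF sets_\<mu>] .

lemma Z_space: "k \<in> I \<Longrightarrow> Z k \<subseteq> space (S k)"
  using section_flow.Z_space[OF flow] .

lemma sigma_finite_\<mu>: "k \<in> I \<Longrightarrow> sigma_finite_measure (\<mu> k)"
  using prob_\<mu> by (simp add: prob_space_imp_sigma_finite)

lemma sigma_finite_\<nu>: "k \<in> I \<Longrightarrow> sigma_finite_measure (\<nu> k)"
  using finite_\<nu> by (simp add: finite_measure_def)

lemma borel_flow: "k \<in> I \<Longrightarrow> borel_flow G T (S k) (\<phi> k)"
  using flow by (rule section_flow.axioms(1))

lemmas flow_closed = borel_flow.act_closed[OF borel_flow]
  and flow_one = borel_flow.act_one[OF borel_flow]
  and flow_mult = borel_flow.act_mult[OF borel_flow]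
  and flow_inv = borel_flow.act_inv[OF borel_flow]
  and flow_inv' = borel_flow.act_inv'[OF borel_flow]
  and measurable_flow = borel_flow.measurable_act[OF borel_flow]

lemma measurable_cong_m: "M \<rightarrow>\<^sub>M m = M \<rightarrow>\<^sub>M borel_of T"
  by (rule measurable_cong_sets[OF refl sets_m])

text \<open>The times \<open>h\<close> with \<open>\<phi> h x \<in> Z\<close> enter as \<open>(inv h, \<phi> h x)\<close>, the points of
  \<open>G \<times> Z\<close> above \<open>x\<close>.\<close>

lemma lift:
  assumes F: "F \<in> borel_measurable (PiM I (\<lambda>k. m \<Otimes>\<^sub>M \<nu> k))"
  shows "(\<integral>\<^sup>+z. (\<integral>\<^sup>+g. F (\<lambda>k\<in>I. (g k, z k)) \<partial>PiM I (\<lambda>_. m)) \<partial>PiM I \<nu>) =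
    (\<integral>\<^sup>+x. (\<integral>\<^sup>+h. F (\<lambda>k\<in>I. (inv (h k), \<phi> k (h k) (x k))) \<partial>count_space (RR x)) \<partial>PiM I \<mu>)"
proof -
  \<comment> \<open>\<open>N \<Otimes>\<^sub>M \<mu> k\<close> carries one copy of the space for
    every branch index. On the part \<open>E k\<close>, where the branch exists, \<open>j k\<close>
    sends (i, x) to the i-th point above x. The identity for a single flow then says that the image
    of this part is \<open>m \<Otimes>\<^sub>M \<nu> k\<close>, a statement that survives finite
    products.\<close>
  define N :: "nat measure" where "N = count_space UNIV"
  have N: "sigma_finite_measure N"
    unfolding N_def by (rule sigma_finite_measure_count_space)
  define z0 where "z0 k = (SOME z. z \<in> Z k)" for k
  have z0: "z0 k \<in> Z k" if "k \<in> I" for k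
    unfolding z0_def using Z_ne[OF that] by (simp add: some_in_eq)
  \<comment> \<open>The value off the branch domains is arbitrary in \<open>G \<times> Z\<close> and
    never counts, since \<open>E k\<close> excludes it; \<open>Z_ne\<close> supplies a point for
    it.\<close>
  define j where "j k = (\<lambda>(i, x). if x \<in> D k i then (\<gamma> k i x, \<phi> k (inv (\<gamma> k i x)) x) else (\<one>, z0 k))" for k
  define E where "E k = {p \<in> space (N \<Otimes>\<^sub>M \<mu> k). snd p \<in> D k (fst p)}" for k
  have E: "E k \<in> sets (N \<Otimes>\<^sub>M \<mu> k)" if k: "k \<in> I" for k
  proof -
    have "E k = (\<Union>i. {i} \<times> D k i)"
      using section_flow.D[OF flow[OF k], THEN sets.sets_into_space] space_\<mu>[OF k]
      by (auto simp: E_def space_pair_measure N_def)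
    moreover have "{i} \<times> D k i \<in> sets (N \<Otimes>\<^sub>M \<mu> k)" for i
      using section_flow.D[OF flow[OF k], of i] sets_\<mu>[OF k]
      by (intro pair_measureI) (auto simp: N_def)
    ultimately show ?thesis
      by auto
  qed
  have j: "j k \<in> N \<Otimes>\<^sub>M \<mu> k \<rightarrow>\<^sub>M m \<Otimes>\<^sub>M \<nu> k" if k: "k \<in> I" for k
  proof -
    interpret section_flow G T "S k" "\<phi> k" "Z k" "D k" "\<gamma> k" by (rule flow[OF k])
    have target: "sets (m \<Otimes>\<^sub>M \<nu> k) = sets (borel_of T \<Otimes>\<^sub>M restrict_space (S k) (Z k))"
      by (rule sets_pair_measure_cong[OF sets_m sets_\<nu>[OF k]])
    have "(\<lambda>x. j k (i, x)) \<in> S k \<rightarrow>\<^sub>M borel_of T \<Otimes>\<^sub>M restrict_space (S k) (Z k)" for i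
    proof -
      have "(\<lambda>x. if x \<in> D k i then (\<gamma> k i x, \<phi> k (inv (\<gamma> k i x)) x) else (\<one>, z0 k)) \<in>
          S k \<rightarrow>\<^sub>M borel_of T \<Otimes>\<^sub>M restrict_space (S k) (Z k)"
      proof (subst measurable_If_restrict_space_iff)
        show "{x \<in> space (S k). x \<in> D k i} \<in> sets (S k)"
          using D by simp
        have "(\<one>, z0 k) \<in> space (borel_of T \<Otimes>\<^sub>M restrict_space (S k) (Z k))"
          using z0[OF k] space_Z by (simp add: space_pair_measure topspace_eq)
        then show "(\<lambda>x. (\<gamma> k i x, \<phi> k (inv (\<gamma> k i x)) x)) \<in>
            restrict_space (S k) {x. x \<in> D k i} \<rightarrow>\<^sub>M borel_of T \<Otimes>\<^sub>M restrict_space (S k) (Z k) \<and>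
            (\<lambda>x. (\<one>, z0 k)) \<in> restrict_space (S k) {x. x \<notin> D k i} \<rightarrow>\<^sub>M borel_of T \<Otimes>\<^sub>M restrict_space (S k) (Z k)"
          using measurable_enum[of i] by (simp add: measurable_const)
      qed
      then show ?thesis
        by (simp add: j_def)
    qed
    then have "(\<lambda>x. j k (i, x)) \<in> \<mu> k \<rightarrow>\<^sub>M m \<Otimes>\<^sub>M \<nu> k" for i
      by (simp add: measurable_cong_sets[OF sets_\<mu>[OF k] target])
    then show ?thesis
      unfolding N_def by (intro measurable_pair_measure_countable1) auto
  qed
  have push: "emeasure (m \<Otimes>\<^sub>M \<nu> k) A = (\<integral>\<^sup>+p. indicator (E k) p * indicator A (j k p) \<partial>(N \<Otimes>\<^sub>M \<mu> k))"
    if k: "k \<in> I" and A: "A \<in> sets (m \<Otimes>\<^sub>M \<nu> k)" for k A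
  proof -
    interpret F: section_flow G T "S k" "\<phi> k" "Z k" "D k" "\<gamma> k" by (rule flow[OF k])
    interpret \<nu>: sigma_finite_measure "\<nu> k" by (rule sigma_finite_\<nu>[OF k])
    interpret pair_sigma_finite N "\<mu> k"
      using N sigma_finite_\<mu>[OF k] by (intro pair_sigma_finite.intro)
    have target: "sets (m \<Otimes>\<^sub>M \<nu> k) = sets (borel_of T \<Otimes>\<^sub>M restrict_space (S k) (Z k))"
      by (rule sets_pair_measure_cong[OF sets_m sets_\<nu>[OF k]])
    have "emeasure (m \<Otimes>\<^sub>M \<nu> k) A = (\<integral>\<^sup>+h. \<integral>\<^sup>+t. indicator A (h, t) \<partial>\<nu> k \<partial>m)"
      using A by (subst \<nu>.nn_integral_fst) auto
    also have "\<dots> = (\<integral>\<^sup>+x. F.fibre_sum (indicator A) x \<partial>\<mu> k)"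
      unfolding F.fibre_sum_def using A target by (intro transverse[OF k, symmetric]) simp
    also have "\<dots> = (\<integral>\<^sup>+x. (\<integral>\<^sup>+i. indicator (E k) (i, x) * indicator A (j k (i, x)) \<partial>N) \<partial>\<mu> k)"
    proof (rule nn_integral_cong)
      fix x assume x: "x \<in> space (\<mu> k)"
      have "F.fibre_sum (indicator A) x =
          (\<Sum>i. if x \<in> D k i then indicator A (\<gamma> k i x, \<phi> k (inv (\<gamma> k i x)) x) else 0)"
        using x space_\<mu>[OF k] by (intro F.fibre_sum_suminf) simp
      also have "\<dots> = (\<Sum>i. indicator (E k) (i, x) * indicator A (j k (i, x)))"
        using x by (intro suminf_cong) (simp add: E_def j_def N_def space_pair_measure)
      finally show "F.fibre_sum (indicator A) x = (\<integral>\<^sup>+i. indicator (E k) (i, x) * indicator A (j k (i, x)) \<partial>N)"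
        unfolding N_def by (simp add: nn_integral_count_space_nat)
    qed
    also have "\<dots> = (\<integral>\<^sup>+p. indicator (E k) p * indicator A (j k p) \<partial>(N \<Otimes>\<^sub>M \<mu> k))"
      using E[OF k] measurable_compose[OF j[OF k] borel_measurable_indicator[OF A]]
      by (intro nn_integral_snd borel_measurable_times_ennreal) auto
    finally show ?thesis .
  qed
  have pairL: "sigma_finite_measure (m \<Otimes>\<^sub>M \<nu> k)" if "k \<in> I" for k
  proof -
    interpret pair_sigma_finite m "\<nu> k"
      using sigma_finite_\<nu>[OF that] by (intro pair_sigma_finite.intro sigma_finite_measure_axioms)
    show ?thesis by (rule P.sigma_finite_measure_axioms)
  qed
  have pairM: "sigma_finite_measure (N \<Otimes>\<^sub>M \<mu> k)" if "k \<in> I" for k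
  proof -
    interpret pair_sigma_finite N "\<mu> k"
      using N sigma_finite_\<mu>[OF that] by (intro pair_sigma_finite.intro)
    show ?thesis by (rule P.sigma_finite_measure_axioms)
  qed
  have box: "Pi\<^sub>E I E \<in> sets (PiM I (\<lambda>k. N \<Otimes>\<^sub>M \<mu> k))"
    using E finite_I by (intro sets_PiM_I_finite) auto
  have J: "(\<lambda>\<omega>. \<lambda>k\<in>I. j k (\<omega> k)) \<in> PiM I (\<lambda>k. N \<Otimes>\<^sub>M \<mu> k) \<rightarrow>\<^sub>M PiM I (\<lambda>k. m \<Otimes>\<^sub>M \<nu> k)"
  proof (rule measurable_restrict)
    fix k assume k: "k \<in> I"
    show "(\<lambda>\<omega>. j k (\<omega> k)) \<in> PiM I (\<lambda>k. N \<Otimes>\<^sub>M \<mu> k) \<rightarrow>\<^sub>M m \<Otimes>\<^sub>M \<nu> k"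
      by (rule measurable_compose[of "\<lambda>x. x k" "PiM I (\<lambda>k. N \<Otimes>\<^sub>M \<mu> k)" "N \<Otimes>\<^sub>M \<mu> k" "j k",
            OF measurable_component_singleton[OF k] j[OF k]])
  qed
  have "(\<integral>\<^sup>+z. (\<integral>\<^sup>+g. F (\<lambda>k\<in>I. (g k, z k)) \<partial>PiM I (\<lambda>_. m)) \<partial>PiM I \<nu>) =
      integral\<^sup>N (PiM I (\<lambda>k. m \<Otimes>\<^sub>M \<nu> k)) F"
    by (rule nn_integral_PiM_pair[OF finite_I sigma_finite_measure_axioms sigma_finite_\<nu> F, symmetric])
  also have "\<dots> = (\<integral>\<^sup>+\<omega>. indicator (Pi\<^sub>E I E) \<omega> * F (\<lambda>k\<in>I. j k (\<omega> k)) \<partial>PiM I (\<lambda>k. N \<Otimes>\<^sub>M \<mu> k))"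
    by (rule nn_integral_PiM_push[OF finite_I pairM pairL E j push F])
  also have "\<dots> = (\<integral>\<^sup>+x. (\<integral>\<^sup>+i. indicator (Pi\<^sub>E I E) (\<lambda>k\<in>I. (i k, x k)) *
      F (\<lambda>k\<in>I. j k ((\<lambda>k\<in>I. (i k, x k)) k)) \<partial>PiM I (\<lambda>_. N)) \<partial>PiM I \<mu>)"
    by (rule nn_integral_PiM_pair[OF finite_I N sigma_finite_\<mu>
          borel_measurable_times_ennreal[OF borel_measurable_indicator[OF box] measurable_compose[OF J F]]])
  also have "\<dots> = (\<integral>\<^sup>+x. (\<integral>\<^sup>+h. F (\<lambda>k\<in>I. (inv (h k), \<phi> k (h k) (x k))) \<partial>count_space (RR x)) \<partial>PiM I \<mu>)"
  proof (rule nn_integral_cong)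
    fix x assume "x \<in> space (PiM I \<mu>)"
    then have x: "x k \<in> space (S k)" if "k \<in> I" for k
      using that space_\<mu>[OF that] by (auto simp: space_PiM)
    define A where "A = Pi\<^sub>E I (\<lambda>k. {i. x k \<in> D k i})"
    \<comment> \<open>The product of counting measures is counting measure on tuples of branch
      indices. Indices outside the domains contribute 0, and the remaining tuples enumerate the
      tuples of return times.\<close>
    have "PiM I (\<lambda>_. N) = count_space (Pi\<^sub>E I (\<lambda>_. UNIV))"
      unfolding N_def by (rule count_space_PiM_finite[OF finite_I]) simp
    then have "(\<integral>\<^sup>+i. indicator (Pi\<^sub>E I E) (\<lambda>k\<in>I. (i k, x k)) *
        F (\<lambda>k\<in>I. j k ((\<lambda>k\<in>I. (i k, x k)) k)) \<partial>PiM I (\<lambda>_. N)) =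
        (\<integral>\<^sup>+i. indicator (Pi\<^sub>E I E) (\<lambda>k\<in>I. (i k, x k)) *
        F (\<lambda>k\<in>I. j k ((\<lambda>k\<in>I. (i k, x k)) k)) \<partial>count_space (Pi\<^sub>E I (\<lambda>_. UNIV)))"
      by simp
    also have "\<dots> = (\<integral>\<^sup>+i. indicator (Pi\<^sub>E I E) (\<lambda>k\<in>I. (i k, x k)) *
        F (\<lambda>k\<in>I. j k ((\<lambda>k\<in>I. (i k, x k)) k)) \<partial>count_space A)"
    proof (rule nn_integral_count_space_eq)
      fix i assume i: "i \<in> Pi\<^sub>E I (\<lambda>_. UNIV) - A"
      then obtain k where "k \<in> I" "x k \<notin> D k (i k)"
        unfolding A_def by (auto simp: PiE_iff)
      then have "(\<lambda>k\<in>I. (i k, x k)) \<notin> Pi\<^sub>E I E"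
        unfolding E_def by (auto simp: PiE_iff)
      then show "indicator (Pi\<^sub>E I E) (\<lambda>k\<in>I. (i k, x k)) * F (\<lambda>k\<in>I. j k ((\<lambda>k\<in>I. (i k, x k)) k)) = 0"
        by simp
    next
      fix i assume i: "i \<in> A - Pi\<^sub>E I (\<lambda>_. UNIV)"
      then show "indicator (Pi\<^sub>E I E) (\<lambda>k\<in>I. (i k, x k)) * F (\<lambda>k\<in>I. j k ((\<lambda>k\<in>I. (i k, x k)) k)) = 0"
        unfolding A_def by (auto simp: PiE_iff)
    qed
    also have "\<dots> = (\<integral>\<^sup>+i. F (\<lambda>k\<in>I. (inv (inv (\<gamma> k (i k) (x k))), \<phi> k (inv (\<gamma> k (i k) (x k))) (x k))) \<partial>count_space A)"
    proof (rule nn_integral_cong)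
      fix i assume "i \<in> space (count_space A)"
      then have i: "x k \<in> D k (i k)" if "k \<in> I" for k
        using that unfolding A_def by (auto simp: PiE_iff)
      then have "(\<lambda>k\<in>I. (i k, x k)) \<in> Pi\<^sub>E I E"
        using x space_\<mu> unfolding E_def by (auto simp: PiE_iff space_pair_measure N_def)
      moreover have "(\<lambda>k\<in>I. j k ((\<lambda>k\<in>I. (i k, x k)) k)) =
          (\<lambda>k\<in>I. (inv (inv (\<gamma> k (i k) (x k))), \<phi> k (inv (\<gamma> k (i k) (x k))) (x k)))"
      proof (rule restrict_ext)
        fix k assume k: "k \<in> I"
        then show "j k ((\<lambda>k\<in>I. (i k, x k)) k) =
            (inv (inv (\<gamma> k (i k) (x k))), \<phi> k (inv (\<gamma> k (i k) (x k))) (x k))"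
          using i[OF k] section_flow.\<gamma>_closed[OF flow[OF k] x[OF k]] by (simp add: j_def)
      qed
      ultimately show "indicator (Pi\<^sub>E I E) (\<lambda>k\<in>I. (i k, x k)) * F (\<lambda>k\<in>I. j k ((\<lambda>k\<in>I. (i k, x k)) k)) =
          F (\<lambda>k\<in>I. (inv (inv (\<gamma> k (i k) (x k))), \<phi> k (inv (\<gamma> k (i k) (x k))) (x k)))"
        by simp
    qed
    also have "\<dots> = (\<integral>\<^sup>+i. (\<lambda>h. F (\<lambda>k\<in>I. (inv (h k), \<phi> k (h k) (x k)))) (\<lambda>k\<in>I. inv (\<gamma> k (i k) (x k))) \<partial>count_space A)"
      by (simp cong: restrict_cong)
    also have "\<dots> = (\<integral>\<^sup>+h. F (\<lambda>k\<in>I. (inv (h k), \<phi> k (h k) (x k))) \<partial>count_space (RR x))"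
      unfolding A_def
      by (rule nn_integral_bij_count_space[OF bij_betw_PiE_map], rule section_flow.enum[OF flow x])
    finally show "(\<integral>\<^sup>+i. indicator (Pi\<^sub>E I E) (\<lambda>k\<in>I. (i k, x k)) *
        F (\<lambda>k\<in>I. j k ((\<lambda>k\<in>I. (i k, x k)) k)) \<partial>PiM I (\<lambda>_. N)) =
        (\<integral>\<^sup>+h. F (\<lambda>k\<in>I. (inv (h k), \<phi> k (h k) (x k))) \<partial>count_space (RR x))" .
  qed
  finally show ?thesis .
qed

text \<open>With group coordinates g_j = inv h_j this is the condition that g_j lies in V_j g_k for
  all j \<noteq> k, that is, the indicator of a neighbourhood of the diagonal, measured from index
  k.\<close>

definition window :: "('i \<Rightarrow> 'a set) \<Rightarrow> 'i \<Rightarrow> ('i \<Rightarrow> 'a) \<Rightarrow> ennreal" where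
  "window V k h = (\<Prod>j\<in>I - {k}. indicator (V j) (inv (h j) \<otimes> h k))"

lemma sigma_finite_m: "sigma_finite_measure m"
  by (rule sigma_finite_measure_axioms)

lemma sigma_finite_PiM_\<nu>: "sigma_finite_measure (PiM I \<nu>)"
  by (rule sigma_finite_PiM[OF finite_I sigma_finite_\<nu>])

text \<open>Restricting the elements \<open>g j\<close>, \<open>j \<noteq> k\<close>, to \<open>V j \<cdot> g k\<close> makes the integral over the
  product of \<open>r\<close> copies of the group an integral over one copy, because the Haar measure is
  right invariant.\<close>

lemma lift_diagonal:
  assumes k: "k \<in> I" and V: "\<And>j. j \<in> I \<Longrightarrow> V j \<in> sets m"
    and H: "H \<in> borel_measurable (m \<Otimes>\<^sub>M PiM I \<nu>)"
  shows "(\<Prod>j\<in>I - {k}. emeasure m (V j)) * integral\<^sup>N (m \<Otimes>\<^sub>M PiM I \<nu>) H =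
    (\<integral>\<^sup>+x. (\<integral>\<^sup>+h. window V k h * H (inv (h k), \<lambda>j\<in>I. \<phi> j (h j) (x j)) \<partial>count_space (RR x)) \<partial>PiM I \<mu>)"
proof -
  interpret N: sigma_finite_measure "PiM I \<nu>"
    by (rule sigma_finite_PiM_\<nu>)
  interpret pair_sigma_finite m "PiM I \<nu>"
    by (intro pair_sigma_finite.intro sigma_finite_m N.sigma_finite_measure_axioms)
  \<comment> \<open>H sees the k-th group coordinate only; the other group coordinates occur in the
    window alone and can be integrated out one by one.\<close>
  define F where "F \<omega> = (\<Prod>j\<in>I - {k}. indicator (V j) (fst (\<omega> j) \<otimes> inv (fst (\<omega> k)))) *
      H (fst (\<omega> k), \<lambda>j\<in>I. snd (\<omega> j))" for \<omega> :: "'i \<Rightarrow> 'a \<times> 's"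
  have fst_m: "(\<lambda>\<omega>. fst (\<omega> j)) \<in> PiM I (\<lambda>k. m \<Otimes>\<^sub>M \<nu> k) \<rightarrow>\<^sub>M m" if "j \<in> I" for j
    by (rule measurable_compose[OF measurable_component_singleton[OF that] measurable_fst])
  have snd_m: "(\<lambda>\<omega>. snd (\<omega> j)) \<in> PiM I (\<lambda>k. m \<Otimes>\<^sub>M \<nu> k) \<rightarrow>\<^sub>M \<nu> j" if "j \<in> I" for j
    by (rule measurable_compose[OF measurable_component_singleton[OF that] measurable_snd])
  have F: "F \<in> borel_measurable (PiM I (\<lambda>k. m \<Otimes>\<^sub>M \<nu> k))"
  proof -
    have "(\<lambda>\<omega>. indicator (V j) (fst (\<omega> j) \<otimes> inv (fst (\<omega> k))) :: ennreal)
        \<in> borel_measurable (PiM I (\<lambda>k. m \<Otimes>\<^sub>M \<nu> k))" if "j \<in> I - {k}" for j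
    proof -
      have "(\<lambda>\<omega>. fst (\<omega> j) \<otimes> inv (fst (\<omega> k))) \<in> PiM I (\<lambda>k. m \<Otimes>\<^sub>M \<nu> k) \<rightarrow>\<^sub>M m"
        using fst_m[of j] fst_m[OF k] that unfolding measurable_cong_m
        by (intro measurable_group_mult measurable_group_inv) auto
      then show ?thesis
        using V[of j] that by (intro measurable_compose[OF _ borel_measurable_indicator]) auto
    qed
    moreover have "(\<lambda>\<omega>. (fst (\<omega> k), \<lambda>j\<in>I. snd (\<omega> j))) \<in> PiM I (\<lambda>k. m \<Otimes>\<^sub>M \<nu> k) \<rightarrow>\<^sub>M m \<Otimes>\<^sub>M PiM I \<nu>"
      by (intro measurable_Pair fst_m[OF k] measurable_restrict snd_m)
    then have "(\<lambda>\<omega>. H (fst (\<omega> k), \<lambda>j\<in>I. snd (\<omega> j))) \<in> borel_measurable (PiM I (\<lambda>k. m \<Otimes>\<^sub>M \<nu> k))"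
      by (rule measurable_compose[OF _ H])
    ultimately show ?thesis
      unfolding F_def by (intro borel_measurable_times_ennreal borel_measurable_prod_ennreal)
  qed
  have eq: "(\<integral>\<^sup>+g. F (\<lambda>k\<in>I. (g k, z k)) \<partial>PiM I (\<lambda>_. m)) =
      (\<Prod>j\<in>I - {k}. emeasure m (V j)) * (\<integral>\<^sup>+g. H (g, z) \<partial>m)" if z: "z \<in> space (PiM I \<nu>)" for z
  proof -
    have zr: "(\<lambda>j\<in>I. z j) = z"
      using z by (auto simp: space_PiM PiE_def extensional_restrict)
    have Fz: "F (\<lambda>k\<in>I. (g k, z k)) = (\<Prod>j\<in>I - {k}. indicator (V j) (g j \<otimes> inv (g k))) * H (g k, z)" for g
    proof -
      have "(\<lambda>j\<in>I. snd ((\<lambda>k\<in>I. (g k, z k)) j)) = z"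
        using zr by (metis (mono_tags, lifting) restrict_apply' restrict_ext snd_conv)
      then show ?thesis
        using k by (simp add: F_def)
    qed
    have meas: "(\<lambda>g. F (\<lambda>k\<in>I. (g k, z k))) \<in> borel_measurable (PiM I (\<lambda>_. m))"
    proof (rule measurable_compose[OF measurable_restrict F])
      fix j assume j: "j \<in> I"
      have "z j \<in> space (\<nu> j)"
        using z j by (auto simp: space_PiM)
      then show "(\<lambda>g. (g j, z j)) \<in> PiM I (\<lambda>_. m) \<rightarrow>\<^sub>M m \<Otimes>\<^sub>M \<nu> j"
        by (intro measurable_Pair measurable_component_singleton[OF j] measurable_const)
    qed
    have "(\<integral>\<^sup>+g. F (\<lambda>k\<in>I. (g k, z k)) \<partial>PiM I (\<lambda>_. m)) =
        (\<integral>\<^sup>+y. (\<integral>\<^sup>+g. F (\<lambda>i\<in>I. ((g(k := y)) i, z i)) \<partial>PiM (I - {k}) (\<lambda>_. m)) \<partial>m)"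
      by (rule nn_integral_PiM_split[OF finite_I k sigma_finite_m meas])
    also have "\<dots> = (\<integral>\<^sup>+y. (\<Prod>j\<in>I - {k}. emeasure m (V j)) * H (y, z) \<partial>m)"
    proof (rule nn_integral_cong)
      fix y assume "y \<in> space m"
      then have y: "inv y \<in> carrier G" by simp
      have Vm: "(\<lambda>g. indicator (V j) (g \<otimes> inv y) :: ennreal) \<in> borel_measurable m" if "j \<in> I - {k}" for j
        using V[of j] that
        by (intro measurable_compose[OF measurable_right_mult[OF y] borel_measurable_indicator]) auto
      have "(\<integral>\<^sup>+g. F (\<lambda>i\<in>I. ((g(k := y)) i, z i)) \<partial>PiM (I - {k}) (\<lambda>_. m)) =
          (\<integral>\<^sup>+g. (\<Prod>j\<in>I - {k}. indicator (V j) (g j \<otimes> inv y)) * H (y, z) \<partial>PiM (I - {k}) (\<lambda>_. m))"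
        unfolding Fz by (intro nn_integral_cong arg_cong2[where f = times] prod.cong) auto
      also have "\<dots> = (\<integral>\<^sup>+g. (\<Prod>j\<in>I - {k}. indicator (V j) (g j \<otimes> inv y)) \<partial>PiM (I - {k}) (\<lambda>_. m)) * H (y, z)"
      proof (rule nn_integral_multc)
        show "(\<lambda>g. \<Prod>j\<in>I - {k}. indicator (V j) (g j \<otimes> inv y) :: ennreal)
            \<in> borel_measurable (PiM (I - {k}) (\<lambda>_. m))"
        proof (rule borel_measurable_prod_ennreal)
          fix j assume j: "j \<in> I - {k}"
          show "(\<lambda>g. indicator (V j) (g j \<otimes> inv y) :: ennreal) \<in> borel_measurable (PiM (I - {k}) (\<lambda>_. m))"
            by (rule measurable_compose[OF measurable_component_singleton[OF j] Vm[OF j]])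
        qed
      qed
      also have "(\<integral>\<^sup>+g. (\<Prod>j\<in>I - {k}. indicator (V j) (g j \<otimes> inv y)) \<partial>PiM (I - {k}) (\<lambda>_. m)) =
          (\<Prod>j\<in>I - {k}. \<integral>\<^sup>+g. indicator (V j) (g \<otimes> inv y) \<partial>m)"
        using finite_I Vm by (intro nn_integral_PiM_prod sigma_finite_m) auto
      also have "\<dots> = (\<Prod>j\<in>I - {k}. emeasure m (V j))"
      proof (rule prod.cong[OF refl])
        fix j assume "j \<in> I - {k}"
        then have "V j \<in> sets m" using V by simp
        then show "(\<integral>\<^sup>+g. indicator (V j) (g \<otimes> inv y) \<partial>m) = emeasure m (V j)"
          using nn_integral_right_mult[OF y, of "indicator (V j)"] by simp
      qed
      finally show "(\<integral>\<^sup>+g. F (\<lambda>i\<in>I. ((g(k := y)) i, z i)) \<partial>PiM (I - {k}) (\<lambda>_. m)) =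
          (\<Prod>j\<in>I - {k}. emeasure m (V j)) * H (y, z)" .
    qed
    also have "\<dots> = (\<Prod>j\<in>I - {k}. emeasure m (V j)) * (\<integral>\<^sup>+g. H (g, z) \<partial>m)"
      using measurable_compose[OF measurable_Pair2'[OF z] H] by (intro nn_integral_cmult)
    finally show ?thesis .
  qed
  have "(\<Prod>j\<in>I - {k}. emeasure m (V j)) * integral\<^sup>N (m \<Otimes>\<^sub>M PiM I \<nu>) H =
      (\<Prod>j\<in>I - {k}. emeasure m (V j)) * (\<integral>\<^sup>+z. (\<integral>\<^sup>+g. H (g, z) \<partial>m) \<partial>PiM I \<nu>)"
    by (simp add: nn_integral_snd[OF H])
  also have "\<dots> = (\<integral>\<^sup>+z. (\<Prod>j\<in>I - {k}. emeasure m (V j)) * (\<integral>\<^sup>+g. H (g, z) \<partial>m) \<partial>PiM I \<nu>)"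
    using measurable_pair_swap[OF H]
    by (intro nn_integral_cmult[symmetric]
        sigma_finite_measure.borel_measurable_nn_integral[OF sigma_finite_m])
  also have "\<dots> = (\<integral>\<^sup>+z. (\<integral>\<^sup>+g. F (\<lambda>k\<in>I. (g k, z k)) \<partial>PiM I (\<lambda>_. m)) \<partial>PiM I \<nu>)"
    by (intro nn_integral_cong eq[symmetric])
  also have "\<dots> = (\<integral>\<^sup>+x. (\<integral>\<^sup>+h. F (\<lambda>k\<in>I. (inv (h k), \<phi> k (h k) (x k))) \<partial>count_space (RR x)) \<partial>PiM I \<mu>)"
    by (rule lift[OF F])
  also have "\<dots> = (\<integral>\<^sup>+x. (\<integral>\<^sup>+h. window V k h * H (inv (h k), \<lambda>j\<in>I. \<phi> j (h j) (x j)) \<partial>count_space (RR x)) \<partial>PiM I \<mu>)"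
  proof (intro nn_integral_cong)
    fix x h assume "h \<in> space (count_space (RR x))"
    then have h: "h j \<in> carrier G" if "j \<in> I" for j
      using that by (auto simp: PiE_iff return_set_def)
    have "(\<Prod>j\<in>I - {k}. indicator (V j) (inv (h j) \<otimes> inv (inv (h k))) :: ennreal) = window V k h"
      unfolding window_def using h k by (intro prod.cong) auto
    moreover have "(\<lambda>j\<in>I. snd ((\<lambda>k\<in>I. (inv (h k), \<phi> k (h k) (x k))) j)) = (\<lambda>j\<in>I. \<phi> j (h j) (x j))"
      by (rule restrict_ext) simp
    ultimately show "F (\<lambda>k\<in>I. (inv (h k), \<phi> k (h k) (x k))) =
        window V k h * H (inv (h k), \<lambda>j\<in>I. \<phi> j (h j) (x j))"
      using k by (simp add: F_def)
  qed
  finally show ?thesis .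
qed

end

section \<open>The diagonal flow on the intersection space\<close>

lemma sets_eq_if_identity_measurable:
  assumes "(\<lambda>x. x) \<in> M \<rightarrow>\<^sub>M N" "(\<lambda>x. x) \<in> N \<rightarrow>\<^sub>M M" "space M = space N"
  shows "sets M = sets N"
proof (rule subset_antisym)
  show "sets M \<subseteq> sets N"
    using measurable_sets[OF assms(2)] assms(3) sets.sets_into_space[of _ M]
    by (auto simp: Int_absorb2)
  show "sets N \<subseteq> sets M"
    using measurable_sets[OF assms(1)] assms(3) sets.sets_into_space[of _ N]
    by (auto simp: Int_absorb2)
qed

lemma sets_PiM_restrict_space:
  assumes I: "finite I" and A: "\<And>i. i \<in> I \<Longrightarrow> A i \<in> sets (M i)"
  shows "sets (PiM I (\<lambda>i. restrict_space (M i) (A i))) = sets (restrict_space (PiM I M) (Pi\<^sub>E I A))"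
proof (rule sets_eq_if_identity_measurable)
  have A': "A i \<subseteq> space (M i)" if "i \<in> I" for i
    using sets.sets_into_space[OF A[OF that]] .
  have sp: "space (restrict_space (PiM I M) (Pi\<^sub>E I A)) = Pi\<^sub>E I A"
    using A' by (auto simp: space_restrict_space space_PiM PiE_iff)
  have sp': "space (PiM I (\<lambda>i. restrict_space (M i) (A i))) = Pi\<^sub>E I A"
    unfolding space_PiM using A' by (intro PiE_cong) (auto simp: space_restrict_space)
  show "space (PiM I (\<lambda>i. restrict_space (M i) (A i))) = space (restrict_space (PiM I M) (Pi\<^sub>E I A))"
    using sp sp' by simp
  show "(\<lambda>x. x) \<in> PiM I (\<lambda>i. restrict_space (M i) (A i)) \<rightarrow>\<^sub>M restrict_space (PiM I M) (Pi\<^sub>E I A)"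
  proof (rule measurable_restrict_space2)
    show "(\<lambda>x. x) \<in> space (PiM I (\<lambda>i. restrict_space (M i) (A i))) \<rightarrow> Pi\<^sub>E I A"
      by (simp add: sp')
    show "(\<lambda>x. x) \<in> PiM I (\<lambda>i. restrict_space (M i) (A i)) \<rightarrow>\<^sub>M PiM I M"
    proof (rule measurable_PiM_single')
      show "(\<lambda>x. x) \<in> space (PiM I (\<lambda>i. restrict_space (M i) (A i))) \<rightarrow> (\<Pi>\<^sub>E i\<in>I. space (M i))"
        unfolding sp' using A' by (auto simp: PiE_iff)
      fix i assume i: "i \<in> I"
      have "(\<lambda>x. x i) \<in> PiM I (\<lambda>i. restrict_space (M i) (A i)) \<rightarrow>\<^sub>M restrict_space (M i) (A i)"
        by (rule measurable_component_singleton[OF i])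
      then show "(\<lambda>x. x i) \<in> PiM I (\<lambda>i. restrict_space (M i) (A i)) \<rightarrow>\<^sub>M M i"
        by (simp add: measurable_restrict_space2_iff)
    qed
  qed
  show "(\<lambda>x. x) \<in> restrict_space (PiM I M) (Pi\<^sub>E I A) \<rightarrow>\<^sub>M PiM I (\<lambda>i. restrict_space (M i) (A i))"
  proof (rule measurable_PiM_single')
    show "(\<lambda>x. x) \<in> space (restrict_space (PiM I M) (Pi\<^sub>E I A)) \<rightarrow> (\<Pi>\<^sub>E i\<in>I. space (restrict_space (M i) (A i)))"
      unfolding sp using A' by (auto simp: PiE_iff space_restrict_space)
    fix i assume i: "i \<in> I"
    show "(\<lambda>x. x i) \<in> restrict_space (PiM I M) (Pi\<^sub>E I A) \<rightarrow>\<^sub>M restrict_space (M i) (A i)"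
      using i by (intro measurable_restrict_space2 measurable_restrict_space1 measurable_component_singleton)
        (auto simp: sp PiE_iff)
  qed
qed

text \<open>Y will be the Borel space of the product topology. It has the sets of
  \<open>PiM I S\<close> but need not be that measure, hence the separate parameter.\<close>

locale joint_space = joint_flow G T m I S \<phi> Z D \<gamma> \<mu> \<nu>
  for G (structure) and T and m :: "'a measure" and I :: "'i set" and S :: "'i \<Rightarrow> 's measure"
    and \<phi> Z D \<gamma> \<mu> \<nu> +
  fixes Y :: "('i \<Rightarrow> 's) measure"
  assumes sets_Y: "sets Y = sets (PiM I S)"
begin

definition XR :: "('i \<Rightarrow> 's) set" where
  "XR = {x \<in> space Y. \<exists>g\<in>carrier G. \<forall>k\<in>I. \<phi> k g (x k) \<in> Z k}"

definition \<delta> :: "'a \<Rightarrow> ('i \<Rightarrow> 's) \<Rightarrow> ('i \<Rightarrow> 's)" where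
  "\<delta> g = (\<lambda>x\<in>XR. \<lambda>k\<in>I. \<phi> k g (x k))"

abbreviation ZZ :: "('i \<Rightarrow> 's) set" where
  "ZZ \<equiv> Pi\<^sub>E I Z"

abbreviation SR :: "('i \<Rightarrow> 's) measure" where
  "SR \<equiv> restrict_space Y XR"

definition k0 :: 'i where
  "k0 = (SOME k. k \<in> I)"

text \<open>A return time of the tuple is a return time of its coordinate \<open>k0\<close> that
  brings all other coordinates into their sections too. The branches of one coordinate, on smaller
  Borel domains, thus enumerate the return times of the diagonal flow.\<close>

definition DD :: "nat \<Rightarrow> ('i \<Rightarrow> 's) set" where
  "DD i = {x \<in> space Y. x k0 \<in> D k0 i \<and> (\<forall>k\<in>I. \<phi> k (inv (\<gamma> k0 i (x k0))) (x k) \<in> Z k)}"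

lemma k0: "k0 \<in> I"
  unfolding k0_def using I_ne by (simp add: some_in_eq)

lemma space_Y: "space Y = (\<Pi>\<^sub>E k\<in>I. space (S k))"
  using sets_eq_imp_space_eq[OF sets_Y] by (simp add: space_PiM)

lemma measurable_Y_component: "k \<in> I \<Longrightarrow> (\<lambda>x. x k) \<in> Y \<rightarrow>\<^sub>M S k"
  using measurable_component_singleton[of k I S] measurable_cong_sets[OF sets_Y refl] by blast

lemma Y_closed: "x \<in> space Y \<Longrightarrow> k \<in> I \<Longrightarrow> x k \<in> space (S k)"
  by (auto simp: space_Y PiE_iff)

lemma XR_subset: "XR \<subseteq> space Y"
  by (auto simp: XR_def)

lemma XR_closed: "x \<in> XR \<Longrightarrow> k \<in> I \<Longrightarrow> x k \<in> space (S k)"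
  using XR_subset Y_closed by blast

lemma space_SR: "space SR = XR"
  using XR_subset by (auto simp: space_restrict_space)

lemma \<delta>_apply: "x \<in> XR \<Longrightarrow> \<delta> g x = (\<lambda>k\<in>I. \<phi> k g (x k))"
  by (simp add: \<delta>_def)

lemma mem_return_set: "x \<in> XR \<Longrightarrow> h \<in> return_set G \<delta> ZZ x \<longleftrightarrow> h \<in> carrier G \<and> (\<forall>k\<in>I. \<phi> k h (x k) \<in> Z k)"
  by (auto simp: return_set_def \<delta>_apply PiE_iff)

lemma ZZ_subset: "ZZ \<subseteq> XR"
proof
  fix z assume z: "z \<in> ZZ"
  then have zZ: "z k \<in> Z k" if "k \<in> I" for k
    using that by (auto simp: PiE_iff)
  then have zS: "z k \<in> space (S k)" if "k \<in> I" for k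
    using that Z_space by blast
  have "z \<in> space Y"
    unfolding space_Y using z zS by (auto simp: PiE_iff)
  moreover have "\<forall>k\<in>I. \<phi> k \<one> (z k) \<in> Z k"
    using zZ zS by (simp add: flow_one)
  ultimately show "z \<in> XR"
    unfolding XR_def by (auto intro!: bexI[of _ \<one>])
qed

lemma translate_XR:
  assumes x: "x \<in> XR" and g: "g \<in> carrier G"
  shows "(\<lambda>k\<in>I. \<phi> k g (x k)) \<in> XR"
proof -
  obtain h where h: "h \<in> carrier G" "\<forall>k\<in>I. \<phi> k h (x k) \<in> Z k"
    using x by (auto simp: XR_def)
  have "\<phi> k (h \<otimes> inv g) (\<phi> k g (x k)) = \<phi> k h (x k)" if k: "k \<in> I" for k
    using flow_mult[OF k, of h "inv g" "\<phi> k g (x k)"] flow_inv[OF k g] flow_closed[OF k g] h(1) g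
      XR_closed[OF x k] by simp
  then have "\<forall>k\<in>I. \<phi> k (h \<otimes> inv g) ((\<lambda>k\<in>I. \<phi> k g (x k)) k) \<in> Z k"
    using h(2) by simp
  moreover have "(\<lambda>k\<in>I. \<phi> k g (x k)) \<in> space Y"
    unfolding space_Y using flow_closed g XR_closed[OF x] by simp
  ultimately show ?thesis
    unfolding XR_def using h(1) g by (auto intro!: bexI[of _ "h \<otimes> inv g"])
qed

lemma \<delta>_closed: "x \<in> XR \<Longrightarrow> g \<in> carrier G \<Longrightarrow> \<delta> g x \<in> XR"
  by (simp add: \<delta>_apply translate_XR)

lemma \<delta>_mult:
  assumes x: "x \<in> XR" and g: "g \<in> carrier G" "h \<in> carrier G"
  shows "\<delta> (g \<otimes> h) x = \<delta> g (\<delta> h x)"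
proof -
  have "\<delta> h x \<in> XR" by (rule \<delta>_closed[OF x g(2)])
  moreover have "\<phi> k (g \<otimes> h) (x k) = \<phi> k g (\<phi> k h (x k))" if "k \<in> I" for k
    using flow_mult[OF that g XR_closed[OF x that]] .
  ultimately show ?thesis
    using x by (simp add: \<delta>_apply cong: restrict_cong)
qed

lemma \<delta>_one: "x \<in> XR \<Longrightarrow> \<delta> \<one> x = x"
proof -
  assume x: "x \<in> XR"
  then have "x \<in> extensional I"
    using XR_subset by (auto simp: space_Y PiE_def)
  moreover have "\<phi> k \<one> (x k) = x k" if "k \<in> I" for k
    using flow_one[OF that XR_closed[OF x that]] .
  ultimately show ?thesis
    using x by (simp add: \<delta>_apply extensional_restrict cong: restrict_cong)
qed

lemma group_action_\<delta>: "group_action G XR \<delta>"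
proof -
  have Bij: "\<delta> g \<in> Bij XR" if g: "g \<in> carrier G" for g
  proof -
    have "bij_betw (\<delta> g) XR XR"
    proof (rule bij_betwI[where g = "\<delta> (inv g)"])
      show "\<delta> g \<in> XR \<rightarrow> XR" "\<delta> (inv g) \<in> XR \<rightarrow> XR"
        using \<delta>_closed g by auto
      show "\<delta> (inv g) (\<delta> g x) = x" if "x \<in> XR" for x
        using \<delta>_mult[OF that, of "inv g" g] g \<delta>_one[OF that] by simp
      show "\<delta> g (\<delta> (inv g) y) = y" if "y \<in> XR" for y
        using \<delta>_mult[OF that, of g "inv g"] g \<delta>_one[OF that] by simp
    qed
    then show ?thesis
      by (simp add: Bij_def \<delta>_def)
  qed
  have "\<delta> \<in> hom G (BijGroup XR)"
  proof (rule homI)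
    fix g h assume gh: "g \<in> carrier G" "h \<in> carrier G"
    have "\<delta> (g \<otimes> h) = compose XR (\<delta> g) (\<delta> h)"
    proof
      fix x
      show "\<delta> (g \<otimes> h) x = compose XR (\<delta> g) (\<delta> h) x"
        using \<delta>_mult[OF _ gh] by (cases "x \<in> XR") (simp_all add: compose_def \<delta>_def)
    qed
    then show "\<delta> (g \<otimes> h) = \<delta> g \<otimes>\<^bsub>BijGroup XR\<^esub> \<delta> h"
      using Bij gh by (simp add: BijGroup_def)
  qed (simp add: BijGroup_def Bij)
  then show ?thesis
    by (intro group_action.intro group_hom.intro group_hom_axioms.intro group_BijGroup is_group)
qed

lemma measurable_SR_component: "k \<in> I \<Longrightarrow> (\<lambda>x. x k) \<in> SR \<rightarrow>\<^sub>M S k"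
  by (intro measurable_restrict_space1 measurable_Y_component)

lemma measurable_into_SR:
  assumes "\<And>k. k \<in> I \<Longrightarrow> (\<lambda>x. f x k) \<in> N \<rightarrow>\<^sub>M S k" "\<And>x. x \<in> space N \<Longrightarrow> f x \<in> XR"
  shows "f \<in> N \<rightarrow>\<^sub>M SR"
proof (rule measurable_restrict_space2)
  show "f \<in> space N \<rightarrow> XR" using assms(2) by simp
  have "f \<in> N \<rightarrow>\<^sub>M PiM I S"
  proof (rule measurable_PiM_single')
    show "f \<in> space N \<rightarrow> (\<Pi>\<^sub>E k\<in>I. space (S k))"
      using assms(2) XR_subset space_Y by auto
  qed (use assms(1) in simp)
  then show "f \<in> N \<rightarrow>\<^sub>M Y"
    by (simp add: measurable_cong_sets[OF refl sets_Y])
qed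

lemma borel_flow_\<delta>: "borel_flow G T SR \<delta>"
proof (intro borel_flow.intro borel_flow_axioms.intro lcsc_group_axioms)
  show "group_action G (space SR) \<delta>"
    unfolding space_SR by (rule group_action_\<delta>)
  show "(\<lambda>(h, s). \<delta> h s) \<in> borel_of T \<Otimes>\<^sub>M SR \<rightarrow>\<^sub>M SR"
  proof (rule measurable_into_SR)
    fix p assume "p \<in> space (borel_of T \<Otimes>\<^sub>M SR)"
    then show "(case p of (h, s) \<Rightarrow> \<delta> h s) \<in> XR"
      by (auto simp: space_pair_measure space_SR topspace_eq \<delta>_closed)
  next
    fix k assume k: "k \<in> I"
    have meas: "(\<lambda>p. \<phi> k (fst p) (snd p k)) \<in> borel_of T \<Otimes>\<^sub>M SR \<rightarrow>\<^sub>M S k"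
      by (intro measurable_flow[OF k] measurable_fst measurable_compose[OF measurable_snd measurable_SR_component[OF k]])
    have eq: "(case p of (h, s) \<Rightarrow> \<delta> h s) k = \<phi> k (fst p) (snd p k)"
      if "p \<in> space (borel_of T \<Otimes>\<^sub>M SR)" for p
      using that k by (auto simp: space_pair_measure space_SR \<delta>_apply)
    show "(\<lambda>p. (case p of (h, s) \<Rightarrow> \<delta> h s) k) \<in> borel_of T \<Otimes>\<^sub>M SR \<rightarrow>\<^sub>M S k"
      by (rule measurable_cong[THEN iffD2, OF eq meas])
  qed
qed

lemma DD_sets_Y: "DD i \<in> sets Y"
proof -
  have "{x \<in> space Y. x k0 \<in> D k0 i} \<in> sets Y"
    using measurable_sets[OF measurable_Y_component[OF k0] section_flow.D[OF flow[OF k0], of i]]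
    by (simp add: vimage_def Int_def conj_commute)
  moreover have "{x \<in> space Y. \<phi> k (inv (\<gamma> k0 i (x k0))) (x k) \<in> Z k} \<in> sets Y" if k: "k \<in> I" for k
  proof -
    have "(\<lambda>x. \<phi> k (inv (\<gamma> k0 i (x k0))) (x k)) \<in> Y \<rightarrow>\<^sub>M S k"
      by (intro measurable_flow[OF k] measurable_group_inv measurable_Y_component[OF k]
          measurable_compose[OF measurable_Y_component[OF k0] section_flow.\<gamma>[OF flow[OF k0]]])
    from measurable_sets[OF this section_flow.Z[OF flow[OF k]]] show ?thesis
      by (simp add: vimage_def Int_def conj_commute)
  qed
  ultimately have "{x \<in> space Y. x k0 \<in> D k0 i} \<inter>
      (\<Inter>k\<in>I. {x \<in> space Y. \<phi> k (inv (\<gamma> k0 i (x k0))) (x k) \<in> Z k}) \<in> sets Y"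
    using finite_I I_ne by (intro sets.Int sets.finite_INT) auto
  moreover have "DD i = {x \<in> space Y. x k0 \<in> D k0 i} \<inter>
      (\<Inter>k\<in>I. {x \<in> space Y. \<phi> k (inv (\<gamma> k0 i (x k0))) (x k) \<in> Z k})"
    using k0 by (auto simp: DD_def)
  ultimately show ?thesis
    by simp
qed

lemma DD_enum:
  assumes x: "x \<in> XR"
  shows "bij_betw (\<lambda>i. inv (\<gamma> k0 i (x k0))) {i. x \<in> DD i} (return_set G \<delta> ZZ x)"
proof -
  have bij: "bij_betw (\<lambda>i. inv (\<gamma> k0 i (x k0))) {i. x k0 \<in> D k0 i} (R k0 (x k0))"
    by (rule section_flow.enum[OF flow[OF k0] XR_closed[OF x k0]])
  have "(\<lambda>i. inv (\<gamma> k0 i (x k0))) ` {i. x \<in> DD i} = return_set G \<delta> ZZ x"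
  proof (rule subset_antisym)
    show "(\<lambda>i. inv (\<gamma> k0 i (x k0))) ` {i. x \<in> DD i} \<subseteq> return_set G \<delta> ZZ x"
      using section_flow.\<gamma>_closed[OF flow[OF k0] XR_closed[OF x k0]] x
      by (auto simp: mem_return_set DD_def)
    show "return_set G \<delta> ZZ x \<subseteq> (\<lambda>i. inv (\<gamma> k0 i (x k0))) ` {i. x \<in> DD i}"
    proof
      fix h assume "h \<in> return_set G \<delta> ZZ x"
      then have h: "h \<in> carrier G" "\<forall>k\<in>I. \<phi> k h (x k) \<in> Z k"
        using x by (simp_all add: mem_return_set)
      then have "h \<in> R k0 (x k0)"
        using k0 by (simp add: return_set_def)
      then obtain i where i: "x k0 \<in> D k0 i" "h = inv (\<gamma> k0 i (x k0))"
        using bij_betw_imp_surj_on[OF bij] by (auto simp: image_iff)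
      then have "x \<in> DD i"
        using h(2) x XR_subset by (auto simp: DD_def)
      then show "h \<in> (\<lambda>i. inv (\<gamma> k0 i (x k0))) ` {i. x \<in> DD i}"
        using i(2) by simp
    qed
  qed
  moreover have "{i. x \<in> DD i} \<subseteq> {i. x k0 \<in> D k0 i}"
    by (auto simp: DD_def)
  ultimately show ?thesis
    using bij_betw_subset[OF bij] by blast
qed

text \<open>The definition of the intersection space quantifies over the whole group. Through the
  branches it becomes a countable union of Borel sets, hence Borel.\<close>

lemma XR_eq_UN: "XR = (\<Union>i. DD i)"
proof (rule subset_antisym)
  show "XR \<subseteq> (\<Union>i. DD i)"
  proof
    fix x assume x: "x \<in> XR"
    then obtain h where "h \<in> return_set G \<delta> ZZ x"
      by (auto simp: mem_return_set) (auto simp: XR_def)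
    then show "x \<in> (\<Union>i. DD i)"
      using bij_betw_imp_surj_on[OF DD_enum[OF x]] by (auto simp: image_iff)
  qed
  show "(\<Union>i. DD i) \<subseteq> XR"
    using section_flow.\<gamma>_closed[OF flow[OF k0]] Y_closed[OF _ k0]
    by (auto simp: DD_def XR_def intro!: bexI[of _ "inv (\<gamma> k0 i x)" for i x])
qed

lemma XR_sets: "XR \<in> sets Y"
  unfolding XR_eq_UN using DD_sets_Y by auto

lemma sets_SR: "A \<in> sets SR \<longleftrightarrow> A \<subseteq> XR \<and> A \<in> sets Y"
  using XR_sets XR_subset by (subst sets_restrict_space_iff) (auto simp: Int_absorb2)

lemma ZZ_sets: "ZZ \<in> sets SR"
  unfolding sets_SR sets_Y
  using ZZ_subset section_flow.Z[OF flow] finite_I by (auto intro!: sets_PiM_I_finite)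

sublocale J: section_flow G T SR \<delta> ZZ DD "\<lambda>i x. \<gamma> k0 i (x k0)"
proof (intro section_flow.intro section_flow_axioms.intro borel_flow_\<delta> ZZ_sets)
  show "DD i \<in> sets SR" for i
    unfolding sets_SR using DD_sets_Y XR_eq_UN by auto
  show "(\<lambda>x. \<gamma> k0 i (x k0)) \<in> SR \<rightarrow>\<^sub>M borel_of T" for i
    by (rule measurable_compose[OF measurable_SR_component[OF k0] section_flow.\<gamma>[OF flow[OF k0]]])
  show "bij_betw (\<lambda>i. inv (\<gamma> k0 i (x k0))) {i. x \<in> DD i} (return_set G \<delta> ZZ x)"
    if "x \<in> space SR" for x
    using that space_SR by (intro DD_enum) simp
qed

text \<open>The product of the \<nu>_k is built on the product of the subspaces Z_k; a transverse
  measure has to live on \<open>ZZ\<close> as a subspace of the intersection space.\<close>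

lemma sets_PiM_\<nu>: "sets (PiM I \<nu>) = sets (restrict_space SR ZZ)"
proof -
  have "sets (PiM I \<nu>) = sets (PiM I (\<lambda>k. restrict_space (S k) (Z k)))"
    by (rule sets_PiM_cong) (simp_all add: sets_\<nu>)
  also have "\<dots> = sets (restrict_space (PiM I S) ZZ)"
    by (rule sets_PiM_restrict_space[OF finite_I section_flow.Z[OF flow]])
  also have "\<dots> = sets (restrict_space Y ZZ)"
    by (rule sets_restrict_space_cong) (simp add: sets_Y)
  also have "restrict_space Y ZZ = restrict_space SR ZZ"
    using XR_sets XR_subset ZZ_sets ZZ_subset
    by (subst restrict_restrict_space) (auto simp: sets_SR Int_absorb1 Int_absorb2)
  finally show ?thesis .
qed

abbreviation M :: "('a \<times> ('i \<Rightarrow> 's)) measure" where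
  "M \<equiv> m \<Otimes>\<^sub>M PiM I \<nu>"

lemma sets_M: "sets M = sets (borel_of T \<Otimes>\<^sub>M restrict_space SR ZZ)"
  by (rule sets_pair_measure_cong[OF sets_m sets_PiM_\<nu>])

lemma space_M: "space M = carrier G \<times> ZZ"
  using sets_eq_imp_space_eq[OF sets_M] J.space_Z by (simp add: space_pair_measure topspace_eq)

lemma measurable_M: "F \<in> borel_measurable M \<longleftrightarrow> F \<in> borel_measurable (borel_of T \<Otimes>\<^sub>M restrict_space SR ZZ)"
  by (simp add: measurable_cong_sets[OF sets_M refl])

definition orbit_map :: "'a \<times> ('i \<Rightarrow> 's) \<Rightarrow> ('i \<Rightarrow> 's)" where
  "orbit_map p = \<delta> (fst p) (snd p)"

lemma measurable_orbit_map: "orbit_map \<in> M \<rightarrow>\<^sub>M SR"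
proof -
  have "snd \<in> M \<rightarrow>\<^sub>M restrict_space SR ZZ"
    using measurable_snd[of m "PiM I \<nu>"] by (simp add: measurable_cong_sets[OF refl sets_PiM_\<nu>])
  then have "snd \<in> M \<rightarrow>\<^sub>M SR"
    by (simp add: measurable_restrict_space2_iff)
  moreover have "fst \<in> M \<rightarrow>\<^sub>M borel_of T"
    unfolding measurable_cong_m[symmetric] by (rule measurable_fst)
  ultimately show ?thesis
    unfolding orbit_map_def by (intro J.measurable_act)
qed

lemma orbit_map_closed: "p \<in> space M \<Longrightarrow> orbit_map p \<in> XR"
  using measurable_space[OF measurable_orbit_map] space_SR by simp

lemma orbit_map_return: "x \<in> XR \<Longrightarrow> h \<in> return_set G \<delta> ZZ x \<Longrightarrow> orbit_map (inv h, \<delta> h x) = x"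
  using J.act_inv[of h x] by (simp add: orbit_map_def return_set_def space_SR)

section \<open>Mass transport\<close>

lemma measurable_fibre_sum_orbit_map:
  assumes "B \<in> borel_measurable M"
  shows "(\<lambda>p. J.fibre_sum B (orbit_map p)) \<in> borel_measurable M"
  using assms unfolding measurable_M
  by (intro measurable_compose[OF measurable_orbit_map[unfolded measurable_cong_sets[OF sets_M refl]]] J.measurable_fibre_sum)

text \<open>A tuple of return times of x gives a point of the product of the sections, and the
  single element \<open>inv (h k)\<close> moves it back. The result agrees with x at coordinate k,
  while the other coordinates are moved by the quotients
  \<open>inv (h k) \<otimes> h j\<close>.\<close>

definition fibre_point :: "'i \<Rightarrow> ('i \<Rightarrow> 's) \<Rightarrow> ('i \<Rightarrow> 'a) \<Rightarrow> 'a \<times> ('i \<Rightarrow> 's)" where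
  "fibre_point k x h = (inv (h k), \<lambda>j\<in>I. \<phi> j (h j) (x j))"

text \<open>The relation concerns group elements and not image points: where stabilizers are
  nontrivial, different quotients can lead to the same image, but the return times of an image point
  have to correspond to tuples one to one.\<close>

definition same_quotients :: "('i \<Rightarrow> 'a) \<Rightarrow> ('i \<Rightarrow> 'a) \<Rightarrow> bool" where
  "same_quotients h h' \<longleftrightarrow> (\<forall>j\<in>I. inv (h k0) \<otimes> h j = inv (h' k0) \<otimes> h' j)"

lemma RR_closed: "h \<in> RR x \<Longrightarrow> j \<in> I \<Longrightarrow> h j \<in> carrier G"
  by (auto simp: PiE_iff return_set_def)

lemma fibre_point_ZZ: "h \<in> RR x \<Longrightarrow> snd (fibre_point k x h) \<in> ZZ"
  by (auto simp: fibre_point_def PiE_iff return_set_def)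

lemma fibre_point_space_M: "h \<in> RR x \<Longrightarrow> k \<in> I \<Longrightarrow> fibre_point k x h \<in> space M"
  using fibre_point_ZZ[of h x k] RR_closed[of h x k] by (simp add: space_M fibre_point_def mem_Times_iff)

lemma orbit_map_fibre_point:
  assumes h: "h \<in> RR x" and x: "x \<in> space Y" and k: "k \<in> I"
  shows "orbit_map (fibre_point k x h) \<in> XR" and "j \<in> I \<Longrightarrow> orbit_map (fibre_point k x h) j = \<phi> j (inv (h k) \<otimes> h j) (x j)"
proof -
  show "orbit_map (fibre_point k x h) \<in> XR"
    by (rule orbit_map_closed[OF fibre_point_space_M[OF h k]])
  have "snd (fibre_point k x h) \<in> XR"
    using fibre_point_ZZ[OF h] ZZ_subset by blast
  then show "orbit_map (fibre_point k x h) j = \<phi> j (inv (h k) \<otimes> h j) (x j)" if "j \<in> I"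
    using flow_mult[OF that, of "inv (h k)" "h j" "x j"] RR_closed[OF h] that k Y_closed[OF x that]
    by (simp add: orbit_map_def \<delta>_apply fibre_point_def)
qed

text \<open>Let n be the tuple of quotients of h, so that the image point y has the coordinates n_j
  x_j. A return time t of y gives the tuple of the t n_j, which consists of return times of x and
  again has the quotients n. Conversely t is recovered at \<open>k0\<close>, where n is \<one>. The
  fibre point of the new tuple is the point above y that belongs to t.\<close>

lemma fibre_sum_fibre_point:
  assumes h: "h \<in> RR x" and x: "x \<in> space Y"
  shows "J.fibre_sum B (orbit_map (fibre_point k0 x h)) = (\<integral>\<^sup>+h'. of_bool (same_quotients h h') * B (fibre_point k0 x h') \<partial>count_space (RR x))"
proof -
  let ?y = "orbit_map (fibre_point k0 x h)"
  define n where "n j = inv (h k0) \<otimes> h j" for j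
  have y: "?y \<in> XR" and yj: "?y j = \<phi> j (n j) (x j)" if "j \<in> I" for j
    using orbit_map_fibre_point[OF h x k0] that by (simp_all add: n_def)
  have nG: "n j \<in> carrier G" if "j \<in> I" for j
    using RR_closed[OF h] that k0 by (simp add: n_def)
  have n_k0: "n k0 = \<one>"
    using RR_closed[OF h k0] by (simp add: n_def)
  have tn: "\<phi> j (t \<otimes> n j) (x j) = \<phi> j t (?y j)" if "j \<in> I" "t \<in> carrier G" for j t
    using flow_mult[OF that(1,2) nG[OF that(1)] Y_closed[OF x that(1)]] yj[OF that(1)] by simp
  have bij: "bij_betw (\<lambda>t. \<lambda>j\<in>I. t \<otimes> n j) (return_set G \<delta> ZZ ?y) {h' \<in> RR x. same_quotients h h'}"
  proof (rule bij_betwI[where g = "\<lambda>h'. h' k0"])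
    show "(\<lambda>t. \<lambda>j\<in>I. t \<otimes> n j) \<in> return_set G \<delta> ZZ ?y \<rightarrow> {h' \<in> RR x. same_quotients h h'}"
    proof
      fix t assume "t \<in> return_set G \<delta> ZZ ?y"
      then have t: "t \<in> carrier G" "\<forall>j\<in>I. \<phi> j t (?y j) \<in> Z j"
        using y[OF k0] by (simp_all add: mem_return_set)
      have "(\<lambda>j\<in>I. t \<otimes> n j) \<in> RR x"
        using t tn nG by (simp add: return_set_def)
      moreover have "same_quotients h (\<lambda>j\<in>I. t \<otimes> n j)"
        unfolding same_quotients_def
      proof
        fix j assume j: "j \<in> I"
        have "inv (t \<otimes> n k0) \<otimes> (t \<otimes> n j) = inv t \<otimes> (t \<otimes> n j)"
          using t by (simp add: n_k0)
        also have "\<dots> = n j"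
          using t nG[OF j] by (simp add: m_assoc[symmetric])
        finally show "inv (h k0) \<otimes> h j = inv ((\<lambda>j\<in>I. t \<otimes> n j) k0) \<otimes> (\<lambda>j\<in>I. t \<otimes> n j) j"
          using j k0 by (simp add: n_def)
      qed
      ultimately show "(\<lambda>j\<in>I. t \<otimes> n j) \<in> {h' \<in> RR x. same_quotients h h'}"
        by simp
    qed
    have eq: "h' j = h' k0 \<otimes> n j" if "h' \<in> RR x" "same_quotients h h'" "j \<in> I" for h' j
    proof -
      have "n j = inv (h' k0) \<otimes> h' j"
        using that(2,3) by (simp add: same_quotients_def n_def)
      then show ?thesis
        using RR_closed[OF that(1)] that(3) k0 by (simp add: m_assoc[symmetric])
    qed
    show "(\<lambda>h'. h' k0) \<in> {h' \<in> RR x. same_quotients h h'} \<rightarrow> return_set G \<delta> ZZ ?y"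
    proof
      fix h' assume "h' \<in> {h' \<in> RR x. same_quotients h h'}"
      then have h': "h' \<in> RR x" "same_quotients h h'" by auto
      have "\<phi> j (h' k0) (?y j) \<in> Z j" if "j \<in> I" for j
        using tn[OF that RR_closed[OF h'(1) k0]] eq[OF h' that] h'(1) that
        by (auto simp: PiE_iff return_set_def)
      then show "h' k0 \<in> return_set G \<delta> ZZ ?y"
        using y[OF k0] RR_closed[OF h'(1) k0] by (simp add: mem_return_set)
    qed
    show "(\<lambda>j\<in>I. t \<otimes> n j) k0 = t" if "t \<in> return_set G \<delta> ZZ ?y" for t
      using that k0 by (simp add: n_k0 return_set_def)
    show "(\<lambda>j\<in>I. h' k0 \<otimes> n j) = h'" if "h' \<in> {h' \<in> RR x. same_quotients h h'}" for h'
    proof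
      fix j
      show "(\<lambda>j\<in>I. h' k0 \<otimes> n j) j = h' j"
        using that eq[of h' j] by (cases "j \<in> I") (auto simp: PiE_iff extensional_def)
    qed
  qed
  have "J.fibre_sum B ?y = (\<integral>\<^sup>+t. B (fibre_point k0 x (\<lambda>j\<in>I. t \<otimes> n j)) \<partial>count_space (return_set G \<delta> ZZ ?y))"
    unfolding J.fibre_sum_def
  proof (rule nn_integral_cong)
    fix t assume "t \<in> space (count_space (return_set G \<delta> ZZ ?y))"
    then have t: "t \<in> carrier G"
      by (simp add: return_set_def)
    have "\<delta> t ?y = (\<lambda>j\<in>I. \<phi> j ((\<lambda>j\<in>I. t \<otimes> n j) j) (x j))"
      using y[OF k0] tn[OF _ t] by (simp add: \<delta>_apply cong: restrict_cong)
    then show "B (inv t, \<delta> t ?y) = B (fibre_point k0 x (\<lambda>j\<in>I. t \<otimes> n j))"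
      using k0 t by (simp add: fibre_point_def n_k0)
  qed
  also have "\<dots> = (\<integral>\<^sup>+h'. B (fibre_point k0 x h') \<partial>count_space {h' \<in> RR x. same_quotients h h'})"
    by (rule nn_integral_bij_count_space[OF bij])
  also have "\<dots> = (\<integral>\<^sup>+h'. of_bool (same_quotients h h') * B (fibre_point k0 x h') \<partial>count_space {h' \<in> RR x. same_quotients h h'})"
    by (intro nn_integral_cong) simp
  also have "\<dots> = (\<integral>\<^sup>+h'. of_bool (same_quotients h h') * B (fibre_point k0 x h') \<partial>count_space (RR x))"
    by (rule nn_integral_count_space_eq) auto
  finally show ?thesis .
qed

text \<open>The entries of the window are inverses of the quotients. This lets the window stay in
  place when h and h' exchange their roles in mass transport.\<close>

lemma window_same_quotients:
  assumes "h \<in> RR x" "h' \<in> RR x" "same_quotients h h'"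
  shows "window V k0 h = window V k0 h'"
  unfolding window_def
proof (rule prod.cong[OF refl])
  fix j assume j: "j \<in> I - {k0}"
  have G: "h j \<in> carrier G" "h k0 \<in> carrier G" "h' j \<in> carrier G" "h' k0 \<in> carrier G"
    using RR_closed assms(1,2) j k0 by auto
  have "inv (h k0) \<otimes> h j = inv (h' k0) \<otimes> h' j"
    using assms(3) j by (simp add: same_quotients_def)
  then have "inv (inv (h k0) \<otimes> h j) = inv (inv (h' k0) \<otimes> h' j)"
    by simp
  then have "inv (h j) \<otimes> h k0 = inv (h' j) \<otimes> h' k0"
    using G by (simp add: inv_mult_group)
  then show "indicator (V j) (inv (h j) \<otimes> h k0) = (indicator (V j) (inv (h' j) \<otimes> h' k0) :: ennreal)"
    by simp
qed

lemma space_PiM_\<mu>: "space (PiM I \<mu>) = space Y"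
  unfolding space_PiM space_Y by (intro PiE_cong) (simp add: space_\<mu>)

text \<open>Both sides are expressed by \<open>lift_diagonal\<close> through sums over pairs of tuples \<open>h\<close>,
  \<open>h'\<close> of return times with the same quotients \<open>inv (h k0) \<otimes> h j\<close>; these sums are symmetric.\<close>

lemma mass_transport:
  assumes A: "A \<in> borel_measurable M" and B: "B \<in> borel_measurable M"
  shows "(\<integral>\<^sup>+p. A p * J.fibre_sum B (orbit_map p) \<partial>M) = (\<integral>\<^sup>+p. B p * J.fibre_sum A (orbit_map p) \<partial>M)"
proof -
  \<comment> \<open>Any identity neighbourhood inside a compact set will do, so U is the whole
    group. Its measure is nonzero and finite, hence the constant c can be cancelled at the
    end.\<close>
  have "openin T (topspace T)" "\<one> \<in> topspace T"
    by (simp_all add: topspace_eq openin_topspace[of T, unfolded topspace_eq])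
  then obtain V where V: "openin T V" "\<one> \<in> V" "\<exists>K. compactin T K \<and> V \<subseteq> K"
    by (rule small_neighbourhood) (rule that)
  define c where "c = (\<Prod>j\<in>I - {k0}. emeasure m V)"
  have Vm: "V \<in> sets m"
    using openin_borel_of[OF V(1)] sets_m by simp
  have "emeasure m V \<noteq> 0"
    using V by (intro emeasure_open_nonzero) auto
  moreover have "emeasure m V \<noteq> \<infinity>"
    using V(3) emeasure_subset_compact_finite by (auto simp: less_top)
  ultimately have c: "c \<noteq> 0" "c \<noteq> \<infinity>"
    unfolding c_def by (auto simp: power_eq_top_ennreal)
  have key: "c * (\<integral>\<^sup>+p. A p * J.fibre_sum B (orbit_map p) \<partial>M) =
      (\<integral>\<^sup>+x. \<integral>\<^sup>+h. \<integral>\<^sup>+h'. window (\<lambda>_. V) k0 h * (of_bool (same_quotients h h') * A (fibre_point k0 x h) * B (fibre_point k0 x h'))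
        \<partial>count_space (RR x) \<partial>count_space (RR x) \<partial>PiM I \<mu>)"
    if A: "A \<in> borel_measurable M" and B: "B \<in> borel_measurable M" for A B
  proof -
    have "c * (\<integral>\<^sup>+p. A p * J.fibre_sum B (orbit_map p) \<partial>M) =
        (\<integral>\<^sup>+x. \<integral>\<^sup>+h. window (\<lambda>_. V) k0 h * (A (fibre_point k0 x h) * J.fibre_sum B (orbit_map (fibre_point k0 x h)))
          \<partial>count_space (RR x) \<partial>PiM I \<mu>)"
      unfolding c_def fibre_point_def using Vm measurable_fibre_sum_orbit_map[OF B] A
      by (intro lift_diagonal[OF k0, where V = "\<lambda>_. V"] borel_measurable_times_ennreal)
    also have "\<dots> = (\<integral>\<^sup>+x. \<integral>\<^sup>+h. \<integral>\<^sup>+h'. window (\<lambda>_. V) k0 h * (of_bool (same_quotients h h') * A (fibre_point k0 x h) * B (fibre_point k0 x h'))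
        \<partial>count_space (RR x) \<partial>count_space (RR x) \<partial>PiM I \<mu>)"
    proof (intro nn_integral_cong)
      fix x h assume "x \<in> space (PiM I \<mu>)" "h \<in> space (count_space (RR x))"
      then show "window (\<lambda>_. V) k0 h * (A (fibre_point k0 x h) * J.fibre_sum B (orbit_map (fibre_point k0 x h))) =
          (\<integral>\<^sup>+h'. window (\<lambda>_. V) k0 h * (of_bool (same_quotients h h') * A (fibre_point k0 x h) * B (fibre_point k0 x h')) \<partial>count_space (RR x))"
        by (simp add: fibre_sum_fibre_point space_PiM_\<mu> nn_integral_cmult[symmetric] ac_simps)
    qed
    finally show ?thesis .
  qed
  have "c * (\<integral>\<^sup>+p. A p * J.fibre_sum B (orbit_map p) \<partial>M) = c * (\<integral>\<^sup>+p. B p * J.fibre_sum A (orbit_map p) \<partial>M)"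
    unfolding key[OF A B] key[OF B A]
  proof (rule nn_integral_cong)
    fix x
    show "(\<integral>\<^sup>+h. \<integral>\<^sup>+h'. window (\<lambda>_. V) k0 h * (of_bool (same_quotients h h') * A (fibre_point k0 x h) * B (fibre_point k0 x h'))
        \<partial>count_space (RR x) \<partial>count_space (RR x)) =
      (\<integral>\<^sup>+h. \<integral>\<^sup>+h'. window (\<lambda>_. V) k0 h * (of_bool (same_quotients h h') * B (fibre_point k0 x h) * A (fibre_point k0 x h'))
        \<partial>count_space (RR x) \<partial>count_space (RR x))"
    proof (subst nn_integral_count_space_swap, intro nn_integral_cong)
      fix h h' assume "h \<in> space (count_space (RR x))" "h' \<in> space (count_space (RR x))"
      then have hh: "h \<in> RR x" "h' \<in> RR x" by simp_all
      have "same_quotients h h' \<longleftrightarrow> same_quotients h' h"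
        unfolding same_quotients_def by auto
      then show "window (\<lambda>_. V) k0 h' * (of_bool (same_quotients h' h) * A (fibre_point k0 x h') * B (fibre_point k0 x h)) =
          window (\<lambda>_. V) k0 h * (of_bool (same_quotients h h') * B (fibre_point k0 x h) * A (fibre_point k0 x h'))"
        using window_same_quotients[OF hh] by (cases "same_quotients h h'") (simp_all add: ac_simps)
    qed
  qed
  then show ?thesis
    using c by (simp add: ennreal_mult_cancel_left)
qed

end

context joint_space
begin

section \<open>The intersection measure\<close>

definition \<gamma>0 :: "('i \<Rightarrow> 's) \<Rightarrow> 'a" where
  "\<gamma>0 x = \<gamma> k0 (LEAST i. x \<in> DD i) (x k0)"

text \<open>Of all points above an element of the intersection space, the one whose group coordinate
  is selected by the first available branch.\<close>

definition fund :: "('a \<times> ('i \<Rightarrow> 's)) set" where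
  "fund = {p \<in> space M. \<gamma>0 (orbit_map p) = fst p}"

lemma measurable_\<gamma>0: "\<gamma>0 \<in> SR \<rightarrow>\<^sub>M borel_of T"
proof -
  have [measurable]: "DD i \<in> sets SR" for i
    by (rule J.D)
  have "(\<lambda>x. LEAST i. x \<in> DD i) \<in> SR \<rightarrow>\<^sub>M count_space UNIV"
    by measurable
  then show ?thesis
    unfolding \<gamma>0_def by (rule measurable_compose_countable[OF J.\<gamma>])
qed

lemma \<gamma>0_return: "x \<in> XR \<Longrightarrow> inv (\<gamma>0 x) \<in> return_set G \<delta> ZZ x"
proof -
  assume x: "x \<in> XR"
  then have "x \<in> DD (LEAST i. x \<in> DD i)"
    unfolding XR_eq_UN by (auto intro: LeastI)
  then show ?thesis
    using bij_betw_apply[OF DD_enum[OF x]] unfolding \<gamma>0_def by simp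
qed

lemma \<gamma>0_closed: "x \<in> XR \<Longrightarrow> \<gamma>0 x \<in> carrier G"
  using measurable_space[OF measurable_\<gamma>0] by (simp add: space_SR topspace_eq)

lemma fund_sets: "fund \<in> sets M"
proof -
  have "fst \<in> M \<rightarrow>\<^sub>M borel_of T"
    unfolding measurable_cong_m[symmetric] by (rule measurable_fst)
  then show ?thesis
    unfolding fund_def
    by (intro measurable_diagonal[OF second_countable Hausdorff] measurable_compose[OF measurable_orbit_map measurable_\<gamma>0])
qed

text \<open>Only the selected return time contributes. Every function on the intersection space is
  therefore a fibre sum, which serves both the construction of the measure and its
  uniqueness.\<close>

lemma fibre_sum_fund:
  assumes x: "x \<in> XR"
  shows "J.fibre_sum (\<lambda>p. indicator fund p * f (orbit_map p)) x = f x"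
proof -
  let ?R = "return_set G \<delta> ZZ x"
  have ind: "indicator fund (inv h, \<delta> h x) * f (orbit_map (inv h, \<delta> h x)) = (if h = inv (\<gamma>0 x) then f x else 0)"
    if h: "h \<in> ?R" for h
  proof -
    have "(inv h, \<delta> h x) \<in> space M"
      using h by (simp add: space_M return_set_def)
    moreover have "\<gamma>0 x = inv h \<longleftrightarrow> h = inv (\<gamma>0 x)"
      using h \<gamma>0_closed[OF x] by (auto simp: return_set_def)
    ultimately have "(inv h, \<delta> h x) \<in> fund \<longleftrightarrow> h = inv (\<gamma>0 x)"
      using orbit_map_return[OF x h] by (simp add: fund_def)
    then show ?thesis
      using orbit_map_return[OF x h] by (simp add: indicator_def)
  qed
  have "J.fibre_sum (\<lambda>p. indicator fund p * f (orbit_map p)) x =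
      (\<integral>\<^sup>+h. (if h = inv (\<gamma>0 x) then f x else 0) \<partial>count_space ?R)"
    unfolding J.fibre_sum_def by (intro nn_integral_cong ind) simp
  also have "\<dots> = (\<Sum>h\<in>{inv (\<gamma>0 x)}. if h = inv (\<gamma>0 x) then f x else 0)"
    using \<gamma>0_return[OF x] by (intro nn_integral_count_space') auto
  finally show ?thesis by simp
qed

definition \<mu>r :: "('i \<Rightarrow> 's) measure" where
  "\<mu>r = distr (density M (indicator fund)) SR orbit_map"

lemma sets_\<mu>r: "sets \<mu>r = sets SR"
  by (simp add: \<mu>r_def)

lemma space_\<mu>r: "space \<mu>r = XR"
  using sets_eq_imp_space_eq[OF sets_\<mu>r] space_SR by simp

lemma measurable_fund_mult:
  fixes f :: "('i \<Rightarrow> 's) \<Rightarrow> ennreal"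
  assumes f: "f \<in> borel_measurable SR"
  shows "(\<lambda>p. indicator fund p * f (orbit_map p)) \<in> borel_measurable M"
  by (intro borel_measurable_times_ennreal borel_measurable_indicator fund_sets
      measurable_compose[OF measurable_orbit_map f])

lemma nn_integral_\<mu>r:
  assumes f: "f \<in> borel_measurable SR"
  shows "(\<integral>\<^sup>+x. f x \<partial>\<mu>r) = (\<integral>\<^sup>+p. indicator fund p * f (orbit_map p) \<partial>M)"
proof -
  have "(\<integral>\<^sup>+x. f x \<partial>\<mu>r) = (\<integral>\<^sup>+p. f (orbit_map p) \<partial>density M (indicator fund))"
    unfolding \<mu>r_def using measurable_orbit_map f by (intro nn_integral_distr) simp_all
  also have "\<dots> = (\<integral>\<^sup>+p. indicator fund p * f (orbit_map p) \<partial>M)"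
    by (intro nn_integral_density borel_measurable_indicator fund_sets measurable_compose[OF measurable_orbit_map f])
  finally show ?thesis .
qed

lemma nn_integral_M:
  assumes "F \<in> borel_measurable M"
  shows "integral\<^sup>N M F = (\<integral>\<^sup>+h. \<integral>\<^sup>+t. F (h, t) \<partial>PiM I \<nu> \<partial>m)"
  by (rule sigma_finite_measure.nn_integral_fst[OF sigma_finite_PiM_\<nu> assms, symmetric])

text \<open>Mass transport exchanges F with the indicator of \<open>fund\<close>, and the fibre sum
  of that indicator is 1 everywhere.\<close>

lemma nn_integral_fibre_sum_\<mu>r:
  assumes F: "F \<in> borel_measurable M"
  shows "(\<integral>\<^sup>+x. J.fibre_sum F x \<partial>\<mu>r) = integral\<^sup>N M F"
proof -
  have "(\<integral>\<^sup>+x. J.fibre_sum F x \<partial>\<mu>r) = (\<integral>\<^sup>+p. indicator fund p * J.fibre_sum F (orbit_map p) \<partial>M)"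
    using F unfolding measurable_M by (intro nn_integral_\<mu>r J.measurable_fibre_sum)
  also have "\<dots> = (\<integral>\<^sup>+p. F p * J.fibre_sum (indicator fund) (orbit_map p) \<partial>M)"
    by (rule mass_transport[OF borel_measurable_indicator[OF fund_sets] F])
  also have "\<dots> = integral\<^sup>N M F"
  proof (rule nn_integral_cong)
    fix p assume "p \<in> space M"
    then show "F p * J.fibre_sum (indicator fund) (orbit_map p) = F p"
      using fibre_sum_fund[OF orbit_map_closed, of p "\<lambda>_. 1"] by simp
  qed
  finally show ?thesis .
qed

lemma transverse_\<mu>r: "transverse_measure G T m SR \<delta> ZZ \<mu>r (PiM I \<nu>)"
proof (rule J.transverseI[OF sets_\<mu>r sets_PiM_\<nu>])
  fix F :: "'a \<times> ('i \<Rightarrow> 's) \<Rightarrow> ennreal"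
  assume "F \<in> borel_measurable (borel_of T \<Otimes>\<^sub>M restrict_space SR ZZ)"
  then have F: "F \<in> borel_measurable M"
    by (simp add: measurable_M)
  show "(\<integral>\<^sup>+x. J.fibre_sum F x \<partial>\<mu>r) = (\<integral>\<^sup>+h. \<integral>\<^sup>+t. F (h, t) \<partial>PiM I \<nu> \<partial>m)"
    unfolding nn_integral_fibre_sum_\<mu>r[OF F] by (rule nn_integral_M[OF F])
qed

text \<open>The indicator of a Borel set is the fibre sum of a function supported on
  \<open>fund\<close>, so the integrals of fibre sums determine the measure.\<close>

lemma \<mu>r_unique:
  assumes sets: "sets \<mu>' = sets SR"
    and tr: "\<And>F. F \<in> borel_measurable M \<Longrightarrow> (\<integral>\<^sup>+x. J.fibre_sum F x \<partial>\<mu>') = integral\<^sup>N M F"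
  shows "\<mu>' = \<mu>r"
proof (rule measure_eqI)
  fix A assume "A \<in> sets \<mu>'"
  then have A: "A \<in> sets SR" using sets by simp
  let ?F = "\<lambda>p. indicator fund p * indicator A (orbit_map p) :: ennreal"
  have F: "?F \<in> borel_measurable M"
    by (rule measurable_fund_mult[OF borel_measurable_indicator[OF A]])
  have "emeasure \<mu>' A = (\<integral>\<^sup>+x. indicator A x \<partial>\<mu>')"
    using A sets by simp
  also have "\<dots> = (\<integral>\<^sup>+x. J.fibre_sum ?F x \<partial>\<mu>')"
    using sets_eq_imp_space_eq[OF sets] space_SR
    by (intro nn_integral_cong fibre_sum_fund[symmetric]) simp
  also have "\<dots> = integral\<^sup>N M ?F"
    by (rule tr[OF F])
  also have "\<dots> = (\<integral>\<^sup>+x. indicator A x \<partial>\<mu>r)"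
    by (rule nn_integral_\<mu>r[OF borel_measurable_indicator[OF A], symmetric])
  also have "\<dots> = emeasure \<mu>r A"
    using A sets_\<mu>r by simp
  finally show "emeasure \<mu>' A = emeasure \<mu>r A" .
qed (simp add: sets sets_\<mu>r)

lemma transverse_imp_\<mu>r:
  assumes "sets \<mu>' = sets SR" "transverse_measure G T m SR \<delta> ZZ \<mu>' (PiM I \<nu>)"
  shows "\<mu>' = \<mu>r"
proof (rule \<mu>r_unique[OF assms(1)])
  fix F :: "'a \<times> ('i \<Rightarrow> 's) \<Rightarrow> ennreal"
  assume F: "F \<in> borel_measurable M"
  then show "(\<integral>\<^sup>+x. J.fibre_sum F x \<partial>\<mu>') = integral\<^sup>N M F"
    using J.transverseD[OF assms(2,1) sets_m sigma_finite_PiM_\<nu>, of F] nn_integral_M[OF F]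
    by (simp add: measurable_M)
qed

section \<open>Invariance and marginals of the intersection measure\<close>

lemma measurable_\<delta>: "g \<in> carrier G \<Longrightarrow> \<delta> g \<in> SR \<rightarrow>\<^sub>M SR"
  by (rule J.measurable_act[of "\<lambda>_. g"]) (simp_all add: topspace_eq)

text \<open>By uniqueness it suffices that the translated measure has the same integrals of fibre
  sums. The return times h of the translate of x by g correspond to the return times h g of x, and
  inv h = g inv (h g). Translation thus multiplies the group coordinate by g from the left, which
  Haar measure does not notice.\<close>

lemma \<mu>r_invariant:
  assumes g: "g \<in> carrier G"
  shows "distr \<mu>r \<mu>r (\<delta> g) = \<mu>r"
proof (rule \<mu>r_unique)
  fix F :: "'a \<times> ('i \<Rightarrow> 's) \<Rightarrow> ennreal"
  assume F: "F \<in> borel_measurable M"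
  define F' where "F' p = F (g \<otimes> fst p, snd p)" for p
  have shift: "(\<lambda>p. (g \<otimes> fst p, snd p)) \<in> M \<rightarrow>\<^sub>M M"
  proof (rule measurable_Pair)
    have "(\<lambda>p. g \<otimes> fst p) \<in> M \<rightarrow>\<^sub>M borel_of T"
      using g by (intro measurable_group_mult measurable_const)
        (simp_all add: topspace_eq measurable_cong_m[symmetric])
    then show "(\<lambda>p. g \<otimes> fst p) \<in> M \<rightarrow>\<^sub>M m"
      by (simp add: measurable_cong_m)
  qed (rule measurable_snd)
  have F': "F' \<in> borel_measurable M"
    unfolding F'_def by (rule measurable_compose[OF shift F])
  have meas: "\<delta> g \<in> \<mu>r \<rightarrow>\<^sub>M \<mu>r"
    using measurable_\<delta>[OF g] by (simp add: measurable_cong_sets[OF sets_\<mu>r sets_\<mu>r])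
  have fs: "J.fibre_sum F \<in> borel_measurable \<mu>r"
    using F J.measurable_fibre_sum unfolding measurable_M by (simp add: measurable_cong_sets[OF sets_\<mu>r refl])
  have "(\<integral>\<^sup>+x. J.fibre_sum F x \<partial>distr \<mu>r \<mu>r (\<delta> g)) = (\<integral>\<^sup>+x. J.fibre_sum F (\<delta> g x) \<partial>\<mu>r)"
    using meas fs by (intro nn_integral_distr) simp_all
  also have "\<dots> = (\<integral>\<^sup>+x. J.fibre_sum F' x \<partial>\<mu>r)"
  proof (rule nn_integral_cong)
    fix x assume "x \<in> space \<mu>r"
    then have x: "x \<in> XR" by (simp add: space_\<mu>r)
    have gx: "\<delta> g x \<in> XR" by (rule \<delta>_closed[OF x g])
    have bij: "bij_betw (\<lambda>h. h \<otimes> g) (return_set G \<delta> ZZ (\<delta> g x)) (return_set G \<delta> ZZ x)"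
    proof (rule bij_betwI[where g = "\<lambda>h. h \<otimes> inv g"])
      show "(\<lambda>h. h \<otimes> g) \<in> return_set G \<delta> ZZ (\<delta> g x) \<rightarrow> return_set G \<delta> ZZ x"
        using g \<delta>_mult[OF x _ g] by (auto simp: return_set_def)
      show "(\<lambda>h. h \<otimes> inv g) \<in> return_set G \<delta> ZZ x \<rightarrow> return_set G \<delta> ZZ (\<delta> g x)"
        using g \<delta>_mult[OF gx, of _ "inv g"] J.act_inv[OF g, of x] x by (auto simp: return_set_def space_SR)
      show "(h \<otimes> g) \<otimes> inv g = h" if "h \<in> return_set G \<delta> ZZ (\<delta> g x)" for h
        using that g by (simp add: return_set_def m_assoc)
      show "(h \<otimes> inv g) \<otimes> g = h" if "h \<in> return_set G \<delta> ZZ x" for h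
        using that g by (simp add: return_set_def m_assoc)
    qed
    have "J.fibre_sum F (\<delta> g x) =
        (\<integral>\<^sup>+h. F' (inv (h \<otimes> g), \<delta> (h \<otimes> g) x) \<partial>count_space (return_set G \<delta> ZZ (\<delta> g x)))"
      unfolding J.fibre_sum_def
    proof (rule nn_integral_cong)
      fix h assume "h \<in> space (count_space (return_set G \<delta> ZZ (\<delta> g x)))"
      then have h: "h \<in> carrier G" by (simp add: return_set_def)
      have "g \<otimes> inv (h \<otimes> g) = inv h"
        using g h by (simp add: inv_mult_group m_assoc[symmetric])
      then show "F (inv h, \<delta> h (\<delta> g x)) = F' (inv (h \<otimes> g), \<delta> (h \<otimes> g) x)"
        using \<delta>_mult[OF x h g] by (simp add: F'_def)
    qed
    also have "\<dots> = J.fibre_sum F' x"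
      unfolding J.fibre_sum_def
      by (rule nn_integral_bij_count_space[OF bij, where f = "\<lambda>h. F' (inv h, \<delta> h x)"])
    finally show "J.fibre_sum F (\<delta> g x) = J.fibre_sum F' x" .
  qed
  also have "\<dots> = integral\<^sup>N M F'"
    by (rule nn_integral_fibre_sum_\<mu>r[OF F'])
  also have "\<dots> = (\<integral>\<^sup>+h. (\<lambda>h. \<integral>\<^sup>+t. F (h, t) \<partial>PiM I \<nu>) (g \<otimes> h) \<partial>m)"
    unfolding nn_integral_M[OF F'] by (simp add: F'_def)
  also have "\<dots> = (\<integral>\<^sup>+h. \<integral>\<^sup>+t. F (h, t) \<partial>PiM I \<nu> \<partial>m)"
    by (rule nn_integral_left_mult[OF g
          sigma_finite_measure.borel_measurable_nn_integral_fst[OF sigma_finite_PiM_\<nu> F]])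
  also have "\<dots> = integral\<^sup>N M F"
    by (rule nn_integral_M[OF F, symmetric])
  finally show "(\<integral>\<^sup>+x. J.fibre_sum F x \<partial>distr \<mu>r \<mu>r (\<delta> g)) = integral\<^sup>N M F" .
qed (simp add: sets_\<mu>r)

text \<open>Distinct tuples \<open>h\<close> of return times above the same \<open>x\<close>, restricted to the window and to
  the fundamental domain, have distinct images, so at most one of them counts.\<close>

lemma \<mu>r_marginal_le:
  assumes k: "k \<in> I" and V: "\<And>j. j \<in> I \<Longrightarrow> openin T (V j)"
    and sep: "\<And>b b' y y' j. y \<in> XR \<Longrightarrow> y' \<in> XR \<Longrightarrow>
      (\<And>j. j \<in> I - {k} \<Longrightarrow> b j \<in> V j \<and> b' j \<in> V j \<and> \<phi> j (b j) (y j) = \<phi> j (b' j) (y' j)) \<Longrightarrow>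
      y k = y' k \<Longrightarrow> j \<in> I - {k} \<Longrightarrow> b j = b' j"
    and A: "A \<in> sets (S k)"
  shows "(\<Prod>j\<in>I - {k}. emeasure m (V j)) * emeasure \<mu>r {x \<in> XR. x k \<in> A} \<le> emeasure (\<mu> k) A"
proof -
  let ?A = "{x \<in> XR. x k \<in> A}"
  have A': "?A \<in> sets SR"
    using measurable_sets[OF measurable_SR_component[OF k] A] space_SR
    by (simp add: vimage_def Int_def conj_commute)
  have Vm: "V j \<in> sets m" if "j \<in> I" for j
    using openin_borel_of[OF V[OF that]] sets_m by simp
  let ?H = "\<lambda>p. indicator fund p * indicator ?A (orbit_map p) :: ennreal"
  have H: "?H \<in> borel_measurable M"
    by (rule measurable_fund_mult[OF borel_measurable_indicator[OF A']])
  have "emeasure \<mu>r ?A = integral\<^sup>N M ?H"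
    using nn_integral_\<mu>r[OF borel_measurable_indicator[OF A']] A' sets_\<mu>r by simp
  then have "(\<Prod>j\<in>I - {k}. emeasure m (V j)) * emeasure \<mu>r ?A =
      (\<integral>\<^sup>+x. \<integral>\<^sup>+h. window V k h * ?H (fibre_point k x h) \<partial>count_space (RR x) \<partial>PiM I \<mu>)"
    using lift_diagonal[OF k Vm H] by (simp add: fibre_point_def)
  also have "\<dots> \<le> (\<integral>\<^sup>+x. indicator A (x k) \<partial>PiM I \<mu>)"
  proof (rule nn_integral_mono)
    fix x assume "x \<in> space (PiM I \<mu>)"
    then have x: "x \<in> space Y" by (simp add: space_PiM_\<mu>)
    \<comment> \<open>Index k is the reference, so coordinate k is not moved. This is why the
      estimate concerns the k-th marginal.\<close>
    have base: "orbit_map (fibre_point k x h) k = x k" if h: "h \<in> RR x" for h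
      using orbit_map_fibre_point(2)[OF h x k k] RR_closed[OF h k] flow_one[OF k Y_closed[OF x k]] by simp
    show "(\<integral>\<^sup>+h. window V k h * ?H (fibre_point k x h) \<partial>count_space (RR x)) \<le> indicator A (x k)"
    proof (cases "x k \<in> A")
      case False
      have "(\<integral>\<^sup>+h. window V k h * ?H (fibre_point k x h) \<partial>count_space (RR x)) = (\<integral>\<^sup>+h. 0 \<partial>count_space (RR x))"
        using False base by (intro nn_integral_cong) simp
      then show ?thesis by simp
    next
      case True
      have "(\<integral>\<^sup>+h. window V k h * ?H (fibre_point k x h) \<partial>count_space (RR x)) \<le> 1"
      proof (rule nn_integral_count_space_le_one)
        fix h
        have "window V k h \<le> 1"
          unfolding window_def by (intro prod_le_1) (simp add: indicator_def)
        moreover have "?H (fibre_point k x h) \<le> 1"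
          by (simp add: indicator_def)
        ultimately show "window V k h * ?H (fibre_point k x h) \<le> 1"
          using mult_mono[of "window V k h" 1 "?H (fibre_point k x h)" 1] by simp
      next
        fix h h' assume h: "h \<in> RR x" "h' \<in> RR x"
          and nz: "window V k h * ?H (fibre_point k x h) \<noteq> 0" "window V k h' * ?H (fibre_point k x h') \<noteq> 0"
        have mem: "inv (h j) \<otimes> h k \<in> V j \<and> fibre_point k x h \<in> fund"
          if "window V k h * ?H (fibre_point k x h) \<noteq> 0" "j \<in> I - {k}" for h j
        proof -
          have "window V k h \<noteq> 0" "fibre_point k x h \<in> fund"
            using that(1) by (auto simp: indicator_def split: if_splits)
          then show ?thesis
            using that(2) finite_I unfolding window_def by (auto simp: indicator_def split: if_splits)
        qed
        have fund: "fibre_point k x h \<in> fund" if "window V k h * ?H (fibre_point k x h) \<noteq> 0" for h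
          using that by (auto simp: indicator_def split: if_splits)
        \<comment> \<open>These elements carry the j-th coordinate of the image back to x_j, and the
          window puts them into V_j. Two tuples above the same x are therefore an instance of
          \<open>sep\<close>.\<close>
        let ?b = "\<lambda>h j. inv (h j) \<otimes> h k"
        have recover: "\<phi> j (?b h j) (orbit_map (fibre_point k x h) j) = x j" if "h \<in> RR x" "j \<in> I" for h j
        proof -
          have G: "h j \<in> carrier G" "h k \<in> carrier G"
            using RR_closed[OF that(1)] that(2) k by auto
          have "orbit_map (fibre_point k x h) j = \<phi> j (inv (?b h j)) (x j)"
            using orbit_map_fibre_point(2)[OF that(1) x k that(2)] G by (simp add: inv_mult_group)
          then show ?thesis
            using flow_inv'[OF that(2) _ Y_closed[OF x that(2)], of "?b h j"] G by simp
        qed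
        have b: "?b h j = ?b h' j" if j: "j \<in> I - {k}" for j
        proof (rule sep[of "orbit_map (fibre_point k x h)" "orbit_map (fibre_point k x h')" "?b h" "?b h'"])
          show "orbit_map (fibre_point k x h) \<in> XR" "orbit_map (fibre_point k x h') \<in> XR"
            by (rule orbit_map_fibre_point(1)[OF h(1) x k], rule orbit_map_fibre_point(1)[OF h(2) x k])
          show "orbit_map (fibre_point k x h) k = orbit_map (fibre_point k x h') k"
            using base h by simp
          show "?b h j \<in> V j \<and> ?b h' j \<in> V j \<and> \<phi> j (?b h j) (orbit_map (fibre_point k x h) j) = \<phi> j (?b h' j) (orbit_map (fibre_point k x h') j)"
            if "j \<in> I - {k}" for j
            using mem[OF nz(1) that] mem[OF nz(2) that] recover[OF h(1), of j] recover[OF h(2), of j] that by simp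
        qed (rule j)
        have G: "h j \<in> carrier G" "h' j \<in> carrier G" if "j \<in> I" for j
          using RR_closed h that by auto
        have q: "inv (h k) \<otimes> h j = inv (h' k) \<otimes> h' j" if j: "j \<in> I" for j
        proof (cases "j = k")
          case True
          then show ?thesis using G[OF k] by simp
        next
          case False
          then have "inv (?b h j) = inv (?b h' j)"
            using b[of j] j by simp
          then show ?thesis
            using G[OF k] G[OF j] by (simp add: inv_mult_group)
        qed
        \<comment> \<open>Equal quotients give equal images. Two points of \<open>fund\<close> with
          the same image have the same group coordinate, so h and h' agree at k, and by the
          quotients everywhere.\<close>
        have "orbit_map (fibre_point k x h) = orbit_map (fibre_point k x h')"
        proof (rule PiE_ext[of _ I "\<lambda>k. space (S k)"])
          show "orbit_map (fibre_point k x h) \<in> (\<Pi>\<^sub>E k\<in>I. space (S k))" "orbit_map (fibre_point k x h') \<in> (\<Pi>\<^sub>E k\<in>I. space (S k))"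
            using subsetD[OF XR_subset orbit_map_fibre_point(1)[OF h(1) x k]] subsetD[OF XR_subset orbit_map_fibre_point(1)[OF h(2) x k]]
            by (simp_all only: space_Y)
          show "orbit_map (fibre_point k x h) j = orbit_map (fibre_point k x h') j" if "j \<in> I" for j
            using orbit_map_fibre_point(2)[OF h(1) x k that] orbit_map_fibre_point(2)[OF h(2) x k that] q[OF that] by simp
        qed
        then have "inv (h k) = inv (h' k)"
          using fund[OF nz(1)] fund[OF nz(2)] by (simp add: fund_def fibre_point_def)
        then have hk: "h k = h' k"
          using G[OF k] by (metis inv_inv)
        show "h = h'"
        proof (rule PiE_ext[OF h])
          fix j assume j: "j \<in> I"
          show "h j = h' j"
            using q[OF j] hk G[OF j] G[OF k] by simp
        qed
      qed
      then show ?thesis using True by simp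
    qed
  qed
  also have "\<dots> = emeasure (\<mu> k) A"
  proof -
    \<comment> \<open>The cylinder over A is a box whose other sides are whole spaces, each of mass
      one.\<close>
    let ?B = "\<lambda>j. if j = k then A else space (\<mu> j)"
    have B: "?B j \<in> sets (\<mu> j)" if "j \<in> I" for j
      using A sets_\<mu>[OF k] by simp
    have "(\<integral>\<^sup>+x. indicator A (x k) \<partial>PiM I \<mu>) = (\<integral>\<^sup>+x. indicator (Pi\<^sub>E I ?B) x \<partial>PiM I \<mu>)"
      using k by (intro nn_integral_cong) (auto simp: indicator_def space_PiM PiE_iff split: if_splits)
    also have "\<dots> = (\<Prod>j\<in>I. emeasure (\<mu> j) (?B j))"
      using B finite_I by (subst nn_integral_indicator)
        (auto intro!: sets_PiM_I_finite emeasure_PiM_sigma_finite sigma_finite_\<mu>)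
    also have "\<dots> = (\<Prod>j\<in>I. if j = k then emeasure (\<mu> k) A else 1)"
      using prob_space.emeasure_space_1[OF prob_\<mu>] by (intro prod.cong) auto
    also have "\<dots> = emeasure (\<mu> k) A"
      using finite_I k by (simp add: prod.delta)
    finally show ?thesis .
  qed
  finally show ?thesis .
qed

text \<open>If the measure vanished, the identity for F = 1 would make m(G) times the product of the
  masses of the \<nu>_k equal to 0, so some \<nu>_k would be 0. Then, by the identity for \<mu>_k,
  almost no point would have a return time, whereas every point has one.\<close>

lemma \<mu>r_nonzero: "emeasure \<mu>r XR \<noteq> 0"
proof
  assume 0: "emeasure \<mu>r XR = 0"
  have "integral\<^sup>N M (\<lambda>_. 1) = (\<integral>\<^sup>+x. J.fibre_sum (\<lambda>_. 1) x \<partial>\<mu>r)"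
    by (rule nn_integral_fibre_sum_\<mu>r[symmetric]) simp
  also have "\<dots> = 0"
  proof -
    have "AE x in \<mu>r. False"
      using 0 space_\<mu>r by (intro AE_I[of _ _ XR]) (auto simp: sets_\<mu>r sets_SR XR_sets)
    then have "AE x in \<mu>r. J.fibre_sum (\<lambda>_. 1) x = 0"
      by eventually_elim simp
    then have "(\<integral>\<^sup>+x. J.fibre_sum (\<lambda>_. 1) x \<partial>\<mu>r) = (\<integral>\<^sup>+x. 0 \<partial>\<mu>r)"
      by (rule nn_integral_cong_AE)
    then show ?thesis by simp
  qed
  finally have "emeasure M (space M) = 0"
    by simp
  moreover have "emeasure M (space M) = emeasure m (space m) * emeasure (PiM I \<nu>) (space (PiM I \<nu>))"
    using sigma_finite_measure.emeasure_pair_measure_Times[OF sigma_finite_PiM_\<nu>, of "space m" m "space (PiM I \<nu>)"]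
      sets.top[of m]
    by (simp add: space_pair_measure)
  moreover have "emeasure m (space m) \<noteq> 0"
    using haar unfolding haar_measure_def by simp
  moreover have "emeasure (PiM I \<nu>) (space (PiM I \<nu>)) = (\<Prod>k\<in>I. emeasure (\<nu> k) (space (\<nu> k)))"
    unfolding space_PiM by (rule emeasure_PiM_sigma_finite[OF finite_I sigma_finite_\<nu>]) auto
  moreover have "emeasure (\<nu> k) (space (\<nu> k)) \<noteq> 0" if k: "k \<in> I" for k
  proof
    interpret F: section_flow G T "S k" "\<phi> k" "Z k" "D k" "\<gamma> k" by (rule flow[OF k])
    assume 0: "emeasure (\<nu> k) (space (\<nu> k)) = 0"
    have "(\<integral>\<^sup>+x. F.fibre_sum (\<lambda>_. 1) x \<partial>\<mu> k) = (\<integral>\<^sup>+h. \<integral>\<^sup>+t. 1 \<partial>\<nu> k \<partial>m)"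
      unfolding F.fibre_sum_def by (rule transverse[OF k, where F = "\<lambda>_. 1"]) simp
    also have "\<dots> = 0"
      using 0 by simp
    finally have "AE x in \<mu> k. F.fibre_sum (\<lambda>_. 1) x = 0"
      using F.measurable_fibre_sum[of "\<lambda>_. 1"] by (simp add: nn_integral_0_iff_AE measurable_cong_sets[OF sets_\<mu>[OF k] refl])
    then have "AE x in \<mu> k. R k x = {}"
    proof eventually_elim
      case (elim x)
      show ?case
      proof (rule ccontr)
        assume "R k x \<noteq> {}"
        then obtain h where "h \<in> R k x" by blast
        then have "1 \<le> F.fibre_sum (\<lambda>_. 1) x"
          unfolding F.fibre_sum_def using nn_integral_ge_point[of h "R k x" "\<lambda>_. 1"] by simp
        then show False
          using elim by simp
      qed
    qed
    moreover have "R k x \<noteq> {}" if "x \<in> space (\<mu> k)" for x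
      using cover[OF k] that space_\<mu>[OF k] by blast
    ultimately have "AE x in \<mu> k. False"
      by (auto elim: eventually_mono simp: eventually_ae_filter)
    then show False
      using prob_space.AE_False[OF prob_\<mu>[OF k]] by simp
  qed
  ultimately show False
    using finite_I by auto
qed

end

section \<open>Ergodicity\<close>

lemma (in borel_flow) measurable_flow_map:
  assumes "g \<in> carrier G" and N: "sets N = sets S"
  shows "\<phi> g \<in> N \<rightarrow>\<^sub>M N"
proof -
  have "\<phi> g \<in> S \<rightarrow>\<^sub>M S"
    using assms(1) by (intro measurable_act[of "\<lambda>_. g"]) (simp_all add: topspace_eq)
  then show ?thesis
    by (simp add: measurable_cong_sets[OF N N])
qed

lemma (in borel_flow) nn_integral_flow_map:
  assumes g: "g \<in> carrier G" and N: "sets N = sets S" "invariant_measure G \<phi> N"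
    and f: "f \<in> borel_measurable N"
  shows "(\<integral>\<^sup>+x. f (\<phi> g x) \<partial>N) = (\<integral>\<^sup>+x. f x \<partial>N)"
  using nn_integral_distr[OF measurable_flow_map[OF g N(1)], of f] f N(2) g
  unfolding invariant_measure_def by simp

text \<open>A set that is invariant up to null sets is replaced by the set of points whose orbit lies
  in it for almost every group element; right invariance of the Haar measure makes it strictly
  invariant.\<close>

lemma (in unimodular_group) ergodic_almost_invariant:
  assumes flow: "borel_flow G T S \<phi>" and \<mu>: "sets \<mu> = sets S" "prob_space \<mu>" and erg: "ergodic G \<phi> \<mu>"
    and B: "B \<in> sets S" and ae: "\<And>g. g \<in> carrier G \<Longrightarrow> AE x in \<mu>. \<phi> g x \<in> B \<longleftrightarrow> x \<in> B"
  shows "(AE x in \<mu>. x \<in> B) \<or> (AE x in \<mu>. x \<notin> B)"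
proof -
  have sf_m: "sigma_finite_measure m"
    by (rule sigma_finite_measure_axioms)
  interpret F: borel_flow G T S \<phi> by (rule flow)
  interpret \<mu>: prob_space \<mu> by (rule \<mu>(2))
  interpret pair_sigma_finite m \<mu>
    by (intro pair_sigma_finite.intro sf_m \<mu>.sigma_finite_measure_axioms)
  have sp: "space \<mu> = space S"
    by (rule sets_eq_imp_space_eq[OF \<mu>(1)])
  have act: "(\<lambda>p. \<phi> (fst p) (snd p)) \<in> m \<Otimes>\<^sub>M \<mu> \<rightarrow>\<^sub>M S"
    using F.measurable_action
    by (simp add: case_prod_beta' measurable_cong_sets[OF sets_pair_measure_cong[OF sets_m \<mu>(1)] refl])
  define f where "f x = (\<integral>\<^sup>+h. indicator (space S - B) (\<phi> h x) \<partial>m)" for x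
  have f_meas: "f \<in> borel_measurable \<mu>"
  proof -
    have "(\<lambda>p. indicator (space S - B) (\<phi> (fst p) (snd p)) :: ennreal) \<in> borel_measurable (m \<Otimes>\<^sub>M \<mu>)"
      using B by (intro measurable_compose[OF act borel_measurable_indicator]) auto
    from measurable_pair_swap[OF this] show ?thesis
      unfolding f_def
      by (intro sigma_finite_measure.borel_measurable_nn_integral[OF sf_m]) (simp add: case_prod_beta')
  qed
  define B' where "B' = {x \<in> space \<mu>. f x = 0}"
  have B'_sets: "B' \<in> sets \<mu>"
    unfolding B'_def using f_meas by measurable
  have f_act: "f (\<phi> g x) = f x" if g: "g \<in> carrier G" and x: "x \<in> space S" for g x
  proof -
    have "(\<lambda>h. \<phi> h x) \<in> m \<rightarrow>\<^sub>M S"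
      using x by (intro F.measurable_act) (simp_all add: measurable_ident_sets[OF sets_m])
    then have meas: "(\<lambda>h. indicator (space S - B) (\<phi> h x) :: ennreal) \<in> borel_measurable m"
      using B by (intro measurable_compose[OF _ borel_measurable_indicator]) auto
    have "f (\<phi> g x) = (\<integral>\<^sup>+h. indicator (space S - B) (\<phi> (h \<otimes> g) x) \<partial>m)"
      unfolding f_def using g x by (intro nn_integral_cong) (simp add: F.act_mult)
    then show ?thesis
      unfolding f_def using nn_integral_right_mult[OF g meas] by simp
  qed
  have B'_inv: "\<phi> g ` B' = B'" if g: "g \<in> carrier G" for g
  proof (rule subset_antisym)
    show "\<phi> g ` B' \<subseteq> B'"
      using f_act[OF g] F.act_closed[OF g] by (auto simp: B'_def sp)
    show "B' \<subseteq> \<phi> g ` B'"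
    proof
      fix x assume x: "x \<in> B'"
      then have "x = \<phi> g (\<phi> (inv g) x)"
        using F.act_inv'[OF g] by (simp add: B'_def sp)
      moreover have "\<phi> (inv g) x \<in> B'"
        using x f_act[of "inv g" x] F.act_closed[of "inv g" x] g by (simp add: B'_def sp)
      ultimately show "x \<in> \<phi> g ` B'" by (rule image_eqI)
    qed
  qed
  have dich: "emeasure \<mu> B' = 0 \<or> emeasure \<mu> (space \<mu> - B') = 0"
    by (rule erg[unfolded ergodic_def, rule_format, OF B'_sets B'_inv])
  \<comment> \<open>Tonelli passes from "for every h and almost every x" to "for almost every x and
    almost every h". For such x the value \<open>f x\<close> is 0 or the nonzero mass of the group,
    according to whether x lies in B.\<close>
  have ae': "AE x in \<mu>. AE h in m. \<phi> h x \<in> B \<longleftrightarrow> x \<in> B"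
  proof -
    have "{p \<in> space (m \<Otimes>\<^sub>M \<mu>). \<phi> (fst p) (snd p) \<in> B \<longleftrightarrow> snd p \<in> B} \<in> sets (m \<Otimes>\<^sub>M \<mu>)"
    proof -
      have [measurable]: "B \<in> sets \<mu>" using B \<mu>(1) by simp
      have [measurable]: "(\<lambda>p. \<phi> (fst p) (snd p)) \<in> m \<Otimes>\<^sub>M \<mu> \<rightarrow>\<^sub>M \<mu>"
        using act by (simp add: measurable_cong_sets[OF refl \<mu>(1)])
      show ?thesis by measurable
    qed
    note comm = AE_commute[OF this]
    have "AE h in m. AE x in \<mu>. \<phi> h x \<in> B \<longleftrightarrow> x \<in> B"
    proof (rule AE_I2)
      fix h assume "h \<in> space m"
      then show "AE x in \<mu>. \<phi> h x \<in> B \<longleftrightarrow> x \<in> B"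
        using space_m by (intro ae) (simp only:)
    qed
    then show ?thesis
      by (rule comm[THEN iffD1])
  qed
  have "AE x in \<mu>. x \<in> B' \<longleftrightarrow> x \<in> B"
    using ae' AE_space
  proof eventually_elim
    case (elim x)
    have meas: "(\<lambda>h. indicator (space S - B) (\<phi> h x) :: ennreal) \<in> borel_measurable m"
    proof -
      have "(\<lambda>h. \<phi> h x) \<in> m \<rightarrow>\<^sub>M S"
        using elim(2) by (intro F.measurable_act) (simp_all add: measurable_ident_sets[OF sets_m] sp)
      then show ?thesis
        using B by (intro measurable_compose[OF _ borel_measurable_indicator]) auto
    qed
    have "f x = (\<integral>\<^sup>+h. indicator (space S - B) x \<partial>m)"
      unfolding f_def
    proof (rule nn_integral_cong_AE)
      show "AE h in m. indicator (space S - B) (\<phi> h x) = (indicator (space S - B) x :: ennreal)"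
        using elim(1) AE_space
      proof eventually_elim
        case (elim h)
        then show ?case
          using F.act_closed[of h x] \<open>x \<in> space \<mu>\<close> by (auto simp: indicator_def sp)
      qed
    qed
    also have "\<dots> = indicator (space S - B) x * emeasure m (space m)"
      by simp
    finally have "f x = indicator (space S - B) x * emeasure m (carrier G)"
      by simp
    moreover have "emeasure m (carrier G) \<noteq> 0"
      using haar unfolding haar_measure_def by simp
    ultimately show ?case
      using elim(2) by (auto simp: B'_def indicator_def sp)
  qed
  note eq = this
  show ?thesis
    using dich
  proof
    assume "emeasure \<mu> B' = 0"
    then have "AE x in \<mu>. x \<notin> B'"
      using B'_sets by (intro AE_not_in) (simp add: null_sets_def)
    with eq have "AE x in \<mu>. x \<notin> B"
      by eventually_elim simp
    then show ?thesis ..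
  next
    assume "emeasure \<mu> (space \<mu> - B') = 0"
    then have "AE x in \<mu>. x \<in> B'"
      using B'_sets by (intro AE_I[of _ _ "space \<mu> - B'"]) auto
    with eq have "AE x in \<mu>. x \<in> B"
      by eventually_elim simp
    then show ?thesis ..
  qed
qed

text \<open>Domination yields a density f, which is invariant up to null sets because both measures
  are invariant. The set where f exceeds its mean t, the mass of L, is almost invariant and cannot
  have full measure; so it is null and L is at most t times \<mu>. Both sides have total mass t,
  hence equality on A follows from the inequality on the complement.\<close>

lemma (in unimodular_group) ergodic_dominated:
  assumes flow: "borel_flow G T S \<phi>" and \<mu>: "sets \<mu> = sets S" "prob_space \<mu>" "invariant_measure G \<phi> \<mu>"
    and erg: "ergodic G \<phi> \<mu>"
    and L: "sets L = sets S" "finite_measure L" "invariant_measure G \<phi> L"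
    and c: "c \<noteq> 0" "\<And>A. A \<in> sets S \<Longrightarrow> c * emeasure L A \<le> emeasure \<mu> A"
    and A: "A \<in> sets S"
  shows "emeasure L A = emeasure L (space L) * emeasure \<mu> A"
proof -
  interpret F: borel_flow G T S \<phi> by (rule flow)
  interpret \<mu>: prob_space \<mu> by (rule \<mu>(2))
  interpret L: finite_measure L by (rule L(2))
  have sets_eq: "sets L = sets \<mu>" using L(1) \<mu>(1) by simp
  have sp: "space \<mu> = space S" "space L = space S"
    using sets_eq_imp_space_eq[OF \<mu>(1)] sets_eq_imp_space_eq[OF L(1)] by auto
  have "absolutely_continuous \<mu> L"
    unfolding absolutely_continuous_def
  proof
    fix N assume N: "N \<in> null_sets \<mu>"
    then have "c * emeasure L N \<le> 0"
      using c(2)[of N] \<mu>(1) by (auto simp: null_sets_def)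
    then show "N \<in> null_sets L"
      using N c(1) sets_eq by (auto simp: null_sets_def)
  qed
  then obtain f where f: "f \<in> borel_measurable \<mu>" "density \<mu> f = L"
    using \<mu>.Radon_Nikodym[OF _ sets_eq] by blast
  have em: "emeasure L E = (\<integral>\<^sup>+x. f x * indicator E x \<partial>\<mu>)" if "E \<in> sets S" for E
    using emeasure_density[OF f(1), of E] f(2) that \<mu>(1) by simp
  define t where "t = emeasure L (space L)"
  have t_fin: "t < \<infinity>"
    unfolding t_def using L.emeasure_finite by (simp add: less_top[symmetric])
  have int_f: "(\<integral>\<^sup>+x. f x \<partial>\<mu>) = t"
  proof -
    have "t = (\<integral>\<^sup>+x. f x * indicator (space S) x \<partial>\<mu>)"
      unfolding t_def sp(2) by (rule em) simp
    also have "\<dots> = (\<integral>\<^sup>+x. f x \<partial>\<mu>)"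
      by (intro nn_integral_cong) (simp add: sp)
    finally show ?thesis by simp
  qed
  have f_inv: "AE x in \<mu>. f (\<phi> g x) = f x" if g: "g \<in> carrier G" for g
  proof -
    have meas: "\<phi> g \<in> \<mu> \<rightarrow>\<^sub>M \<mu>" by (rule F.measurable_flow_map[OF g \<mu>(1)])
    have fg: "(\<lambda>x. f (\<phi> g x)) \<in> borel_measurable \<mu>"
      by (rule measurable_compose[OF meas f(1)])
    have ig: "inv g \<in> carrier G" using g by simp
    have meas': "\<phi> (inv g) \<in> \<mu> \<rightarrow>\<^sub>M \<mu>" by (rule F.measurable_flow_map[OF ig \<mu>(1)])
    \<comment> \<open>Densities are unique up to null sets, so the measures may be compared instead:
      invariance of \<mu> moves g from the density to the test set, and invariance of L under the
      inverse removes it there.\<close>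
    have "density \<mu> (\<lambda>x. f (\<phi> g x)) = density \<mu> f"
    proof (rule measure_eqI)
      fix E assume "E \<in> sets (density \<mu> (\<lambda>x. f (\<phi> g x)))"
      then have E: "E \<in> sets \<mu>" by simp
      have iE: "(\<lambda>y. indicator E (\<phi> (inv g) y) :: ennreal) \<in> borel_measurable \<mu>"
        by (rule measurable_compose[OF meas' borel_measurable_indicator[OF E]])
      have "emeasure (density \<mu> (\<lambda>x. f (\<phi> g x))) E = (\<integral>\<^sup>+x. f (\<phi> g x) * indicator E x \<partial>\<mu>)"
        by (rule emeasure_density[OF fg E])
      also have "\<dots> = (\<integral>\<^sup>+x. f (\<phi> g x) * indicator E (\<phi> (inv g) (\<phi> g x)) \<partial>\<mu>)"
        using F.act_inv[OF g] by (intro nn_integral_cong) (simp add: sp)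
      also have "\<dots> = (\<integral>\<^sup>+y. f y * indicator E (\<phi> (inv g) y) \<partial>\<mu>)"
        using f(1) iE by (intro F.nn_integral_flow_map[OF g \<mu>(1,3), of "\<lambda>y. f y * indicator E (\<phi> (inv g) y)"]
            borel_measurable_times_ennreal)
      also have "\<dots> = (\<integral>\<^sup>+y. indicator E (\<phi> (inv g) y) \<partial>L)"
        unfolding f(2)[symmetric] by (rule nn_integral_density[OF f(1) iE, symmetric])
      also have "\<dots> = (\<integral>\<^sup>+y. indicator E y \<partial>L)"
        using E sets_eq by (intro F.nn_integral_flow_map[OF ig L(1,3)]) simp
      also have "\<dots> = emeasure (density \<mu> f) E"
        using E sets_eq f(2) by simp
      finally show "emeasure (density \<mu> (\<lambda>x. f (\<phi> g x))) E = emeasure (density \<mu> f) E" .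
    qed simp
    then show ?thesis
      using \<mu>.density_unique_iff[OF fg f(1)] by simp
  qed
  define B where "B = {x \<in> space \<mu>. t < f x}"
  have B: "B \<in> sets S"
    unfolding B_def \<mu>(1)[symmetric] using f(1) by measurable
  have "AE x in \<mu>. \<phi> g x \<in> B \<longleftrightarrow> x \<in> B" if g: "g \<in> carrier G" for g
    using f_inv[OF g] AE_space
  proof eventually_elim
    case (elim x)
    then show ?case
      using F.act_closed[OF g, of x] by (simp add: B_def sp)
  qed
  then have "(AE x in \<mu>. x \<in> B) \<or> (AE x in \<mu>. x \<notin> B)"
    by (rule ergodic_almost_invariant[OF flow \<mu>(1,2) erg B])
  \<comment> \<open>Otherwise f - t would be positive almost everywhere, yet its integral is t - t =
    0.\<close>
  moreover have "\<not> (AE x in \<mu>. x \<in> B)"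
  proof
    assume ae: "AE x in \<mu>. x \<in> B"
    then have le: "AE x in \<mu>. t \<le> f x"
      by eventually_elim (auto simp: B_def)
    have "(\<integral>\<^sup>+x. f x - t \<partial>\<mu>) = (\<integral>\<^sup>+x. f x \<partial>\<mu>) - (\<integral>\<^sup>+x. t \<partial>\<mu>)"
      using f(1) le t_fin \<mu>.emeasure_space_1 by (intro nn_integral_diff) auto
    also have "\<dots> = 0"
      using int_f \<mu>.emeasure_space_1 t_fin by (simp add: less_top)
    finally have "AE x in \<mu>. f x - t = 0"
      using f(1) by (subst (asm) nn_integral_0_iff_AE) auto
    then have "AE x in \<mu>. False"
      using ae
    proof eventually_elim
      case (elim x)
      then show ?case
        using t_fin by (auto simp: B_def diff_eq_0_iff_ennreal)
    qed
    then show False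
      using \<mu>.AE_False by simp
  qed
  ultimately have "AE x in \<mu>. x \<notin> B" by blast
  then have f_le: "AE x in \<mu>. f x \<le> t"
    using AE_space by eventually_elim (simp add: B_def)
  have le: "emeasure L E \<le> t * emeasure \<mu> E" if E: "E \<in> sets S" for E
  proof -
    have "emeasure L E \<le> (\<integral>\<^sup>+x. t * indicator E x \<partial>\<mu>)"
      unfolding em[OF E]
    proof (rule nn_integral_mono_AE)
      show "AE x in \<mu>. f x * indicator E x \<le> t * indicator E x"
        using f_le by eventually_elim (simp add: mult_right_mono)
    qed
    also have "\<dots> = t * emeasure \<mu> E"
      using E \<mu>(1) by (intro nn_integral_cmult_indicator) simp
    finally show ?thesis .
  qed
  let ?C = "space S - A"
  have C: "?C \<in> sets S" using A by auto
  have sum_L: "emeasure L A + emeasure L ?C = t"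
    using A C L(1) sets.sets_into_space[OF A] unfolding t_def sp
    by (subst plus_emeasure) (auto simp: Un_absorb1)
  have sum_\<mu>: "t * emeasure \<mu> A + t * emeasure \<mu> ?C = t"
  proof -
    have "emeasure \<mu> A + emeasure \<mu> ?C = emeasure \<mu> (space \<mu>)"
      using A C \<mu>(1) sets.sets_into_space[OF A] unfolding sp
      by (subst plus_emeasure) (auto simp: Un_absorb1)
    then show ?thesis
      by (simp add: \<mu>.emeasure_space_1 distrib_left[symmetric])
  qed
  have "emeasure L A = t * emeasure \<mu> A"
  proof (rule antisym[OF le[OF A]])
    have "emeasure L ?C + t * emeasure \<mu> A \<le> t * emeasure \<mu> ?C + t * emeasure \<mu> A"
      by (rule add_right_mono[OF le[OF C]])
    also have "\<dots> = emeasure L ?C + emeasure L A"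
      using sum_L sum_\<mu> by (simp add: add.commute)
    finally show "t * emeasure \<mu> A \<le> emeasure L A"
      using L.emeasure_finite by (simp add: ennreal_add_left_cancel_le)
  qed
  then show ?thesis
    by (simp add: t_def)
qed

section \<open>Windows from commensurability\<close>

text \<open>The tuple with entries inv b'_j b_j, and \<one> at position k, lies in the kernel of the
  k-th projection and carries y to y', both of them points of the intersection space. If the V_j are
  so small that these entries stay in a box inside the separating neighbourhood, commensurability
  forces the tuple to be trivial.\<close>

lemma commensurable_windows:
  assumes G: "lcsc_group G T" and flow: "\<And>j. j \<in> {1..r} \<Longrightarrow> borel_flow G T (borel_of (X j)) (\<phi> j)"
    and comm: "commensurable G T r X \<phi> Z" and k: "k \<in> {1..r}"
  obtains V where "\<And>j. j \<in> {1..r} \<Longrightarrow> openin T (V j)" "\<And>j. j \<in> {1..r} \<Longrightarrow> \<one>\<^bsub>G\<^esub> \<in> V j"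
    "\<And>b b' y y' j. y \<in> intersection_space G r X \<phi> Z \<Longrightarrow> y' \<in> intersection_space G r X \<phi> Z \<Longrightarrow>
      (\<And>j. j \<in> {1..r} - {k} \<Longrightarrow> b j \<in> V j \<and> b' j \<in> V j \<and> \<phi> j (b j) (y j) = \<phi> j (b' j) (y' j)) \<Longrightarrow>
      y k = y' k \<Longrightarrow> j \<in> {1..r} - {k} \<Longrightarrow> b j = b' j"
proof -
  interpret lcsc_group G T by (rule G)
  let ?I = "{1..r}"
  let ?one = "\<lambda>i\<in>?I. \<one>\<^bsub>G\<^esub>"
  let ?X = "intersection_space G r X \<phi> Z"
  have ker: "n \<in> coordinate_kernel r G k \<longleftrightarrow> n \<in> (\<Pi>\<^sub>E i\<in>?I. carrier G) \<and> n k = \<one>\<^bsub>G\<^esub>" for n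
    by (simp add: coordinate_kernel_def kernel_def power_group_def)
  obtain U where U: "openin (subtopology (product_topology (\<lambda>_. T) ?I) (coordinate_kernel r G k)) U"
    "?one \<in> U"
    "{h \<in> coordinate_kernel r G k. product_action r X \<phi> h ` ?X \<inter> ?X \<noteq> {}} \<inter> U = {?one}"
  proof -
    have "separated_cross_section ((power_group r G)\<lparr>carrier := coordinate_kernel r G k\<rparr>)
        (subtopology (product_topology (\<lambda>_. T) ?I) (coordinate_kernel r G k))
        (borel_of (product_space r X)) (product_action r X \<phi>) ?X"
      using comm k unfolding commensurable_def by (rule bspec)
    then have "\<exists>U. openin (subtopology (product_topology (\<lambda>_. T) ?I) (coordinate_kernel r G k)) U \<and>
        ?one \<in> U \<and>
        {h \<in> coordinate_kernel r G k. product_action r X \<phi> h ` ?X \<inter> ?X \<noteq> {}} \<inter> U = {?one}"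
      unfolding separated_cross_section_def by (simp add: power_group_def)
    then show ?thesis
      using that by (elim exE conjE)
  qed
  obtain W where W: "openin (product_topology (\<lambda>_. T) ?I) W" "U = W \<inter> coordinate_kernel r G k"
    using U(1) unfolding openin_subtopology by blast
  have "?one \<in> W" using U(2) W(2) by blast
  \<comment> \<open>The separating neighbourhood is open in the kernel only; it contains the trace
    of an open box, which allows the coordinates to be treated separately.\<close>
  then obtain O' where O': "\<forall>i\<in>?I. openin T (O' i)" "?one \<in> Pi\<^sub>E ?I O'" "Pi\<^sub>E ?I O' \<subseteq> W"
    using W(1) unfolding openin_product_topology_alt by blast
  have one_O: "\<one>\<^bsub>G\<^esub> \<in> O' j" if "j \<in> ?I" for j
    using O'(2) that by (auto simp: PiE_iff)
  have "\<exists>V. openin T V \<and> \<one>\<^bsub>G\<^esub> \<in> V \<and> (\<forall>g\<in>V. \<forall>h\<in>V. inv\<^bsub>G\<^esub> g \<otimes>\<^bsub>G\<^esub> h \<in> O' j)" if j: "j \<in> ?I" for j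
  proof -
    have "openin T (O' j)" using O'(1) j by blast
    then obtain V where "openin T V" "\<one>\<^bsub>G\<^esub> \<in> V" "\<And>g h. g \<in> V \<Longrightarrow> h \<in> V \<Longrightarrow> inv\<^bsub>G\<^esub> g \<otimes>\<^bsub>G\<^esub> h \<in> O' j"
      using one_O[OF j] by (rule small_neighbourhood) (rule that)
    then show ?thesis
      by (intro exI[of _ V]) simp
  qed
  then have "\<forall>j\<in>?I. \<exists>V. openin T V \<and> \<one>\<^bsub>G\<^esub> \<in> V \<and> (\<forall>g\<in>V. \<forall>h\<in>V. inv\<^bsub>G\<^esub> g \<otimes>\<^bsub>G\<^esub> h \<in> O' j)"
    by (rule ballI)
  then obtain V where V: "\<forall>j\<in>?I. openin T (V j) \<and> \<one>\<^bsub>G\<^esub> \<in> V j \<and> (\<forall>g\<in>V j. \<forall>h\<in>V j. inv\<^bsub>G\<^esub> g \<otimes>\<^bsub>G\<^esub> h \<in> O' j)"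
    by (rule bchoice[THEN exE])
  show ?thesis
  proof (rule that[of V])
    show "openin T (V j)" "\<one>\<^bsub>G\<^esub> \<in> V j" if "j \<in> ?I" for j
      using V that by auto
    fix b b' y y' j
    assume y: "y \<in> ?X" "y' \<in> ?X" "y k = y' k" and j: "j \<in> ?I - {k}"
      and eq: "\<And>j. j \<in> ?I - {k} \<Longrightarrow> b j \<in> V j \<and> b' j \<in> V j \<and> \<phi> j (b j) (y j) = \<phi> j (b' j) (y' j)"
    have yX: "y \<in> topspace (product_space r X)" "y' \<in> topspace (product_space r X)"
      using y by (auto simp: intersection_space_def)
    have yS: "y i \<in> space (borel_of (X i))" "y' i \<in> space (borel_of (X i))" if "i \<in> ?I" for i
      using yX that by (auto simp: PiE_iff)
    have bG: "b i \<in> carrier G" "b' i \<in> carrier G" if "i \<in> ?I - {k}" for i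
      using eq[OF that] V that openin_subset topspace_eq by (metis DiffD1 subsetD)+
    define n where "n = (\<lambda>i\<in>?I. if i = k then \<one>\<^bsub>G\<^esub> else inv\<^bsub>G\<^esub> (b' i) \<otimes>\<^bsub>G\<^esub> b i)"
    have nker: "n \<in> coordinate_kernel r G k"
      unfolding ker n_def using bG k by auto
    have "n \<in> Pi\<^sub>E ?I O'"
      unfolding n_def using eq V one_O k by auto
    then have nU: "n \<in> U"
      using O'(3) W(2) nker by blast
    have "product_action r X \<phi> n y = y'"
    proof (rule PiE_ext[of _ ?I "\<lambda>i. topspace (X i)"])
      show "y' \<in> (\<Pi>\<^sub>E i\<in>?I. topspace (X i))" using yX by simp
      have comp: "product_action r X \<phi> n y i = y' i" if i: "i \<in> ?I" for i
      proof -
        interpret F: borel_flow G T "borel_of (X i)" "\<phi> i" by (rule flow[OF i])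
        have pa: "product_action r X \<phi> n y i = \<phi> i (n i) (y i)"
          using yX i by (simp add: product_action_def)
        show ?thesis
        proof (cases "i = k")
          case True
          then show ?thesis
            unfolding pa using F.act_one[OF yS(1)[OF i]] y(3) i by (simp add: n_def)
        next
          case False
          then have ik: "i \<in> ?I - {k}" using i by simp
          have "\<phi> i (n i) (y i) = \<phi> i (inv\<^bsub>G\<^esub> (b' i)) (\<phi> i (b i) (y i))"
            using F.act_mult[of "inv\<^bsub>G\<^esub> (b' i)" "b i" "y i"] bG[OF ik] yS[OF i] i False by (simp add: n_def)
          also have "\<dots> = y' i"
            using eq[OF ik] F.act_inv[OF bG(2)[OF ik] yS(2)[OF i]] by simp
          finally show ?thesis
            unfolding pa .
        qed
      qed
      then show "product_action r X \<phi> n y i = y' i" if "i \<in> ?I" for i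
        using that by simp
      have "product_action r X \<phi> n y \<in> extensional ?I"
        using yX by (simp add: product_action_def)
      then show "product_action r X \<phi> n y \<in> (\<Pi>\<^sub>E i\<in>?I. topspace (X i))"
        using comp yS(2) by (auto simp: PiE_iff)
    qed
    then have "product_action r X \<phi> n ` ?X \<inter> ?X \<noteq> {}"
      using y by blast
    then have "n = ?one"
      using U(3) nker nU by blast
    then have "n j = \<one>\<^bsub>G\<^esub>" using j by simp
    then have "inv\<^bsub>G\<^esub> (b' j) \<otimes>\<^bsub>G\<^esub> b j = \<one>\<^bsub>G\<^esub>"
      using j by (simp add: n_def)
    then show "b j = b' j"
      using bG[OF j] by (metis inv_closed inv_equality inv_inv)
  qed
qed

text \<open>Existence and uniqueness form a single equivalence, so that the joining in the last part
  is made from the very measure characterised before. The \<open>distr\<close> along the identity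
  regards it as a measure on the full product.\<close>

theorem theorem1p8:
  fixes G :: "('g, 'b) monoid_scheme" and T :: "'g topology" and m :: "'g measure"
    and r :: nat
    and X :: "nat \<Rightarrow> 'x topology" and \<phi> :: "nat \<Rightarrow> 'g \<Rightarrow> 'x \<Rightarrow> 'x"
    and Z :: "nat \<Rightarrow> 'x set" and \<mu> \<nu> :: "nat \<Rightarrow> 'x measure"
  defines "S \<equiv> intersection_borel G r X \<phi> Z"
    and "\<delta> \<equiv> diagonal_action r \<phi> (intersection_space G r X \<phi> Z)"
    and "ZZ \<equiv> (\<Pi>\<^sub>E k\<in>{1..r}. Z k)"
  assumes "1 \<le> r"
    and "lcsc_group G T" and "unimodular G T" and "haar_measure G T m"
    and "\<And>k. k \<in> {1..r} \<Longrightarrow> polish (X k)"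
    and "\<And>k. k \<in> {1..r} \<Longrightarrow> jointly_continuous_action G T (X k) (\<phi> k)"
    and "\<And>k. k \<in> {1..r} \<Longrightarrow> separated_cross_section G T (borel_of (X k)) (\<phi> k) (Z k)"
    and "\<And>k. k \<in> {1..r} \<Longrightarrow> sets (\<mu> k) = sets (borel_of (X k))"
    and "\<And>k. k \<in> {1..r} \<Longrightarrow> prob_space (\<mu> k)"
    and "\<And>k. k \<in> {1..r} \<Longrightarrow> invariant_measure G (\<phi> k) (\<mu> k)"
    and "\<And>k. k \<in> {1..r} \<Longrightarrow>
          transverse_measure G T m (borel_of (X k)) (\<phi> k) (Z k) (\<mu> k) (\<nu> k)"
    and "commensurable G T r X \<phi> Z"
  shows "borel_action G T S \<delta> \<and>
    separated_cross_section G T S \<delta> ZZ \<and>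
    (\<exists>\<mu>r.
      (\<forall>\<mu>'. (sets \<mu>' = sets S \<and> finite_measure \<mu>' \<and> invariant_measure G \<delta> \<mu>' \<and>
              transverse_measure G T m S \<delta> ZZ \<mu>' (PiM {1..r} \<nu>)) \<longleftrightarrow> \<mu>' = \<mu>r) \<and>
      ((\<forall>k\<in>{1..r}. ergodic G (\<phi> k) (\<mu> k)) \<longrightarrow>
        (\<exists>c>0. joining G r X \<phi> \<mu>
          (scale_measure (ennreal c) (distr \<mu>r (borel_of (product_space r X)) (\<lambda>x. x))))))"
proof -
  note r = assms(4) and G = assms(5) and uni = assms(6) and haar = assms(7) and polish = assms(8)
    and cont = assms(9) and sep = assms(10) and sets_\<mu> = assms(11) and prob_\<mu> = assms(12)
    and inv_\<mu> = assms(13) and tr = assms(14) and comm = assms(15)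
  note One_nat_def [simp del]
  let ?I = "{1..r}"
  let ?XR = "intersection_space G r X \<phi> Z"
  let ?Y = "borel_of (product_space r X)"
  interpret lcsc_group G T by (rule G)
  have HG: "haar_group G T m"
    by (intro haar_group.intro haar_group_axioms.intro G haar)
  have UG: "unimodular_group G T m"
    by (intro unimodular_group.intro unimodular_group_axioms.intro HG uni)
  have one_I: "1 \<in> ?I" using r by simp
  have "\<forall>k\<in>?I. \<exists>E. section_flow G T (borel_of (X k)) (\<phi> k) (Z k) (fst E) (snd E)"
  proof
    fix k assume k: "k \<in> ?I"
    obtain D \<gamma> where "section_flow G T (borel_of (X k)) (\<phi> k) (Z k) D \<gamma>"
      using return_time_enumeration[OF polish[OF k] cont[OF k] sep[OF k]] by (elim exE)
    then show "\<exists>E. section_flow G T (borel_of (X k)) (\<phi> k) (Z k) (fst E) (snd E)"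
      by (intro exI[of _ "(D, \<gamma>)"]) simp
  qed
  then obtain E where E: "\<forall>k\<in>?I. section_flow G T (borel_of (X k)) (\<phi> k) (Z k) (fst (E k)) (snd (E k))"
    by (rule bchoice[THEN exE])
  define D where "D k = fst (E k)" for k
  define \<gamma> where "\<gamma> k = snd (E k)" for k
  have flow: "section_flow G T (borel_of (X k)) (\<phi> k) (Z k) (D k) (\<gamma> k)" if "k \<in> ?I" for k
    unfolding D_def \<gamma>_def using E that by (rule bspec)
  have Z_ne: "Z k \<noteq> {}" if k: "k \<in> ?I" for k
    using sep[OF k] unfolding separated_cross_section_def by auto
  have cover: "return_set G (\<phi> k) (Z k) x \<noteq> {}" if k: "k \<in> ?I" and x: "x \<in> space (borel_of (X k))" for k x
  proof -
    interpret F: section_flow G T "borel_of (X k)" "\<phi> k" "Z k" "D k" "\<gamma> k" by (rule flow[OF k])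
    have "x \<in> (\<Union>h\<in>carrier G. \<phi> k h ` Z k)"
      using sep[OF k] x unfolding separated_cross_section_def by blast
    then obtain h z where h: "h \<in> carrier G" "z \<in> Z k" "x = \<phi> k h z" by blast
    then have "inv\<^bsub>G\<^esub> h \<in> return_set G (\<phi> k) (Z k) x"
      using F.act_inv[of h z] F.Z_space by (auto simp: return_set_def)
    then show ?thesis by blast
  qed
  have finite_\<nu>: "finite_measure (\<nu> k)" if k: "k \<in> ?I" for k
    using section_flow.transverse_finite[OF flow[OF k] HG sep[OF k] tr[OF k] sets_\<mu>[OF k]] prob_\<mu>[OF k]
    by (simp add: prob_space_def)
  interpret Q: joint_space G T m ?I "\<lambda>k. borel_of (X k)" \<phi> Z D \<gamma> \<mu> \<nu> ?Y
  proof (intro joint_space.intro joint_flow.intro UG joint_flow_axioms.intro joint_space_axioms.intro)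
    show "finite ?I" "?I \<noteq> {}" using r by auto
    show "sets (\<nu> k) = sets (restrict_space (borel_of (X k)) (Z k))" if "k \<in> ?I" for k
      using tr[OF that] unfolding transverse_measure_def by blast
    show "(\<integral>\<^sup>+x. \<integral>\<^sup>+h. F (inv\<^bsub>G\<^esub> h, \<phi> k h x) \<partial>count_space (return_set G (\<phi> k) (Z k) x) \<partial>\<mu> k) =
        (\<integral>\<^sup>+h. \<integral>\<^sup>+t. F (h, t) \<partial>\<nu> k \<partial>m)"
      if k: "k \<in> ?I" and F: "F \<in> borel_measurable (borel_of T \<Otimes>\<^sub>M restrict_space (borel_of (X k)) (Z k))" for k F
      using section_flow.transverseD[OF flow[OF k] tr[OF k] sets_\<mu>[OF k] haar_group.sets_m[OF HG] _ F]
        finite_\<nu>[OF k] section_flow.fibre_sum_def[OF flow[OF k]]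
      by (simp add: finite_measure_def)
    show "sets ?Y = sets (PiM ?I (\<lambda>k. borel_of (X k)))"
      by (intro sets_borel_of_product polish_second_countable polish) simp_all
  qed (use flow Z_ne cover sets_\<mu> prob_\<mu> finite_\<nu> in auto)
  have XR: "?XR = Q.XR"
    by (simp only: Q.XR_def intersection_space_def space_borel_of)
  have \<delta>: "\<delta> = Q.\<delta>"
    unfolding assms(2) XR by (rule ext) (simp only: diagonal_action_def Q.\<delta>_def)
  have S: "S = Q.SR"
    unfolding assms(1) intersection_borel_def XR ..
  have borel: "borel_action G T S \<delta>"
  proof -
    have "standard_borel S"
      unfolding standard_borel_def S
    proof (intro exI conjI)
      show "polish (product_space r X)"
        by (intro polish_product polish) simp_all
      show "Q.XR \<in> sets ?Y" by (rule Q.XR_sets)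
    qed (rule refl)
    moreover have "group_action G (space S) \<delta>"
      unfolding S \<delta> Q.space_SR by (rule Q.group_action_\<delta>)
    moreover have "(\<lambda>(h, s). \<delta> h s) \<in> borel_of T \<Otimes>\<^sub>M S \<rightarrow>\<^sub>M S"
      unfolding S \<delta> by (rule Q.J.measurable_action)
    ultimately show ?thesis
      using G unfolding borel_action_def by simp
  qed
  have cross: "separated_cross_section G T S \<delta> ZZ"
    unfolding separated_cross_section_def
  proof (intro conjI)
    show "ZZ \<in> sets S"
      unfolding S assms(3) by (rule Q.ZZ_sets)
    show "(\<Union>h\<in>carrier G. \<delta> h ` ZZ) = space S"
    proof (rule subset_antisym)
      show "(\<Union>h\<in>carrier G. \<delta> h ` ZZ) \<subseteq> space S"
        unfolding S \<delta> assms(3) Q.space_SR using Q.\<delta>_closed Q.ZZ_subset by auto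
      show "space S \<subseteq> (\<Union>h\<in>carrier G. \<delta> h ` ZZ)"
      proof
        fix x assume "x \<in> space S"
        then have x: "x \<in> Q.XR" unfolding S Q.space_SR .
        have h: "inv\<^bsub>G\<^esub> (Q.\<gamma>0 x) \<in> return_set G Q.\<delta> Q.ZZ x"
          by (rule Q.\<gamma>0_return[OF x])
        have "x = Q.\<delta> (Q.\<gamma>0 x) (Q.\<delta> (inv\<^bsub>G\<^esub> (Q.\<gamma>0 x)) x)"
          using Q.J.act_inv'[OF Q.\<gamma>0_closed[OF x], of x] x by (simp add: Q.space_SR)
        moreover have "Q.\<delta> (inv\<^bsub>G\<^esub> (Q.\<gamma>0 x)) x \<in> ZZ"
          using h unfolding assms(3) return_set_def by simp
        ultimately have "x \<in> Q.\<delta> (Q.\<gamma>0 x) ` ZZ"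
          by (rule image_eqI)
        then show "x \<in> (\<Union>h\<in>carrier G. \<delta> h ` ZZ)"
          unfolding \<delta> using Q.\<gamma>0_closed[OF x] by (rule UN_I[rotated])
      qed
    qed
    \<comment> \<open>A return time of the diagonal flow is also a return time of the first
      coordinate, so the neighbourhood that separates \<open>Z 1\<close> separates the
      product.\<close>
    obtain U where U: "openin T U" "\<one>\<^bsub>G\<^esub> \<in> U" "{h \<in> carrier G. \<phi> 1 h ` Z 1 \<inter> Z 1 \<noteq> {}} \<inter> U = {\<one>\<^bsub>G\<^esub>}"
      using sep[OF one_I] unfolding separated_cross_section_def by (elim conjE exE)
    have "{h \<in> carrier G. \<delta> h ` ZZ \<inter> ZZ \<noteq> {}} \<inter> U = {\<one>\<^bsub>G\<^esub>}"
    proof (rule subset_antisym)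
      show "{h \<in> carrier G. \<delta> h ` ZZ \<inter> ZZ \<noteq> {}} \<inter> U \<subseteq> {\<one>\<^bsub>G\<^esub>}"
      proof
        fix h assume "h \<in> {h \<in> carrier G. \<delta> h ` ZZ \<inter> ZZ \<noteq> {}} \<inter> U"
        then obtain z where h: "h \<in> carrier G" "h \<in> U" "z \<in> ZZ" "\<delta> h z \<in> ZZ" by blast
        have "z \<in> Q.XR"
          using h(3) Q.ZZ_subset unfolding assms(3) by blast
        then have "\<phi> 1 h (z 1) \<in> Z 1"
          using h(4) one_I unfolding \<delta> assms(3) by (auto simp: Q.\<delta>_apply PiE_iff)
        moreover have "z 1 \<in> Z 1"
          using h(3) one_I unfolding assms(3) by (auto simp: PiE_iff)
        ultimately have "h \<in> {h \<in> carrier G. \<phi> 1 h ` Z 1 \<inter> Z 1 \<noteq> {}} \<inter> U"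
          using h(1,2) by blast
        then show "h \<in> {\<one>\<^bsub>G\<^esub>}"
          unfolding U(3) .
      qed
      \<comment> \<open>The definition requires the intersection with U to equal the singleton of
        \<one>, and \<one> belongs to it only because the section is nonempty.\<close>
      have "ZZ \<noteq> {}"
        using Z_ne unfolding assms(3) by (simp add: PiE_eq_empty_iff)
      then obtain z where z: "z \<in> ZZ" by blast
      then have "\<delta> \<one>\<^bsub>G\<^esub> z = z"
        unfolding \<delta> using Q.ZZ_subset unfolding assms(3) by (intro Q.\<delta>_one) blast
      then have "\<delta> \<one>\<^bsub>G\<^esub> ` ZZ \<inter> ZZ \<noteq> {}"
        using z by (metis disjoint_iff image_eqI)
      then show "{\<one>\<^bsub>G\<^esub>} \<subseteq> {h \<in> carrier G. \<delta> h ` ZZ \<inter> ZZ \<noteq> {}} \<inter> U"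
        using U(2) by simp
    qed
    then show "\<exists>U. openin T U \<and> \<one>\<^bsub>G\<^esub> \<in> U \<and> {h \<in> carrier G. \<delta> h ` ZZ \<inter> ZZ \<noteq> {}} \<inter> U = {\<one>\<^bsub>G\<^esub>}"
      using U(1,2) by (intro exI[of _ U]) simp
  qed
  have marginal: "\<exists>c. c \<noteq> 0 \<and> (\<forall>A\<in>sets (borel_of (X k)). c * emeasure Q.\<mu>r {x \<in> Q.XR. x k \<in> A} \<le> emeasure (\<mu> k) A)"
    if k: "k \<in> ?I" for k
  proof (rule commensurable_windows[OF G _ comm k])
    show "borel_flow G T (borel_of (X j)) (\<phi> j)" if "j \<in> ?I" for j
      by (rule section_flow.axioms(1)[OF flow[OF that]])
    fix V assume V: "\<And>j. j \<in> ?I \<Longrightarrow> openin T (V j)" "\<And>j. j \<in> ?I \<Longrightarrow> \<one>\<^bsub>G\<^esub> \<in> V j"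
      and win: "\<And>b b' y y' j. y \<in> ?XR \<Longrightarrow> y' \<in> ?XR \<Longrightarrow>
        (\<And>j. j \<in> ?I - {k} \<Longrightarrow> b j \<in> V j \<and> b' j \<in> V j \<and> \<phi> j (b j) (y j) = \<phi> j (b' j) (y' j)) \<Longrightarrow>
        y k = y' k \<Longrightarrow> j \<in> ?I - {k} \<Longrightarrow> b j = b' j"
    \<comment> \<open>The constant is the product of the Haar measures of the windows. It may be
      infinite, which only strengthens the bound; what counts is that it is not 0.\<close>
    have "emeasure m (V j) \<noteq> 0" if "j \<in> ?I" for j
      using V[OF that] by (intro Q.emeasure_open_nonzero) auto
    then have "(\<Prod>j\<in>?I - {k}. emeasure m (V j)) \<noteq> 0"
      by auto
    moreover have "(\<Prod>j\<in>?I - {k}. emeasure m (V j)) * emeasure Q.\<mu>r {x \<in> Q.XR. x k \<in> A} \<le> emeasure (\<mu> k) A"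
      if "A \<in> sets (borel_of (X k))" for A
      using that by (intro Q.\<mu>r_marginal_le[OF k V(1)] win[unfolded XR])
    ultimately show "\<exists>c. c \<noteq> 0 \<and> (\<forall>A\<in>sets (borel_of (X k)).
        c * emeasure Q.\<mu>r {x \<in> Q.XR. x k \<in> A} \<le> emeasure (\<mu> k) A)"
      by (intro exI[of _ "\<Prod>j\<in>?I - {k}. emeasure m (V j)"]) simp
  qed
  have fin: "emeasure Q.\<mu>r Q.XR \<noteq> \<infinity>"
  proof -
    obtain c where c: "c \<noteq> 0"
      "\<forall>A\<in>sets (borel_of (X 1)). c * emeasure Q.\<mu>r {x \<in> Q.XR. x 1 \<in> A} \<le> emeasure (\<mu> 1) A"
      using marginal[OF one_I] by (elim exE conjE)
    \<comment> \<open>Taking the whole space for A in the first marginal bounds c times the total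
      mass by 1.\<close>
    have "{x \<in> Q.XR. x 1 \<in> space (borel_of (X 1))} = Q.XR"
      using Q.XR_closed[OF _ one_I] by auto
    then have "c * emeasure Q.\<mu>r Q.XR \<le> emeasure (\<mu> 1) (space (borel_of (X 1)))"
      using c(2)[rule_format, OF sets.top] by simp
    also have "\<dots> \<le> 1"
      by (rule prob_space.emeasure_le_1[OF prob_\<mu>[OF one_I]])
    finally show ?thesis
      using c(1) by (auto simp: ennreal_mult_top top_unique)
  qed
  have finite: "finite_measure Q.\<mu>r"
    using fin Q.space_\<mu>r by (intro finite_measureI) simp
  have invariant: "invariant_measure G Q.\<delta> Q.\<mu>r"
    unfolding invariant_measure_def using Q.\<mu>r_invariant by simp
  have unique: "(sets \<mu>' = sets S \<and> finite_measure \<mu>' \<and> invariant_measure G \<delta> \<mu>' \<and>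
      transverse_measure G T m S \<delta> ZZ \<mu>' (PiM ?I \<nu>)) \<longleftrightarrow> \<mu>' = Q.\<mu>r" for \<mu>'
    unfolding S \<delta> assms(3)
    using Q.sets_\<mu>r finite invariant Q.transverse_\<mu>r Q.transverse_imp_\<mu>r by metis
  have joining: "\<exists>c>0. joining G r X \<phi> \<mu> (scale_measure (ennreal c) (distr Q.\<mu>r ?Y (\<lambda>x. x)))"
    if erg: "\<forall>k\<in>?I. ergodic G (\<phi> k) (\<mu> k)"
  proof -
    define t where "t = emeasure Q.\<mu>r Q.XR"
    have t: "t \<noteq> 0" "t \<noteq> \<infinity>"
      unfolding t_def using Q.\<mu>r_nonzero fin by auto
    \<comment> \<open>The reciprocal of the total mass, which is neither 0 nor \<infinity>.\<close>
    define c where "c = 1 / enn2real t"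
    have t_pos: "0 < enn2real t"
      using t by (simp add: enn2real_positive_iff less_top zero_less_iff_neq_zero)
    then have c: "0 < c" by (simp add: c_def)
    have ct: "ennreal c * t = 1"
    proof -
      have "t = ennreal (enn2real t)" using t by (simp add: less_top)
      then have "ennreal c * t = ennreal (c * enn2real t)"
        using c by (metis ennreal_mult' less_imp_le)
      then show ?thesis using t_pos by (simp add: c_def)
    qed
    let ?L = "distr Q.\<mu>r ?Y (\<lambda>x. x)"
    let ?K = "scale_measure (ennreal c) ?L"
    have id: "(\<lambda>x. x) \<in> Q.\<mu>r \<rightarrow>\<^sub>M ?Y"
    proof -
      have "(\<lambda>x. x) \<in> Q.SR \<rightarrow>\<^sub>M ?Y"
        by (intro measurable_restrict_space1 measurable_ident_sets refl)
      then show ?thesis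
        by (simp add: measurable_cong_sets[OF Q.sets_\<mu>r refl])
    qed
    have L: "emeasure ?L A = emeasure Q.\<mu>r (A \<inter> Q.XR)" if "A \<in> sets ?Y" for A
      using emeasure_distr[OF id that] Q.space_\<mu>r by simp
    have K: "emeasure ?K A = ennreal c * emeasure Q.\<mu>r (A \<inter> Q.XR)" if "A \<in> sets ?Y" for A
      using L[OF that] by simp
    have sets_K: "sets ?K = sets ?Y" by simp
    have prob: "prob_space ?K"
    proof (rule prob_spaceI)
      have "space ?Y \<inter> Q.XR = Q.XR"
        using Q.XR_subset by blast
      then show "emeasure ?K (space ?K) = 1"
        using K[OF sets.top] ct by (simp add: t_def space_scale_measure)
    qed
    have inv: "invariant_measure G (diagonal_action r \<phi> (topspace (product_space r X))) ?K"
      unfolding invariant_measure_def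
    proof
      fix g assume g: "g \<in> carrier G"
      let ?d = "diagonal_action r \<phi> (topspace (product_space r X)) g"
      have d_apply: "?d x = (\<lambda>k\<in>?I. \<phi> k g (x k))" if "x \<in> space ?Y" for x
        using that by (simp add: diagonal_action_def)
      have d_meas: "?d \<in> ?Y \<rightarrow>\<^sub>M ?Y"
      proof -
        have "(\<lambda>x. \<lambda>k\<in>?I. \<phi> k g (x k)) \<in> ?Y \<rightarrow>\<^sub>M PiM ?I (\<lambda>k. borel_of (X k))"
        proof (rule measurable_restrict)
          fix k assume k: "k \<in> ?I"
          show "(\<lambda>x. \<phi> k g (x k)) \<in> ?Y \<rightarrow>\<^sub>M borel_of (X k)"
            using g by (intro Q.measurable_flow[OF k] Q.measurable_Y_component[OF k] measurable_const)
              (simp add: topspace_eq)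
        qed
        then have meas: "(\<lambda>x. \<lambda>k\<in>?I. \<phi> k g (x k)) \<in> ?Y \<rightarrow>\<^sub>M ?Y"
          by (simp add: measurable_cong_sets[OF refl Q.sets_Y])
        show ?thesis
          by (rule measurable_cong[THEN iffD2, OF d_apply meas])
      qed
      then have d_meas': "?d \<in> ?K \<rightarrow>\<^sub>M ?K"
        by (simp add: measurable_cong_sets[OF sets_K sets_K])
      show "distr ?K ?K ?d = ?K"
      proof (rule measure_eqI)
        fix A assume "A \<in> sets (distr ?K ?K ?d)"
        then have A: "A \<in> sets ?Y" by simp
        then have pre: "?d -` A \<inter> space ?Y \<in> sets ?Y"
          by (rule measurable_sets[OF d_meas])
        have A': "A \<inter> Q.XR \<in> sets Q.\<mu>r"
          unfolding Q.sets_\<mu>r Q.sets_SR using A Q.XR_sets by auto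
        have \<delta>_meas: "Q.\<delta> g \<in> Q.\<mu>r \<rightarrow>\<^sub>M Q.\<mu>r"
          using Q.measurable_\<delta>[OF g] by (simp add: measurable_cong_sets[OF Q.sets_\<mu>r Q.sets_\<mu>r])
        \<comment> \<open>The measure is concentrated on the intersection space. This set is
          invariant, and the diagonal action on the full product restricts there to
          \<open>Q.\<delta>\<close>, so invariance is inherited.\<close>
        have eq: "(?d -` A \<inter> space ?Y) \<inter> Q.XR = Q.\<delta> g -` (A \<inter> Q.XR) \<inter> space Q.\<mu>r"
        proof (rule Set.set_eqI)
          fix x
          show "x \<in> (?d -` A \<inter> space ?Y) \<inter> Q.XR \<longleftrightarrow> x \<in> Q.\<delta> g -` (A \<inter> Q.XR) \<inter> space Q.\<mu>r"
          proof (cases "x \<in> Q.XR")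
            case True
            then have "x \<in> space ?Y" using Q.XR_subset by blast
            then have "?d x = Q.\<delta> g x"
              using True by (simp only: d_apply Q.\<delta>_apply)
            then show ?thesis
              using True \<open>x \<in> space ?Y\<close> Q.\<delta>_closed[OF True g] Q.space_\<mu>r by simp
          next
            case False
            then show ?thesis using Q.space_\<mu>r by simp
          qed
        qed
        have "emeasure (distr ?K ?K ?d) A = emeasure ?K (?d -` A \<inter> space ?K)"
          using d_meas' A by (intro emeasure_distr) simp_all
        also have "\<dots> = ennreal c * emeasure Q.\<mu>r (Q.\<delta> g -` (A \<inter> Q.XR) \<inter> space Q.\<mu>r)"
          using K[OF pre] by (simp only: eq space_scale_measure space_distr)
        also have "emeasure Q.\<mu>r (Q.\<delta> g -` (A \<inter> Q.XR) \<inter> space Q.\<mu>r) = emeasure Q.\<mu>r (A \<inter> Q.XR)"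
          using emeasure_distr[OF \<delta>_meas A'] Q.\<mu>r_invariant[OF g] by simp
        finally show "emeasure (distr ?K ?K ?d) A = emeasure ?K A"
          using K[OF A] by simp
      qed simp
    qed
    have marg: "distr ?K (borel_of (X k)) (\<lambda>x. x k) = \<mu> k" if k: "k \<in> ?I" for k
    proof (rule measure_eqI)
      interpret F: section_flow G T "borel_of (X k)" "\<phi> k" "Z k" "D k" "\<gamma> k" by (rule flow[OF k])
      let ?P = "distr Q.\<mu>r (borel_of (X k)) (\<lambda>x. x k)"
      have comp: "(\<lambda>x. x k) \<in> Q.\<mu>r \<rightarrow>\<^sub>M borel_of (X k)"
        using Q.measurable_SR_component[OF k] by (simp add: measurable_cong_sets[OF Q.sets_\<mu>r refl])
      have compY: "(\<lambda>x. x k) \<in> ?K \<rightarrow>\<^sub>M borel_of (X k)"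
        using Q.measurable_Y_component[OF k] by (simp add: measurable_cong_sets[OF sets_K refl])
      have P: "emeasure ?P A = emeasure Q.\<mu>r {x \<in> Q.XR. x k \<in> A}" if "A \<in> sets (borel_of (X k))" for A
      proof -
        have "(\<lambda>x. x k) -` A \<inter> space Q.\<mu>r = {x \<in> Q.XR. x k \<in> A}"
          using Q.space_\<mu>r by auto
        then show ?thesis
          using emeasure_distr[OF comp that] by simp
      qed
      have P_space: "emeasure ?P (space ?P) = t"
      proof -
        have "{x \<in> Q.XR. x k \<in> space (borel_of (X k))} = Q.XR"
          using Q.XR_closed[OF _ k] by auto
        then show ?thesis
          using P[OF sets.top] by (simp add: t_def)
      qed
      have P_fin: "finite_measure ?P"
        using P_space t by (intro finite_measureI) simp
      have P_inv: "invariant_measure G (\<phi> k) ?P"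
        unfolding invariant_measure_def
      proof
        fix g assume g: "g \<in> carrier G"
        have meas: "\<phi> k g \<in> borel_of (X k) \<rightarrow>\<^sub>M borel_of (X k)"
          by (rule F.measurable_flow_map[OF g refl])
        have \<delta>_meas: "Q.\<delta> g \<in> Q.\<mu>r \<rightarrow>\<^sub>M Q.\<mu>r"
          using Q.measurable_\<delta>[OF g] by (simp add: measurable_cong_sets[OF Q.sets_\<mu>r Q.sets_\<mu>r])
        have "distr ?P ?P (\<phi> k g) = distr ?P (borel_of (X k)) (\<phi> k g)"
          by (rule distr_cong) simp_all
        also have "\<dots> = distr Q.\<mu>r (borel_of (X k)) (\<phi> k g \<circ> (\<lambda>x. x k))"
          by (rule distr_distr[OF meas comp])
        also have "\<dots> = distr Q.\<mu>r (borel_of (X k)) ((\<lambda>x. x k) \<circ> Q.\<delta> g)"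
          using k Q.space_\<mu>r by (intro distr_cong) (simp_all add: Q.\<delta>_apply)
        also have "\<dots> = distr (distr Q.\<mu>r Q.\<mu>r (Q.\<delta> g)) (borel_of (X k)) (\<lambda>x. x k)"
          by (rule distr_distr[OF comp \<delta>_meas, symmetric])
        also have "\<dots> = ?P"
          by (simp only: Q.\<mu>r_invariant[OF g])
        finally show "distr ?P ?P (\<phi> k g) = ?P" .
      qed
      obtain d where d: "d \<noteq> 0"
        "\<forall>A\<in>sets (borel_of (X k)). d * emeasure Q.\<mu>r {x \<in> Q.XR. x k \<in> A} \<le> emeasure (\<mu> k) A"
        using marginal[OF k] by (elim exE conjE)
      fix A assume "A \<in> sets (distr ?K (borel_of (X k)) (\<lambda>x. x k))"
      then have A: "A \<in> sets (borel_of (X k))" by simp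
      \<comment> \<open>The unnormalised k-th marginal is invariant and dominated by a multiple of
        the ergodic measure \<mu>_k, hence equal to t times it; the factor c then cancels t.\<close>
      have "emeasure ?P A = emeasure ?P (space ?P) * emeasure (\<mu> k) A"
        using d(2) P
        by (intro unimodular_group.ergodic_dominated[OF UG F.borel_flow_axioms sets_\<mu>[OF k] prob_\<mu>[OF k]
              inv_\<mu>[OF k] bspec[OF erg k] _ P_fin P_inv d(1) _ A]) simp_all
      then have PA: "emeasure Q.\<mu>r {x \<in> Q.XR. x k \<in> A} = t * emeasure (\<mu> k) A"
        using P[OF A] P_space by simp
      have "emeasure (distr ?K (borel_of (X k)) (\<lambda>x. x k)) A = emeasure ?K ((\<lambda>x. x k) -` A \<inter> space ?Y)"
        using emeasure_distr[OF compY A] by (simp only: space_scale_measure space_distr)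
      also have "\<dots> = ennreal c * emeasure Q.\<mu>r (((\<lambda>x. x k) -` A \<inter> space ?Y) \<inter> Q.XR)"
        by (rule K[OF measurable_sets[OF Q.measurable_Y_component[OF k] A]])
      also have "((\<lambda>x. x k) -` A \<inter> space ?Y) \<inter> Q.XR = {x \<in> Q.XR. x k \<in> A}"
        using Q.XR_subset by auto
      finally show "emeasure (distr ?K (borel_of (X k)) (\<lambda>x. x k)) A = emeasure (\<mu> k) A"
        unfolding PA by (simp add: mult.assoc[symmetric] ct)
    qed (simp add: sets_\<mu>[OF k])
    show ?thesis
      using c sets_K prob inv marg unfolding joining_def by (intro exI[of _ c]) simp
  qed
  show ?thesis
    using borel cross unique joining by (intro conjI exI[of _ Q.\<mu>r]) simp_all
qed

end
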